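(* Let $k\ge 1$ be an integer and let $G$ be a finite simple $2$-connected non-bipartite graph. If the minimum degree of $G$ is at least $k+1$, then $G$ contains $\lceil k/2\rceil$ cycles with consecutive odd lengths, i.e. there is an odd integer $\ell$ such that $G$ contains, for each $i\in\{0,1,\dots,\lceil k/2\rceil-1\}$, a cycle of length $\ell+2i$.
   Context: All graphs are finite, simple and undirected. The length of a cycle is its number of edges. *)

theory Defs
  imports "Graph_Theory.Graph_Theory"
begin

text \<open>
  Finite simple undirected graphs are given by the locale \<^locale>\<open>graph\<close>: every edge is
  represented by a pair of mutually reverse arcs, without loops or parallel arcs. Hence the
  out-degree of a vertex is its degree.
\<close>

definition min_degree :: "('a, 'b) pre_digraph \<Rightarrow> nat" where
  "min_degree G = Min (out_degree G ` verts G)"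

definition vertex_connected :: "nat \<Rightarrow> ('a, 'b) pre_digraph \<Rightarrow> bool" where
  "vertex_connected k G \<longleftrightarrow>
     k < card (verts G) \<and>
     (\<forall>X \<subseteq> verts G. card X < k \<longrightarrow> Digraph_Component.connected (G \<restriction> (verts G - X)))"

definition bipartite :: "('a, 'b) pre_digraph \<Rightarrow> bool" where
  "bipartite G \<longleftrightarrow>
     (\<exists>A B. A \<union> B = verts G \<and> A \<inter> B = {} \<and>
        (\<forall>(u, v) \<in> arcs_ends G. u \<in> A \<and> v \<in> B \<or> u \<in> B \<and> v \<in> A))"

text \<open>
  \<^const>\<open>pre_digraph.cycle\<close> also holds for the closed walk of length 2 that traverses one edge back
  and forth, which is not a cycle of the undirected graph; hence the lower bound on the length.
\<close>

definition has_cycle_of_length :: "('a, 'b) pre_digraph \<Rightarrow> nat \<Rightarrow> bool" where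
  "has_cycle_of_length G n \<longleftrightarrow> (\<exists>p. pre_digraph.cycle G p \<and> length p = n \<and> 3 \<le> n)"

end

theory Submission
  imports Defs
begin

text \<open>
  Put \<open>m = \<lceil>k/2\<rceil>\<close>; it suffices to use minimum degree at least \<open>2m\<close>.

  The engine is a rooted statement: if adding the edge \<open>xy\<close> makes the graph 2-connected and every
  vertex other than \<open>x\<close>, \<open>y\<close> and one exceptional vertex \<open>z\<close> has degree at least \<open>k + 1\<close>, then the
  lengths of the \<open>x\<close>-\<open>y\<close> paths contain \<open>k\<close> consecutive integers or \<open>\<lfloor>k/2\<rfloor> + 1\<close> terms of an
  arithmetic progression with difference 2. In a minimal counterexample one contracts a small core at
  \<open>x\<close> (a clique, a 4-cycle, or the star at \<open>x\<close>) and applies induction; the different path lengths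
  inside the core make up for the degrees lost by the contraction.

  For the theorem itself, a 2-cut is treated by applying the rooted statement to one side and choosing
  the parity on the other side. If the graph is 3-connected and has a triangle, a core around it
  produces \<open>2m\<close> consecutive cycle lengths. If it is triangle-free and \<open>m \<ge> 3\<close>, a shortest odd cycle
  closes up families of paths in the components of its complement, its two arcs providing either
  parity. For \<open>m = 2\<close> one finds an even cycle \<open>Q\<close> whose complement is a connected graph containing an
  odd cycle; two vertices of \<open>Q\<close> whose arcs differ by 2 in length are then joined by a path of the
  required parity outside \<open>Q\<close>.
\<close>

section \<open>Paths and connected sets\<close>

text \<open>Induction yields path lengths of unknown parity, and in a bipartite piece all of them
  share one parity; hence the second alternative of the rooted statement. For k = 2m - 1 either
  alternative contains m terms of difference 2, which a single closing path of suitable parity turns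
  into m odd cycles, and non-bipartiteness supplies that path. The exceptional vertex closes the
  induction: cutting along a small separator damages the degree of a separator vertex, which can
  then take over the role of z. A clique on c vertices costs c - 2 in degree and offers the lengths
  1 to c - 1; a 4-cycle costs 2 and offers the lengths 1 and 3. The case m = 2 stands apart because
  sums of families are too short there: two families of 2m - 2 consecutive lengths combine to 4m - 5
  of them, which reaches 2m only for m >= 3.\<close>

definition sgr :: "('a \<Rightarrow> 'a \<Rightarrow> bool) \<Rightarrow> bool" where
  "sgr E \<longleftrightarrow> (\<forall>a b. E a b \<longrightarrow> E b a) \<and> (\<forall>a. \<not> E a a)"

lemma sgr_sym: "sgr E \<Longrightarrow> E a b \<Longrightarrow> E b a" and sgr_irrefl: "sgr E \<Longrightarrow> \<not> E a a"
  by (auto simp: sgr_def)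

lemma sgr_neq: "sgr E \<Longrightarrow> E a b \<Longrightarrow> a \<noteq> b"
  by (auto simp: sgr_def)

definition pth :: "('a \<Rightarrow> 'a \<Rightarrow> bool) \<Rightarrow> 'a set \<Rightarrow> 'a \<Rightarrow> 'a list \<Rightarrow> 'a \<Rightarrow> bool" where
  "pth E S x p y \<longleftrightarrow> p \<noteq> [] \<and> hd p = x \<and> last p = y \<and> distinct p \<and> set p \<subseteq> S \<and> successively E p"

definition pl :: "('a \<Rightarrow> 'a \<Rightarrow> bool) \<Rightarrow> 'a set \<Rightarrow> 'a \<Rightarrow> 'a \<Rightarrow> nat \<Rightarrow> bool" where
  "pl E S x y n \<longleftrightarrow> (\<exists>p. pth E S x p y \<and> length p = Suc n)"

definition con :: "('a \<Rightarrow> 'a \<Rightarrow> bool) \<Rightarrow> 'a set \<Rightarrow> 'a \<Rightarrow> 'a \<Rightarrow> bool" where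
  "con E S x y \<longleftrightarrow> (\<exists>p. pth E S x p y)"

definition compo :: "('a \<Rightarrow> 'a \<Rightarrow> bool) \<Rightarrow> 'a set \<Rightarrow> 'a \<Rightarrow> 'a set" where
  "compo E S x = {y. con E S x y}"

lemma pth_mono: "pth E S x p y \<Longrightarrow> S \<subseteq> T \<Longrightarrow> pth E T x p y"
  by (auto simp: pth_def)

lemma pl_mono: "pl E S x y n \<Longrightarrow> S \<subseteq> T \<Longrightarrow> pl E T x y n"
  unfolding pl_def using pth_mono by metis

lemma con_mono: "con E S x y \<Longrightarrow> S \<subseteq> T \<Longrightarrow> con E T x y"
  unfolding con_def using pth_mono by metis

lemma con_pl: "con E S x y \<longleftrightarrow> (\<exists>n. pl E S x y n)"
proof
  assume "con E S x y"
  then obtain p where p: "pth E S x p y" by (auto simp: con_def)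
  then have "length p = Suc (length p - 1)" by (cases p) (auto simp: pth_def)
  with p show "\<exists>n. pl E S x y n" unfolding pl_def by blast
qed (auto simp: con_def pl_def)

lemma pth_refl: "x \<in> S \<Longrightarrow> pth E S x [x] x"
  by (auto simp: pth_def)

lemma pl_refl: "x \<in> S \<Longrightarrow> pl E S x x 0"
  using pth_refl unfolding pl_def by fastforce

lemma con_refl: "x \<in> S \<Longrightarrow> con E S x x"
  using pth_refl unfolding con_def by fastforce

lemma pl_in: assumes "pl E S x y n" shows "x \<in> S" "y \<in> S"
  using assms unfolding pl_def pth_def by (metis hd_in_set subsetD, metis last_in_set subsetD)

lemma con_in: assumes "con E S x y" shows "x \<in> S" "y \<in> S"
  using assms pl_in[of E S x y] by (auto simp: con_pl)

lemma pl_0: "pl E S x y 0 \<Longrightarrow> x = y"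
  unfolding pl_def pth_def by (auto simp: length_Suc_conv)

lemma pl_edge: "E x y \<Longrightarrow> x \<noteq> y \<Longrightarrow> pl E {x,y} x y 1"
  unfolding pl_def pth_def by (rule exI[of _ "[x,y]"]) auto

lemma pl_edgeI: "sgr E \<Longrightarrow> E x y \<Longrightarrow> x \<in> S \<Longrightarrow> y \<in> S \<Longrightarrow> pl E S x y 1"
  using pl_mono[OF pl_edge[of E x y], of S] sgr_neq[of E x y] by simp

lemma pth_rev: assumes "sgr E" "pth E S x p y" shows "pth E S y (rev p) x"
proof -
  have "successively (\<lambda>a b. E b a) p"
    by (rule successively_mono[of E p]) (use assms sgr_sym[of E] in \<open>simp_all add: pth_def\<close>)
  then have "successively E (rev p)" by (simp add: successively_rev)
  with assms show ?thesis by (auto simp: pth_def hd_rev last_rev)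
qed

lemma pl_sym: "sgr E \<Longrightarrow> pl E S x y n \<Longrightarrow> pl E S y x n"
  unfolding pl_def using pth_rev[of E S x _ y] by (metis length_rev)

lemma con_sym: "sgr E \<Longrightarrow> con E S x y \<Longrightarrow> con E S y x"
  unfolding con_pl using pl_sym[of E S x y] by blast

lemma pth_append:
  assumes "pth E S x p c" "pth E T c q y" "set p \<inter> set q \<subseteq> {c}"
  shows "pth E (S \<union> T) x (p @ tl q) y \<and> length (p @ tl q) = length p + length q - 1"
proof -
  obtain q' where q: "q = c # q'" using assms(2) by (cases q) (auto simp: pth_def)
  have "c \<notin> set q'" using assms(2) by (auto simp: pth_def q)
  moreover have "c \<in> set p" using assms(1) unfolding pth_def using last_in_set by blast
  ultimately have d: "set p \<inter> set q' = {}" using assms(3) q by auto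
  have s: "successively E (p @ q')"
  proof (cases q')
    case Nil then show ?thesis using assms(1) by (simp add: pth_def)
  next
    case (Cons a l)
    then show ?thesis using assms(1,2) by (auto simp: pth_def successively_append_iff q)
  qed
  have l: "last (p @ q') = y"
    using assms(1,2) by (cases "q' = []") (auto simp: pth_def q)
  show ?thesis using assms d s l by (auto simp: pth_def q)
qed

lemma pl_append:
  assumes "pl E S x c n" "pl E T c y r" "S \<inter> T \<subseteq> {c}"
  shows "pl E (S \<union> T) x y (n + r)"
proof -
  obtain p q where p: "pth E S x p c" "length p = Suc n" and q: "pth E T c q y" "length q = Suc r"
    using assms(1,2) by (auto simp: pl_def)
  have "set p \<inter> set q \<subseteq> {c}" using p q assms(3) by (auto simp: pth_def)
  from pth_append[OF p(1) q(1) this] p(2) q(2) show ?thesis unfolding pl_def by fastforce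
qed

lemma pl_append':
  assumes "pl E S x c n" "pl E T c y r" "S \<inter> T \<subseteq> {c}" "S \<union> T \<subseteq> U" "m = n + r"
  shows "pl E U x y m"
  using pl_mono[OF pl_append[OF assms(1-3)] assms(4)] assms(5) by simp

lemma pth_split:
  assumes "pth E S x p y" "v \<in> set p"
  obtains p1 p2 where "p = p1 @ v # p2" "pth E S x (p1 @ [v]) v" "pth E S v (v # p2) y"
proof -
  obtain p1 p2 where p: "p = p1 @ v # p2" using assms(2) by (meson split_list)
  have "successively E ((p1 @ [v]) @ p2)" using assms(1) unfolding pth_def p by simp
  then have "successively E (p1 @ [v])" unfolding successively_append_iff by blast
  then have "pth E S x (p1 @ [v]) v" using assms(1) unfolding pth_def p
    by (cases p1) auto
  moreover have "pth E S v (v # p2) y" using assms(1) unfolding pth_def p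
    by (auto simp: successively_append_iff)
  ultimately show ?thesis using p that by blast
qed

lemma con_step:
  assumes "sgr E" "con E S x b" "E b c" "c \<in> S"
  shows "con E S x c"
proof -
  obtain p where p: "pth E S x p b" using assms by (auto simp: con_def)
  show ?thesis
  proof (cases "c \<in> set p")
    case True then show ?thesis using pth_split[OF p] unfolding con_def by metis
  next
    case False
    have "pth E {b,c} b [b,c] c" using assms sgr_neq[of E b c] by (auto simp: pth_def)
    from pth_append[OF p this] False have "pth E (S \<union> {b,c}) x (p @ tl [b,c]) c" by auto
    moreover have "S \<union> {b,c} = S" using con_in[OF assms(2)] assms(4) by auto
    ultimately show ?thesis unfolding con_def by metis
  qed
qed

lemma con_trans:
  assumes "sgr E" "con E S x y" "con E S y z"
  shows "con E S x z"
proof -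
  obtain q where q: "pth E S y q z" using assms(3) by (auto simp: con_def)
  have "con E S x z" if "con E S x y" "q \<noteq> []" "hd q = y" "last q = z" "set q \<subseteq> S" "successively E q" for q y
    using that
  proof (induction q arbitrary: y)
    case Nil then show ?case by simp
  next
    case (Cons a q)
    show ?case
    proof (cases q)
      case Nil then show ?thesis using Cons by simp
    next
      case (Cons b r)
      then have "con E S x b" using con_step[OF assms(1) Cons.prems(1), of b] Cons.prems by auto
      then show ?thesis using Cons.IH[of b] Cons.prems Cons by auto
    qed
  qed
  then show ?thesis using assms(2) q by (auto simp: pth_def)
qed

lemma compo_self: "x \<in> S \<Longrightarrow> x \<in> compo E S x"
  by (simp add: compo_def con_refl)

lemma compo_sub: "compo E S x \<subseteq> S"
  using con_in(2)[of E S x] by (auto simp: compo_def)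

lemma compo_closed: "sgr E \<Longrightarrow> a \<in> compo E S x \<Longrightarrow> b \<in> S \<Longrightarrow> E a b \<Longrightarrow> b \<in> compo E S x"
  unfolding compo_def using con_step[of E S x a b] by simp

text \<open>The subgraph induced by \<open>C\<close> is connected: every nonempty subset avoiding the base point \<open>y\<close> has a
  neighbour in the rest of \<open>C\<close>.\<close>

definition cset :: "('a \<Rightarrow> 'a \<Rightarrow> bool) \<Rightarrow> 'a set \<Rightarrow> 'a \<Rightarrow> bool" where
  "cset E C y \<longleftrightarrow> y \<in> C \<and> (\<forall>K. K \<noteq> {} \<longrightarrow> K \<subseteq> C - {y} \<longrightarrow> (\<exists>a\<in>K. \<exists>b\<in>C-K. E a b))"

lemma csetD: "cset E C y \<Longrightarrow> K \<noteq> {} \<Longrightarrow> K \<subseteq> C \<Longrightarrow> y \<notin> K \<Longrightarrow> \<exists>a\<in>K. \<exists>b\<in>C-K. E a b"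
  unfolding cset_def by (simp add: subset_Diff_insert)

lemma cset_con: assumes "sgr E" "cset E C y" "u \<in> C" shows "con E C u y"
proof (rule ccontr)
  assume n: "\<not> con E C u y"
  let ?K = "compo E C u"
  have "y \<notin> ?K" using n by (simp add: compo_def)
  then obtain a b where "a \<in> ?K" "b \<in> C - ?K" "E a b"
    using csetD[OF assms(2), of ?K] compo_self[OF assms(3), of E] compo_sub[of E C u] by blast
  then show False using compo_closed[OF assms(1), of a C u b] by blast
qed

lemma con_csetI:
  assumes "sgr E" "y \<in> C" "\<And>u. u \<in> C \<Longrightarrow> con E C u y" shows "cset E C y"
  unfolding cset_def
proof (intro conjI allI impI assms(2))
  fix K assume K: "K \<noteq> {}" "K \<subseteq> C - {y}"
  then obtain u where u: "u \<in> K" by blast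
  then obtain p where p: "pth E C u p y" using assms(3) K by (fastforce simp: con_def)
  have "\<exists>a\<in>K. \<exists>b\<in>C-K. E a b"
    if "p \<noteq> []" "hd p \<in> K" "last p \<notin> K" "set p \<subseteq> C" "successively E p" for p
    using that
  proof (induction p)
    case Nil then show ?case by simp
  next
    case (Cons a p)
    show ?case
    proof (cases p)
      case Nil then show ?thesis using Cons by simp
    next
      case (Cons b r)
      then show ?thesis using Cons.IH Cons.prems by (cases "b \<in> K") auto
    qed
  qed
  from this[of p] show "\<exists>a\<in>K. \<exists>b\<in>C-K. E a b" using p u K by (auto simp: pth_def)
qed

lemma cset_compo: assumes "sgr E" "y \<in> S" shows "cset E (compo E S y) y"
proof (rule con_csetI[OF assms(1) compo_self[OF assms(2)]])
  fix u assume "u \<in> compo E S y"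
  then obtain p where p: "pth E S y p u" by (auto simp: compo_def con_def)
  have "set p \<subseteq> compo E S y"
  proof
    fix v assume "v \<in> set p"
    then show "v \<in> compo E S y" using pth_split[OF p] by (metis compo_def con_def mem_Collect_eq)
  qed
  then have "con E (compo E S y) y u" using p by (auto simp: pth_def con_def)
  then show "con E (compo E S y) u y" by (rule con_sym[OF assms(1)])
qed

lemma cset_any: assumes "sgr E" "cset E C y" "u \<in> C" shows "cset E C u"
proof (rule con_csetI[OF assms(1,3)])
  fix v assume "v \<in> C"
  then have "con E C v y" "con E C y u"
    using cset_con[OF assms(1,2)] con_sym[OF assms(1)] assms(3) by auto
  then show "con E C v u" by (rule con_trans[OF assms(1)])
qed

text \<open>A failed connection is turned into a set that no edge leaves within \<open>S\<close>;
  together with the vertices removed before, this set contradicts a connectivity hypothesis.\<close>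

lemma con_or_sep:
  assumes "sgr E" "x \<in> S"
  shows "con E S x y \<or> (\<exists>R. x \<in> R \<and> R \<subseteq> S \<and> y \<notin> R \<and> (\<forall>a\<in>R. \<forall>b\<in>S. E a b \<longrightarrow> b \<in> R))"
proof (cases "con E S x y")
  case False
  then have "y \<notin> compo E S x" by (simp add: compo_def)
  moreover have "\<forall>a\<in>compo E S x. \<forall>b\<in>S. E a b \<longrightarrow> b \<in> compo E S x"
    using compo_closed[OF assms(1), of _ S x] by blast
  ultimately show ?thesis using compo_self[OF assms(2)] compo_sub[of E S x] by blast
qed auto

text \<open>Rooted connectivity: every set of non-roots has at least two outer neighbours, that is,
  adding the edge between the roots makes the graph 2-connected.\<close>

definition conn2 :: "('a \<Rightarrow> 'a \<Rightarrow> bool) \<Rightarrow> 'a set \<Rightarrow> 'a \<Rightarrow> 'a \<Rightarrow> bool" where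
  "conn2 E V x y \<longleftrightarrow>
     (\<forall>K c. K \<noteq> {} \<longrightarrow> K \<subseteq> V - {x,y} \<longrightarrow> (\<exists>a\<in>K. \<exists>b\<in>V-K. b \<noteq> c \<and> E a b))"

lemma conn2I:
  assumes "\<And>K c. K \<noteq> {} \<Longrightarrow> K \<subseteq> V \<Longrightarrow> x \<notin> K \<Longrightarrow> y \<notin> K \<Longrightarrow>
    (\<And>a b. a \<in> K \<Longrightarrow> b \<in> V \<Longrightarrow> E a b \<Longrightarrow> b \<in> K \<or> b = c) \<Longrightarrow> False"
  shows "conn2 E V x y"
  unfolding conn2_def
proof (intro allI impI, rule ccontr)
  fix K c assume K: "K \<noteq> {}" "K \<subseteq> V - {x,y}" and n: "\<not> (\<exists>a\<in>K. \<exists>b\<in>V-K. b \<noteq> c \<and> E a b)"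
  show False by (rule assms[of K c]) (use K n in blast)+
qed

lemma conn2D:
  assumes "conn2 E V x y" "K \<noteq> {}" "K \<subseteq> V" "x \<notin> K" "y \<notin> K"
  shows "\<exists>a\<in>K. \<exists>b\<in>V. b \<notin> K \<and> b \<noteq> c \<and> E a b"
proof -
  have "K \<subseteq> V - {x,y}" using assms by auto
  then show ?thesis using assms(1,2) unfolding conn2_def by (meson Diff_iff)
qed

lemma conn2_swap: "conn2 E V x y \<Longrightarrow> conn2 E V y x"
  unfolding conn2_def by (simp add: insert_commute)

text \<open>For even \<open>k\<close> the inclusive bound gives k/2 + 1 terms, one more than the k/2
  terms of difference 2 contained in k consecutive numbers; \<open>pair_ap1\<close> relies on this
  surplus.\<close>

definition fam :: "nat \<Rightarrow> (nat \<Rightarrow> bool) \<Rightarrow> bool" where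
  "fam k P \<longleftrightarrow> (\<exists>l. \<forall>i<k. P (l + i)) \<or> (\<exists>l. \<forall>i\<le>k div 2. P (l + 2 * i))"

lemma famI1: "(\<And>i. i < k \<Longrightarrow> P (l + i)) \<Longrightarrow> fam k P" by (auto simp: fam_def)
lemma famI2: "(\<And>i. i \<le> k div 2 \<Longrightarrow> P (l + 2 * i)) \<Longrightarrow> fam k P" by (auto simp: fam_def)

lemma fam_shift: assumes "fam k P" "\<And>n. P n \<Longrightarrow> Q (n + c)" shows "fam k Q"
  using assms(1) unfolding fam_def
proof (elim disjE exE)
  fix l assume "\<forall>i<k. P (l + i)"
  then have "\<forall>i<k. Q (l + i + c)" using assms(2) by blast
  then have "\<forall>i<k. Q (l + c + i)" by (simp add: ac_simps)
  then show "(\<exists>l. \<forall>i<k. Q (l + i)) \<or> (\<exists>l. \<forall>i\<le>k div 2. Q (l + 2 * i))" by blast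
next
  fix l assume "\<forall>i\<le>k div 2. P (l + 2 * i)"
  then have "\<forall>i\<le>k div 2. Q (l + 2 * i + c)" using assms(2) by blast
  then have "\<forall>i\<le>k div 2. Q (l + c + 2 * i)" by (simp add: ac_simps)
  then show "(\<exists>l. \<forall>i<k. Q (l + i)) \<or> (\<exists>l. \<forall>i\<le>k div 2. Q (l + 2 * i))" by blast
qed

lemma fam_mono: "fam k P \<Longrightarrow> (\<And>n. P n \<Longrightarrow> Q n) \<Longrightarrow> fam k Q"
  using fam_shift[of k P Q 0] by simp

text \<open>Adding 1, ..., r to k' consecutive numbers gives k' + r - 1 of them. In the progression
  with difference 2 the gaps are filled since r >= 2, and its \<open>k' div 2 + 1\<close> terms give
  2(k' div 2) + r numbers, again at least k' + r - 1.\<close>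

lemma fam_clique:
  assumes "fam k' P" "\<And>n l. P n \<Longrightarrow> 1 \<le> l \<Longrightarrow> l \<le> r \<Longrightarrow> Q (n + l)" "2 \<le> r" "k \<le> k' + r - 1" "1 \<le> k'"
  shows "\<exists>l. \<forall>i<k. Q (l + i)"
  using assms(1) unfolding fam_def
proof (elim disjE exE)
  fix l assume P: "\<forall>i<k'. P (l + i)"
  have "Q (l + 1 + j)" if j: "j < k" for j
  proof (cases "j < k'")
    case True then show ?thesis using assms(2)[of "l+j" 1] P assms(3) by (simp add: algebra_simps)
  next
    case False
    have "k' - 1 < k'" using assms(5) by simp
    then have "P (l + (k' - 1))" using P by blast
    then have "Q (l + (k' - 1) + (j - (k' - 1) + 1))"
      by (rule assms(2)) (use assms(3-5) j False in auto)
    moreover have "l + (k' - 1) + (j - (k' - 1) + 1) = l + 1 + j" using False assms(5) by simp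
    ultimately show ?thesis by metis
  qed
  then show ?thesis by blast
next
  fix l assume P: "\<forall>i\<le>k' div 2. P (l + 2 * i)"
  have "Q (l + 1 + j)" if j: "j < k" for j
  proof (cases "j \<le> 2 * (k' div 2) + 1")
    case True
    then have "P (l + 2 * (j div 2))" using P by auto
    then have "Q (l + 2 * (j div 2) + (j mod 2 + 1))"
      by (rule assms(2)) (use assms(3) in linarith)+
    moreover have "l + 2 * (j div 2) + (j mod 2 + 1) = l + 1 + j" by presburger
    ultimately show ?thesis by metis
  next
    case False
    have "P (l + 2 * (k' div 2))" using P by blast
    then have "Q (l + 2 * (k' div 2) + (j - 2 * (k' div 2) + 1))"
      by (rule assms(2)) (use False j assms(4,5) in linarith)+
    moreover have "l + 2 * (k' div 2) + (j - 2 * (k' div 2) + 1) = l + 1 + j" using False by linarith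
    ultimately show ?thesis by metis
  qed
  then show ?thesis by blast
qed

text \<open>Two summands that differ by 2 prolong an interval of at least two numbers by 2 and a
  progression by one term, and \<open>(k' + 2) div 2 = k' div 2 + 1\<close>.\<close>

lemma fam_two:
  assumes "fam k' P" "\<And>n. P n \<Longrightarrow> Q (n + a) \<and> Q (n + a + 2)" "2 \<le> k'"
  shows "fam (k' + 2) Q"
  using assms(1) unfolding fam_def
proof (elim disjE exE)
  fix l assume P: "\<forall>i<k'. P (l + i)"
  have "Q (l + a + j)" if j: "j < k' + 2" for j
  proof (cases "j < k'")
    case True then show ?thesis using assms(2)[of "l+j"] P by (simp add: algebra_simps)
  next
    case False
    have "j - 2 < k'" using j False assms(3) by auto
    then have "P (l + (j - 2))" using P by blast
    moreover have "l + (j - 2) + a + 2 = l + a + j" using False assms(3) by simp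
    ultimately show ?thesis using assms(2)[of "l+(j-2)"] by metis
  qed
  then show "(\<exists>l. \<forall>i<k' + 2. Q (l + i)) \<or> (\<exists>l. \<forall>i\<le>(k' + 2) div 2. Q (l + 2 * i))" by blast
next
  fix l assume P: "\<forall>i\<le>k' div 2. P (l + 2 * i)"
  have "Q (l + a + 2 * j)" if j: "j \<le> (k' + 2) div 2" for j
  proof (cases "j \<le> k' div 2")
    case True then show ?thesis using assms(2)[of "l+2*j"] P by (simp add: algebra_simps)
  next
    case False
    then have "j = k' div 2 + 1" using j by simp
    then show ?thesis using assms(2)[of "l+2*(k' div 2)"] P by (simp add: algebra_simps)
  qed
  then show "(\<exists>l. \<forall>i<k' + 2. Q (l + i)) \<or> (\<exists>l. \<forall>i\<le>(k' + 2) div 2. Q (l + 2 * i))" by blast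
qed

section \<open>Two disjoint paths between two sets\<close>

lemma con_last:
  assumes "con E S a s" "a \<noteq> s"
  obtains w where "con E (S - {s}) a w" "E w s"
proof -
  obtain p where p: "pth E S a p s" using assms(1) by (auto simp: con_def)
  then obtain q where q: "p = q @ [s]" by (metis append_butlast_last_id pth_def)
  have "q \<noteq> []" using p assms(2) by (auto simp: pth_def q)
  then have "pth E (S - {s}) a q (last q)" "E (last q) s"
    using p by (auto simp: pth_def q successively_append_iff)
  then show ?thesis using that by (auto simp: con_def)
qed

lemma con_compo: assumes "sgr E" "con E S a b" shows "con E (compo E S a) a b"
proof -
  have "b \<in> compo E S a" using assms(2) by (simp add: compo_def)
  then have "con E (compo E S a) b a"
    by (rule cset_con[OF assms(1) cset_compo[OF assms(1) con_in(1)[OF assms(2)]]])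
  then show ?thesis by (rule con_sym[OF assms(1)])
qed

text \<open>A path is cut at its first vertex in \<open>B\<close>; the connection then meets
  \<open>B\<close> only in \<open>b'\<close>, so that it can be continued inside
  \<open>B\<close>.\<close>

lemma first_hit:
  assumes "con E S a b" "b \<in> B"
  obtains b' where "b' \<in> B" "con E (S - (B - {b'})) a b'"
proof -
  obtain p where p: "pth E S a p b" using assms(1) by (auto simp: con_def)
  then have "\<exists>v\<in>set p. v \<in> B" using assms(2) by (metis pth_def last_in_set)
  then obtain p1 v p2 where s: "p = p1 @ v # p2" "v \<in> B" "\<forall>u\<in>set p1. u \<notin> B"
    using split_list_first_prop[of p "\<lambda>v. v \<in> B"] by blast
  have "successively E ((p1 @ [v]) @ p2)" using p s by (simp add: pth_def)
  then have "successively E (p1 @ [v])" unfolding successively_append_iff by blast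
  then have "pth E (S - (B - {v})) a (p1 @ [v]) v"
    using p s by (cases p1) (auto simp: pth_def)
  then show ?thesis using that s(2) by (auto simp: con_def)
qed

lemma con_exit:
  assumes "sgr E" "con E S a b" "a \<in> W" "b \<notin> W"
  obtains c d where "c \<in> W" "d \<notin> W" "c \<in> S" "d \<in> S" "E c d"
proof -
  have b: "b \<in> S" "a \<in> S" using con_in[OF assms(2)] by auto
  have "cset E (compo E S b) b" by (rule cset_compo[OF assms(1) b(1)])
  moreover have "a \<in> compo E S b" using con_sym[OF assms(1,2)] by (simp add: compo_def)
  ultimately obtain c d where "c \<in> W \<inter> compo E S b" "d \<in> compo E S b - W" "E c d"
    using csetD[of E "compo E S b" b "W \<inter> compo E S b"] assms(3,4) by auto
  then show ?thesis using that compo_sub[of E S b] by blast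
qed

text \<open>A graph given by a set of pairs, so that Menger's theorem for two paths can be proved by
  induction on the edges.\<close>

definition eF :: "('a \<times> 'a) set \<Rightarrow> 'a \<Rightarrow> 'a \<Rightarrow> bool" where
  "eF F a b \<longleftrightarrow> a \<noteq> b \<and> ((a,b) \<in> F \<or> (b,a) \<in> F)"

lemma sgr_eF: "sgr (eF F)" by (auto simp: sgr_def eF_def)

lemma con_eF_mono: "con (eF F) S a b \<Longrightarrow> F \<subseteq> G \<Longrightarrow> con (eF G) S a b"
proof -
  assume c: "con (eF F) S a b" and FG: "F \<subseteq> G"
  obtain p where p: "pth (eF F) S a p b" using c by (auto simp: con_def)
  then have "successively (eF F) p" by (simp add: pth_def)
  then have "successively (eF G) p" by (rule successively_mono) (use FG in \<open>auto simp: eF_def\<close>)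
  then have "pth (eF G) S a p b" using p by (simp add: pth_def)
  then show ?thesis by (auto simp: con_def)
qed

definition sepless :: "('a \<times> 'a) set \<Rightarrow> 'a set \<Rightarrow> 'a set \<Rightarrow> bool" where
  "sepless F A B \<longleftrightarrow> (\<forall>s. \<exists>a\<in>A. \<exists>b\<in>B. con (eF F) (-{s}) a b)"

text \<open>If \<open>t\<close> separated \<open>A\<close> from \<open>{s0,u'}\<close> in
  \<open>F\<close>, then what \<open>a\<close> reaches without \<open>t\<close> would stay on the
  side of \<open>A\<close> with respect to \<open>s0\<close>. A path to \<open>B\<close> in the
  larger graph could leave this set only along the new edge, but neither end of that edge belongs to
  it.\<close>

lemma sepless_half:
  assumes sl: "sepless (insert (u,v) F) A B"
    and RA: "\<And>a b. a \<in> A \<Longrightarrow> b \<in> B \<Longrightarrow> \<not> con (eF F) (-{s0}) a b"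
    and v: "\<And>a. a \<in> A \<Longrightarrow> \<not> con (eF F) (-{s0}) a v'" and uv: "{u,v} = {u',v'}"
  shows "sepless F A {s0,u'}"
  unfolding sepless_def
proof (intro allI)
  fix t
  obtain a b where ab: "a \<in> A" "b \<in> B" "con (eF (insert (u,v) F)) (-{t}) a b"
    using sl unfolding sepless_def by blast
  let ?W = "compo (eF F) (-{t}) a"
  show "\<exists>a\<in>A. \<exists>b\<in>{s0,u'}. con (eF F) (-{t}) a b"
  proof (rule ccontr)
    assume "\<not> ?thesis"
    then have nW: "s0 \<notin> ?W" "u' \<notin> ?W" using ab(1) by (auto simp: compo_def)
    have W: "w \<in> ?W \<Longrightarrow> con (eF F) (-{s0}) a w" for w
    proof -
      assume "w \<in> ?W"
      then have "con (eF F) ?W a w" using con_compo[OF sgr_eF] by (auto simp: compo_def)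
      then show ?thesis by (rule con_mono) (use nW in auto)
    qed
    have a: "a \<in> ?W" by (rule compo_self[OF con_in(1)[OF ab(3)]])
    have "b \<notin> ?W" using W RA ab by blast
    then obtain c d where cd: "c \<in> ?W" "d \<notin> ?W" "d \<in> -{t}" "eF (insert (u,v) F) c d"
      using con_exit[OF sgr_eF ab(3) a] by metis
    have "\<not> eF F c d" using cd compo_closed[OF sgr_eF, of c F "-{t}" a d] by blast
    then have "{c,d} = {u',v'}" using cd(4) uv by (auto simp: eF_def)
    then have "c = v'" using cd(1) nW by (metis doubleton_eq_iff)
    then show False using W[OF cd(1)] v[OF ab(1)] by simp
  qed
qed

text \<open>If deleting the edge \<open>e\<close> leaves a separating vertex \<open>s0\<close>, then
  \<open>e\<close> joins the sides of \<open>A\<close> and \<open>B\<close>. Induction gives two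
  disjoint paths from \<open>A\<close> to \<open>{s0,u'}\<close> and two from \<open>B\<close> to
  \<open>{s0,v'}\<close>, which are glued at \<open>s0\<close> and along \<open>e\<close>.\<close>

lemma menger2_F:
  assumes "finite F" "sepless F A B"
  shows "\<exists>S1 S2 a1 b1 a2 b2. a1 \<in> A \<and> a2 \<in> A \<and> b1 \<in> B \<and> b2 \<in> B \<and> S1 \<inter> S2 = {} \<and>
    con (eF F) S1 a1 b1 \<and> con (eF F) S2 a2 b2"
  using assms
proof (induction F arbitrary: A B rule: finite_induct)
  case empty
  have t: "a = b" if "con (eF {}) S a b" for S a b
    using that unfolding con_def pth_def
    by (metis (no_types, lifting) eF_def empty_iff last.simps list.collapse list.exhaust_sel list.sel(1) successively.simps(3))
  \<comment> \<open>Without edges connected vertices are equal, so \<open>A\<close> and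
    \<open>B\<close> share a vertex and, by avoiding it, a second one.\<close>
  obtain a1 where a1: "a1 \<in> A" "a1 \<in> B" using empty t unfolding sepless_def by metis
  obtain a2 where a2: "a2 \<in> A" "a2 \<in> B" "a2 \<noteq> a1"
    using empty t con_in(1) unfolding sepless_def by (metis ComplD insertI1)
  show ?case
    by (rule exI[of _ "{a1}"], rule exI[of _ "{a2}"], rule exI[of _ a1], rule exI[of _ a1], rule exI[of _ a2], rule exI[of _ a2])
      (use a1 a2 in \<open>auto intro: con_refl\<close>)
next
  case (insert e F)
  obtain u v where e: "e = (u,v)" by (cases e)
  let ?G = "insert (u,v) F"
  show ?case
  proof (cases "sepless F A B")
    case True
    then obtain S1 S2 a1 b1 a2 b2 where "a1 \<in> A" "a2 \<in> A" "b1 \<in> B" "b2 \<in> B" "S1 \<inter> S2 = {}"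
      "con (eF F) S1 a1 b1" "con (eF F) S2 a2 b2" using insert.IH by blast
    then show ?thesis using con_eF_mono[of F _ _ _ ?G] unfolding e by blast
  next
    case False
    then obtain s0 where s0: "\<And>a b. a \<in> A \<Longrightarrow> b \<in> B \<Longrightarrow> \<not> con (eF F) (-{s0}) a b"
      unfolding sepless_def by blast
    define RA where "RA = {w. \<exists>a\<in>A. con (eF F) (-{s0}) a w}"
    define RB where "RB = {w. \<exists>b\<in>B. con (eF F) (-{s0}) b w}"
    have dis: "RA \<inter> RB = {}"
    proof (rule ccontr)
      assume "RA \<inter> RB \<noteq> {}"
      then obtain w a b where "a \<in> A" "b \<in> B" "con (eF F) (-{s0}) a w" "con (eF F) (-{s0}) b w"
        by (auto simp: RA_def RB_def)
      then show False using s0 con_trans[OF sgr_eF] con_sym[OF sgr_eF] by metis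
    qed
    have s0R: "s0 \<notin> RA" "s0 \<notin> RB" unfolding RA_def RB_def using con_in(2) by fastforce+
    have clA: "c \<in> RA \<Longrightarrow> eF F c d \<Longrightarrow> d \<noteq> s0 \<Longrightarrow> d \<in> RA" for c d
      unfolding RA_def using con_step[OF sgr_eF, of F "-{s0}" _ c d] by auto
    have clB: "c \<in> RB \<Longrightarrow> eF F c d \<Longrightarrow> d \<noteq> s0 \<Longrightarrow> d \<in> RB" for c d
      unfolding RB_def using con_step[OF sgr_eF, of F "-{s0}" _ c d] by auto
    obtain a b where ab: "a \<in> A" "b \<in> B" "con (eF ?G) (-{s0}) a b"
      using insert.prems unfolding sepless_def e by blast
    have aRA: "a \<in> RA" unfolding RA_def using con_refl[of a "-{s0}"] con_in[OF ab(3)] ab(1) by blast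
    have bRB: "b \<in> RB" unfolding RB_def using con_refl[of b "-{s0}"] con_in[OF ab(3)] ab(2) by blast
    obtain u' v' where uv: "u' \<in> RA" "v' \<notin> RA" "v' \<noteq> s0" "eF ?G u' v'"
      using con_exit[OF sgr_eF ab(3) aRA] bRB dis by (metis ComplD disjoint_iff insertI1)
    have uv2: "{u,v} = {u',v'}" using uv clA[of u' v'] by (auto simp: eF_def)
    obtain c d where cd: "c \<in> RB" "d \<notin> RB" "d \<noteq> s0" "eF ?G c d"
      using con_exit[OF sgr_eF con_sym[OF sgr_eF ab(3)] bRB] aRA dis by (metis ComplD disjoint_iff insertI1)
    have "{u,v} = {c,d}" using cd clB[of c d] by (auto simp: eF_def)
    then have vRB: "v' \<in> RB" using uv2 cd(1) uv(1) dis by (metis disjoint_iff doubleton_eq_iff)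
    have h1: "sepless F A {s0,u'}"
    proof (rule sepless_half[where u=u and v=v and v'=v' and B=B])
      show "sepless (insert (u,v) F) A B" using insert.prems e by simp
      show "\<not> con (eF F) (-{s0}) a v'" if "a \<in> A" for a
        using that vRB dis unfolding RA_def by blast
    qed (use s0 uv2 in auto)
    have h2: "sepless F B {s0,v'}"
    proof (rule sepless_half[where u=u and v=v and v'=u' and B=A])
      show "sepless (insert (u,v) F) B A" using insert.prems e con_sym[OF sgr_eF] unfolding sepless_def by metis
      show "\<not> con (eF F) (-{s0}) b u'" if "b \<in> B" for b
        using that uv(1) dis unfolding RB_def by blast
      show "\<not> con (eF F) (-{s0}) b a" if "b \<in> B" "a \<in> A" for a b
        using that s0 con_sym[OF sgr_eF] by metis
    qed (use uv2 in auto)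
    \<comment> \<open>The two connections are trimmed to what is reachable on the side
      \<open>R\<close>, so that connections from opposite sides can meet only in
      \<open>s0\<close>.\<close>
    have split: "\<exists>S T a1 a2. a1 \<in> Z \<and> a2 \<in> Z \<and> S \<inter> T = {} \<and> S \<subseteq> insert s0 R \<and> T \<subseteq> R \<and>
        con (eF F) S a1 s0 \<and> con (eF F) T a2 r"
      if sl: "sepless F Z {s0,r}" and R: "R = {w. \<exists>a\<in>Z. con (eF F) (-{s0}) a w}" for Z r R
    proof -
      obtain S1 S2 a1 b1 a2 b2 where i: "a1 \<in> Z" "a2 \<in> Z" "b1 \<in> {s0,r}" "b2 \<in> {s0,r}" "S1 \<inter> S2 = {}"
        "con (eF F) S1 a1 b1" "con (eF F) S2 a2 b2" using insert.IH[OF sl] by blast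
      have "b1 \<noteq> b2" using i con_in(2) by (metis disjoint_iff)
      then obtain S T a1 a2 where j: "a1 \<in> Z" "a2 \<in> Z" "S \<inter> T = {}" "con (eF F) S a1 s0" "con (eF F) T a2 r"
        using i by (metis (no_types, lifting) Int_commute empty_iff insert_iff)
      have s0T: "s0 \<notin> T" using j con_in(2) by (metis disjoint_iff)
      let ?T = "compo (eF F) T a2"
      have T: "con (eF F) ?T a2 r" by (rule con_compo[OF sgr_eF j(5)])
      have TR: "?T \<subseteq> R" unfolding R compo_def using con_mono[of "eF F" T a2 _ "-{s0}"] s0T j(2) by blast
      have "\<exists>S'\<subseteq>S. S' \<subseteq> insert s0 R \<and> con (eF F) S' a1 s0"
      proof (cases "a1 = s0")
        case True then show ?thesis using con_in(1)[OF j(4)] con_refl[of s0 "{s0}"] by (intro exI[of _ "{s0}"]) auto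
      next
        case False
        then obtain w where w: "con (eF F) (S - {s0}) a1 w" "eF F w s0" using con_last[OF j(4)] by metis
        let ?S = "compo (eF F) (S - {s0}) a1"
        have "con (eF F) ?S a1 w" by (rule con_compo[OF sgr_eF w(1)])
        then have "con (eF F) (insert s0 ?S) a1 w" by (rule con_mono) auto
        then have "con (eF F) (insert s0 ?S) a1 s0" by (rule con_step[OF sgr_eF]) (use w in auto)
        moreover have "?S \<subseteq> R" unfolding R compo_def using con_mono[of "eF F" "S - {s0}" a1 _ "-{s0}"] j(1) by blast
        moreover have "insert s0 ?S \<subseteq> S" using compo_sub[of "eF F" "S-{s0}" a1] con_in(2)[OF j(4)] by auto
        ultimately show ?thesis by (intro exI[of _ "insert s0 ?S"]) auto
      qed
      then obtain S' where S': "S' \<subseteq> S" "S' \<subseteq> insert s0 R" "con (eF F) S' a1 s0" by blast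
      have "S' \<inter> ?T = {}" using S' j(3) compo_sub[of "eF F" T a2] by blast
      then show ?thesis using j(1,2) S' T TR by blast
    qed
    obtain S T a1 a2 where st: "a1 \<in> A" "a2 \<in> A" "S \<inter> T = {}" "S \<subseteq> insert s0 RA" "T \<subseteq> RA"
        "con (eF F) S a1 s0" "con (eF F) T a2 u'" using split[OF h1 RA_def] by blast
    obtain S' T' b1 b2 where st': "b1 \<in> B" "b2 \<in> B" "S' \<inter> T' = {}" "S' \<subseteq> insert s0 RB" "T' \<subseteq> RB"
        "con (eF F) S' b1 s0" "con (eF F) T' b2 v'" using split[OF h2 RB_def] by blast
    have c1: "con (eF ?G) (S \<union> S') a1 b1"
    proof -
      have "con (eF F) (S \<union> S') a1 s0" "con (eF F) (S \<union> S') s0 b1"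
        using con_mono[OF st(6)] con_mono[OF con_sym[OF sgr_eF st'(6)]] by auto
      then have "con (eF F) (S \<union> S') a1 b1" by (rule con_trans[OF sgr_eF])
      then show ?thesis by (rule con_eF_mono) auto
    qed
    have c2: "con (eF ?G) (T \<union> T') a2 b2"
    proof -
      have "con (eF F) (T \<union> T') a2 u'" by (rule con_mono[OF st(7)]) auto
      then have "con (eF ?G) (T \<union> T') a2 u'" by (rule con_eF_mono) auto
      then have x: "con (eF ?G) (T \<union> T') a2 v'"
        by (rule con_step[OF sgr_eF]) (use uv(4) con_in(2)[OF st'(7)] in auto)
      have "con (eF F) (T \<union> T') v' b2" by (rule con_mono[OF con_sym[OF sgr_eF st'(7)]]) auto
      then have "con (eF ?G) (T \<union> T') v' b2" by (rule con_eF_mono) auto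
      then show ?thesis by (rule con_trans[OF sgr_eF x])
    qed
    have "(S \<union> S') \<inter> (T \<union> T') = {}" using st(3-5) st'(3-5) dis s0R by blast
    then show ?thesis using st(1,2) st'(1,2) c1 c2 unfolding e by blast
  qed
qed

lemma con_eF:
  assumes "sgr E" "F = {(a,b). a \<in> S \<and> b \<in> S \<and> E a b}" "a \<in> S"
  shows "con (eF F) T a b \<longleftrightarrow> con E (T \<inter> S) a b"
proof
  assume "con (eF F) T a b"
  then obtain p where p: "pth (eF F) T a p b" by (auto simp: con_def)
  have "set q \<subseteq> S \<and> successively E q" if "successively (eF F) q" "q \<noteq> []" "hd q \<in> S" for q
    using that
  proof (induction q)
    case (Cons x q)
    then show ?case using assms(1,2) by (cases q) (auto simp: eF_def sgr_def)
  qed simp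
  from this[of p] show "con E (T \<inter> S) a b" using p assms(3) by (auto simp: con_def pth_def)
next
  assume "con E (T \<inter> S) a b"
  then obtain p where p: "pth E (T \<inter> S) a p b" by (auto simp: con_def)
  have "successively (eF F) q" if "successively E q" "set q \<subseteq> S" for q
    using that
  proof (induction q)
    case (Cons x q)
    then show ?case using assms(2) sgr_neq[OF assms(1)] by (cases q) (auto simp: eF_def)
  qed simp
  from this[of p] show "con (eF F) T a b" using p by (auto simp: con_def pth_def)
qed

text \<open>The paths are represented by disjoint vertex sets in which their ends are connected;
  later proofs choose a path in them or cut it at a first hit.\<close>

lemma menger2:
  assumes "sgr E" "finite S" "A \<subseteq> S" "B \<subseteq> S"
    and "\<And>s. \<exists>a\<in>A. \<exists>b\<in>B. con E (S - {s}) a b"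
  obtains S1 S2 a1 b1 a2 b2 where "a1 \<in> A" "a2 \<in> A" "b1 \<in> B" "b2 \<in> B" "S1 \<inter> S2 = {}" "S1 \<subseteq> S" "S2 \<subseteq> S"
    "con E S1 a1 b1" "con E S2 a2 b2" "a1 \<noteq> a2" "b1 \<noteq> b2"
proof -
  define F where "F = {(a,b). a \<in> S \<and> b \<in> S \<and> E a b}"
  have "F \<subseteq> S \<times> S" by (auto simp: F_def)
  then have fF: "finite F" using assms(2) by (meson finite_SigmaI finite_subset)
  have eq: "a \<in> S \<Longrightarrow> con (eF F) T a b \<longleftrightarrow> con E (T \<inter> S) a b" for a b T
    by (rule con_eF[OF assms(1) F_def])
  have "sepless F A B" unfolding sepless_def
  proof
    fix s
    obtain a b where ab: "a \<in> A" "b \<in> B" "con E (S - {s}) a b" using assms(5) by blast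
    have "S - {s} = (-{s}) \<inter> S" by auto
    then have "con (eF F) (-{s}) a b" using ab eq[of a "-{s}" b] assms(3) by auto
    then show "\<exists>a\<in>A. \<exists>b\<in>B. con (eF F) (-{s}) a b" using ab by blast
  qed
  then obtain S1 S2 a1 b1 a2 b2 where r: "a1 \<in> A" "a2 \<in> A" "b1 \<in> B" "b2 \<in> B" "S1 \<inter> S2 = {}"
    "con (eF F) S1 a1 b1" "con (eF F) S2 a2 b2" using menger2_F[OF fF] by blast
  have c: "con E (S1 \<inter> S) a1 b1" "con E (S2 \<inter> S) a2 b2" using r eq assms(3) by auto
  then have "a1 \<in> S1" "a2 \<in> S2" "b1 \<in> S1" "b2 \<in> S2" using con_in by fastforce+
  then have "a1 \<noteq> a2" "b1 \<noteq> b2" using r(5) by auto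
  then show ?thesis using that[OF r(1-4) _ _ _ c] r(5) by blast
qed

section \<open>Paths between two roots\<close>

text \<open>The neighbours in \<open>V\<close> of vertices of \<open>K\<close> lie in \<open>K \<union> B\<close>. The set \<open>B\<close> is not required to be part of \<open>V\<close>
  or disjoint from \<open>K\<close>.\<close>

definition clo :: "('a \<Rightarrow> 'a \<Rightarrow> bool) \<Rightarrow> 'a set \<Rightarrow> 'a set \<Rightarrow> 'a set \<Rightarrow> bool" where
  "clo E V K B \<longleftrightarrow> (\<forall>a\<in>K. \<forall>b\<in>V. E a b \<longrightarrow> b \<in> K \<or> b \<in> B)"

lemma cloI: "(\<And>a b. a \<in> K \<Longrightarrow> b \<in> V \<Longrightarrow> E a b \<Longrightarrow> b \<notin> K \<Longrightarrow> b \<in> B) \<Longrightarrow> clo E V K B"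
  by (auto simp: clo_def)

lemma cloD: "clo E V K B \<Longrightarrow> a \<in> K \<Longrightarrow> b \<in> V \<Longrightarrow> E a b \<Longrightarrow> b \<in> K \<or> b \<in> B"
  by (auto simp: clo_def)

lemma clo_sub: "clo E (K \<union> B) K' D \<Longrightarrow> K' \<subseteq> K \<Longrightarrow> clo E V K B \<Longrightarrow> clo E V K' D"
  unfolding clo_def by (metis UnCI subsetD)

lemma conn2_cloI:
  assumes "\<And>K c. K \<noteq> {} \<Longrightarrow> K \<subseteq> V \<Longrightarrow> x \<notin> K \<Longrightarrow> y \<notin> K \<Longrightarrow> clo E V K {c} \<Longrightarrow> False"
  shows "conn2 E V x y"
proof (rule conn2I)
  fix K c assume "K \<noteq> {}" "K \<subseteq> V" "x \<notin> K" "y \<notin> K"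
    "\<And>a b. a \<in> K \<Longrightarrow> b \<in> V \<Longrightarrow> E a b \<Longrightarrow> b \<in> K \<or> b = c"
  then show False using assms[of K c] by (auto simp: clo_def)
qed

lemma conn2_cloD:
  assumes "conn2 E V x y" "K \<noteq> {}" "K \<subseteq> V" "x \<notin> K" "y \<notin> K" "clo E V K {c}" shows False
  using conn2D[OF assms(1-5), of c] assms(6) by (auto simp: clo_def)

text \<open>The exceptional vertex \<open>z\<close> may coincide with a root or lie outside \<open>V\<close>, in which case there is no
  exceptional vertex. For \<open>k = 1\<close> no degrees are prescribed.\<close>

definition rooted :: "('a \<Rightarrow> 'a \<Rightarrow> bool) \<Rightarrow> 'a set \<Rightarrow> 'a \<Rightarrow> 'a \<Rightarrow> 'a \<Rightarrow> nat \<Rightarrow> bool" where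
  "rooted E V x y z k \<longleftrightarrow> sgr E \<and> finite V \<and> x \<in> V \<and> y \<in> V \<and> x \<noteq> y \<and> conn2 E V x y \<and>
     V - {x,y,z} \<noteq> {} \<and> 1 \<le> k \<and> (2 \<le> k \<longrightarrow> (\<forall>v\<in>V-{x,y,z}. k + 1 \<le> card {u\<in>V. E v u}))"

lemma pl_sandwich:
  assumes "pl E S1 x a r1" "pl E W a b n" "pl E S2 b y r2" "S1 \<inter> W \<subseteq> {a}" "S2 \<inter> W \<subseteq> {b}" "S1 \<inter> S2 = {}"
    "S1 \<union> W \<union> S2 \<subseteq> V" "m = r1 + n + r2"
  shows "pl E V x y m"
proof -
  have "pl E (S1 \<union> W) x b (r1 + n)" by (rule pl_append[OF assms(1,2,4)])
  then show ?thesis by (rule pl_append'[OF _ assms(3)]) (use assms in auto)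
qed

text \<open>The set \<open>X\<close> contracted to the vertex \<open>x\<close>, next to the subgraph induced by \<open>C\<close>.\<close>

definition ctr :: "('a \<Rightarrow> 'a \<Rightarrow> bool) \<Rightarrow> 'a \<Rightarrow> 'a set \<Rightarrow> 'a set \<Rightarrow> 'a \<Rightarrow> 'a \<Rightarrow> bool" where
  "ctr E x X C a b \<longleftrightarrow> a \<in> C \<and> b \<in> C \<and> E a b \<or> a = x \<and> b \<in> C \<and> (\<exists>e\<in>X. E e b) \<or>
     b = x \<and> a \<in> C \<and> (\<exists>e\<in>X. E e a)"

lemma sgr_ctr: "sgr E \<Longrightarrow> x \<notin> C \<Longrightarrow> sgr (ctr E x X C)"
  by (auto simp: sgr_def ctr_def)

text \<open>A path visits the contracted vertex only at its start, so only its first edge has to be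
  replaced. The vertex \<open>e\<close> depends on the path, hence a core has to reach all of
  \<open>X\<close> by the same lengths.\<close>

lemma ctr_lift:
  assumes "sgr E" "x \<notin> C" "y \<in> C" "X \<inter> C = {}" "pl (ctr E x X C) (insert x C) x y n"
  shows "\<exists>e\<in>X. pl E (insert e C) e y n"
proof -
  obtain p where p: "pth (ctr E x X C) (insert x C) x p y" "length p = Suc n"
    using assms(5) by (auto simp: pl_def)
  obtain q where q: "p = x # q" using p by (cases p) (auto simp: pth_def)
  have qn: "q \<noteq> []" using p q assms(2,3) by (auto simp: pth_def)
  have qC: "set q \<subseteq> C" using p q by (auto simp: pth_def)
  have "ctr E x X C x (hd q)" "successively (ctr E x X C) q"
    using p q qn by (cases q, auto simp: pth_def)+
  then obtain e where e: "e \<in> X" "E e (hd q)" using assms(2) by (auto simp: ctr_def)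
  have "successively E q"
    by (rule successively_mono[OF \<open>successively (ctr E x X C) q\<close>])
      (use qC assms(2) in \<open>auto simp: ctr_def\<close>)
  then have "pth E (insert e C) e (e # q) y"
    using e qn qC p q assms(4) by (cases q) (auto simp: pth_def)
  then show ?thesis using e(1) p(2) q unfolding pl_def by (intro bexI[of _ e]) auto
qed

text \<open>A counterexample \<open>V\<close> of least cardinality; the edge between the roots plays no role and is deleted
  beforehand.\<close>

locale mincex =
  fixes E :: "'a \<Rightarrow> 'a \<Rightarrow> bool" and V :: "'a set" and x y z :: 'a and k :: nat
  assumes rt: "rooted E V x y z k"
    and nxy: "\<not> E x y"
    and IH: "\<And>E' V' x' y' z' k'. card V' < card V \<Longrightarrow> rooted E' V' x' y' (z'::'a) k' \<Longrightarrow> fam k' (pl E' V' x' y')"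
    and ng: "\<not> fam k (pl E V x y)"
begin

lemma sg: "sgr E" and fin: "finite V" and xV: "x \<in> V" and yV: "y \<in> V" and xy: "x \<noteq> y"
  and c2: "conn2 E V x y" and k1: "1 \<le> k"
  using rt by (auto simp: rooted_def)

lemma sym: "E a b \<Longrightarrow> E b a" using sgr_sym[OF sg] .
lemma irr: "\<not> E a a" using sgr_irrefl[OF sg] .
lemma nyx: "\<not> E y x" using nxy sym by blast

lemma nonex: "\<exists>v. v \<in> V \<and> v \<noteq> x \<and> v \<noteq> y \<and> v \<noteq> z"
  using rt by (auto simp: rooted_def)

lemmas c2D = conn2_cloD[OF c2]

lemma swap: "mincex E V y x z k"
proof
  show "rooted E V y x z k" using rt conn2_swap[of E V x y] by (auto simp: rooted_def insert_commute)
  show "\<not> E y x" by (rule nyx)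
  show "fam k' (pl E' V' x' y')" if "card V' < card V" "rooted E' V' x' y' z' k'" for E' V' x' y' and z' :: 'a and k'
    using IH that by blast
  show "\<not> fam k (pl E V y x)" using ng fam_mono[of k "pl E V y x" "pl E V x y"] pl_sym[OF sg, of V y x] by blast
qed

lemma con_xy: "con E V x y"
proof (rule ccontr)
  assume "\<not> ?thesis"
  then obtain R where R: "x \<in> R" "R \<subseteq> V" "y \<notin> R" "\<forall>a\<in>R. \<forall>b\<in>V. E a b \<longrightarrow> b \<in> R"
    using con_or_sep[OF sg xV, of y] by blast
  have "R - {x} = {}" using c2D[of "R - {x}" x] R by (auto simp: clo_def)
  then have nx: "\<not> E x b" if "b \<in> V" for b using R that irr by blast
  obtain v where v: "v \<in> V" "v \<noteq> x" "v \<noteq> y" using nonex by blast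
  have "clo E V (V - {x,y}) {y}" using nx sym by (auto simp: clo_def)
  then show False using c2D[of "V - {x,y}" y] v by auto
qed

lemma k2: "2 \<le> k"
proof (rule ccontr)
  assume "\<not> 2 \<le> k"
  then have k: "k = 1" using k1 by simp
  obtain n where "pl E V x y n" using con_xy by (auto simp: con_pl)
  then have "fam k (pl E V x y)" using k by (intro famI1[of k _ n]) simp
  then show False using ng by blast
qed

lemma deg: "v \<in> V \<Longrightarrow> v \<noteq> x \<Longrightarrow> v \<noteq> y \<Longrightarrow> v \<noteq> z \<Longrightarrow> k + 1 \<le> card {u\<in>V. E v u}"
  using rt k2 by (auto simp: rooted_def)

lemma no_shift: assumes "fam k P" "\<And>n. P n \<Longrightarrow> pl E V x y (n + c)" shows False
  using fam_shift[of k P "pl E V x y" c] assms ng by blast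

lemma IHsub:
  assumes "V' \<subset> V" "x' \<in> V'" "y' \<in> V'" "x' \<noteq> y'" "conn2 E V' x' y'" "V' - {x',y',z'} \<noteq> {}"
    and "\<And>v. v \<in> V' \<Longrightarrow> v \<noteq> x' \<Longrightarrow> v \<noteq> y' \<Longrightarrow> v \<noteq> z' \<Longrightarrow> v \<noteq> x \<and> v \<noteq> y \<and> v \<noteq> z \<and> (\<forall>u\<in>V. E v u \<longrightarrow> u \<in> V')"
  shows "fam k (pl E V' x' y')"
proof (rule IH[of V' E x' y' z'])
  show "card V' < card V" using assms(1) fin by (simp add: psubset_card_mono)
  have "k + 1 \<le> card {u\<in>V'. E v u}" if v: "v \<in> V' - {x',y',z'}" for v
  proof -
    have "{u\<in>V'. E v u} = {u\<in>V. E v u}" using assms(1) assms(7)[of v] v by auto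
    then show ?thesis using deg[of v] assms(7)[of v] v assms(1) by auto
  qed
  then show "rooted E V' x' y' z' k"
    unfolding rooted_def using assms sg fin k1 finite_subset[of V' V] by auto
qed

text \<open>The vertex \<open>x\<close> is removed and its name reused for the contracted
  \<open>X\<close>, so the graph shrinks even if \<open>X\<close> is a single vertex. As
  \<open>C\<close> is connected, only the parts behind a cut vertex of \<open>C\<close> must be
  shown to have a neighbour in \<open>X\<close>.\<close>

lemma reduce:
  assumes "C \<subseteq> V" "x \<notin> C" "X \<subseteq> V" "X \<inter> C = {}" "x \<notin> X" "X \<noteq> {}" "cset E C ys"
    and b: "\<And>c K. c \<in> C \<Longrightarrow> K \<noteq> {} \<Longrightarrow> K \<subseteq> C \<Longrightarrow> c \<notin> K \<Longrightarrow> ys \<notin> K \<Longrightarrow> clo E C K {c} \<Longrightarrow> \<exists>a\<in>K. \<exists>e\<in>X. E e a"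
    and "C - {ys,zs} \<noteq> {}" "1 \<le> k'"
    and d: "\<And>w. 2 \<le> k' \<Longrightarrow> w \<in> C \<Longrightarrow> w \<noteq> ys \<Longrightarrow> w \<noteq> zs \<Longrightarrow> k' + 1 \<le> card {u\<in>C. E w u} + (if \<exists>e\<in>X. E e w then 1 else 0)"
  shows "fam k' (\<lambda>n. \<exists>e\<in>X. pl E (insert e C) e ys n)"
proof -
  let ?E = "ctr E x X C" and ?W = "insert x C"
  have ysC: "ys \<in> C" using assms(7) by (simp add: cset_def)
  obtain e0 where e0: "e0 \<in> X" using assms(6) by blast
  have fC: "finite C" using assms(1) fin finite_subset by blast
  have "?W \<subset> V" using assms e0 xV by auto
  then have card: "card ?W < card V" using fin by (simp add: psubset_card_mono)
  have c2': "conn2 ?E ?W x ys"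
  proof (rule conn2_cloI)
    fix K c assume K: "K \<noteq> {}" "K \<subseteq> ?W" "x \<notin> K" "ys \<notin> K" "clo ?E ?W K {c}"
    have KC: "K \<subseteq> C" using K by auto
    have cl: "clo E C K {c}"
    proof (rule cloI)
      fix a b assume ab: "a \<in> K" "b \<in> C" "E a b" "b \<notin> K"
      then have "?E a b" using KC by (auto simp: ctr_def)
      then show "b \<in> {c}" using cloD[OF K(5), of a b] ab by auto
    qed
    show False
    proof (cases "c \<in> C \<and> c \<notin> K")
      case True
      then obtain a e where "a \<in> K" "e \<in> X" "E e a" using b[of c K] K KC cl by blast
      then have "x \<in> K \<or> x \<in> {c}" using cloD[OF K(5), of a x] KC by (auto simp: ctr_def)
      then show False using K(3) True assms(2) by auto
    next
      case False
      obtain a b where ab: "a \<in> K" "b \<in> C - K" "E a b" using csetD[OF assms(7) K(1) KC K(4)] by blast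
      then show False using cloD[OF cl, of a b] False by auto
    qed
  qed
  have "k' + 1 \<le> card {u\<in>?W. ?E w u}" if k: "2 \<le> k'" and w: "w \<in> ?W - {x,ys,zs}" for w
  proof -
    have wC: "w \<in> C" using w by auto
    have "{u\<in>?W. ?E w u} = {u\<in>C. E w u} \<union> (if \<exists>e\<in>X. E e w then {x} else {})"
      using wC assms(2) by (auto simp: ctr_def)
    moreover have "card ({u\<in>C. E w u} \<union> (if \<exists>e\<in>X. E e w then {x} else {})) = card {u\<in>C. E w u} + (if \<exists>e\<in>X. E e w then 1 else 0)"
      using fC assms(2) by auto
    ultimately show ?thesis using d[OF k wC] w by auto
  qed
  then have "rooted ?E ?W x ys zs k'"
    unfolding rooted_def using sgr_ctr[OF sg assms(2)] fC ysC assms(2,9,10) c2' by auto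
  from IH[OF card this] have "fam k' (pl ?E ?W x ys)" .
  then show ?thesis by (rule fam_mono) (rule ctr_lift[OF sg assms(2) ysC assms(4)])
qed

text \<open>Induction applies to \<open>K \<union> {x,c}\<close> with roots \<open>x\<close> and
  \<open>c\<close>, and one path from \<open>c\<close> to \<open>y\<close> outside \<open>K\<close>
  prolongs all paths found. Only \<open>K = {z}\<close> escapes, since it has no vertex of
  prescribed degree.\<close>

lemma sepx_raw:
  assumes "K \<noteq> {}" "K \<subseteq> V" "x \<notin> K" "y \<notin> K" "c \<notin> K" "c \<noteq> x" "c \<noteq> y" "clo E V K {x,c}"
  shows "K = {z}"
proof (rule ccontr)
  assume "K \<noteq> {z}"
  then have Kz: "K - {z} \<noteq> {}" using assms(1) by auto
  have cV: "c \<in> V"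
  proof (rule ccontr)
    assume "c \<notin> V"
    then have "clo E V K {x}" using assms(8) by (auto simp: clo_def)
    then show False using c2D[of K x] assms by blast
  qed
  let ?V = "K \<union> {x,c}"
  have f: "fam k (pl E ?V x c)"
  proof (rule IHsub[where z'=z])
    show "?V \<subset> V" using assms cV xV yV xy by auto
    show "conn2 E ?V x c"
    proof (rule conn2_cloI)
      fix K' c' assume K': "K' \<noteq> {}" "K' \<subseteq> ?V" "x \<notin> K'" "c \<notin> K'" "clo E ?V K' {c'}"
      then have sub: "K' \<subseteq> K" by auto
      have "clo E V K' {c'}" by (rule clo_sub[OF K'(5) sub assms(8)])
      then show False using c2D[of K' c'] K' sub assms by blast
    qed
    show "v \<noteq> x \<and> v \<noteq> y \<and> v \<noteq> z \<and> (\<forall>u\<in>V. E v u \<longrightarrow> u \<in> ?V)"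
      if "v \<in> ?V" "v \<noteq> x" "v \<noteq> c" "v \<noteq> z" for v
      using that assms by (auto simp: clo_def)
  qed (use assms Kz in auto)
  have "con E (V - K - {x}) c y"
  proof (rule ccontr)
    assume "\<not> ?thesis"
    then obtain R where R: "c \<in> R" "R \<subseteq> V - K - {x}" "y \<notin> R" "\<forall>a\<in>R. \<forall>b\<in>V - K - {x}. E a b \<longrightarrow> b \<in> R"
      using con_or_sep[OF sg, of c "V - K - {x}" y] cV assms(5,6) by blast
    have "clo E V (R \<union> K) {x}" using R assms(8) unfolding clo_def by blast
    then show False using c2D[of "R \<union> K" x] R assms by blast
  qed
  then obtain r where r: "pl E (V - K - {x}) c y r" by (auto simp: con_pl)
  show False
  proof (rule no_shift[OF f, of r])
    fix n assume "pl E ?V x c n"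
    then show "pl E V x y (n + r)" by (rule pl_append'[OF _ r]) (use assms cV xV in auto)
  qed
qed

text \<open>Induction on \<open>K \<union> {x,y}\<close>; if \<open>K = {z}\<close>, the remaining
  vertices form the other side of the cut and take the place of \<open>K\<close>.\<close>

lemma sepxy:
  assumes "K \<noteq> {}" "K \<subseteq> V" "x \<notin> K" "y \<notin> K" "clo E V K {x,y}" "u \<in> V" "u \<notin> K" "u \<noteq> x" "u \<noteq> y"
  shows False
proof -
  have main: False if K: "K \<noteq> {}" "K \<subseteq> V" "x \<notin> K" "y \<notin> K" "clo E V K {x,y}" "u \<in> V" "u \<notin> K" "u \<noteq> x" "u \<noteq> y"
    "K - {z} \<noteq> {}" for K u
  proof -
    let ?V = "K \<union> {x,y}"
    have f: "fam k (pl E ?V x y)"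
    proof (rule IHsub[where z'=z])
      show "?V \<subset> V" using K xV yV by auto
      show "conn2 E ?V x y"
      proof (rule conn2_cloI)
        fix K' c' assume K': "K' \<noteq> {}" "K' \<subseteq> ?V" "x \<notin> K'" "y \<notin> K'" "clo E ?V K' {c'}"
        then have sub: "K' \<subseteq> K" by auto
        have "clo E V K' {c'}" by (rule clo_sub[OF K'(5) sub K(5)])
        then show False using c2D[of K' c'] K' sub K by blast
      qed
      show "v \<noteq> x \<and> v \<noteq> y \<and> v \<noteq> z \<and> (\<forall>u\<in>V. E v u \<longrightarrow> u \<in> ?V)"
        if "v \<in> ?V" "v \<noteq> x" "v \<noteq> y" "v \<noteq> z" for v
        using that K by (auto simp: clo_def)
    qed (use K xy in auto)
    show False
      by (rule no_shift[OF f, of 0]) (use pl_mono[of E ?V x y _ V] K xV yV in auto)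
  qed
  show False
  proof (cases "K - {z} = {}")
    case False then show ?thesis using main assms by blast
  next
    case True
    then have K: "K = {z}" using assms(1) by auto
    let ?K = "V - {x,y,z}"
    have "clo E V ?K {x,y}"
    proof (rule cloI)
      fix a b assume "a \<in> ?K" "b \<in> V" "E a b" "b \<notin> ?K"
      moreover have "\<not> E z a" using cloD[OF assms(5), of z a] \<open>a \<in> ?K\<close> K by auto
      ultimately show "b \<in> {x,y}" using sym by blast
    qed
    then show False using main[of ?K z] nonex assms K by blast
  qed
qed

text \<open>With a single such vertex \<open>u\<close> there are at most four vertices, the degree
  of \<open>u\<close> forces \<open>k = 2\<close>, and a path through \<open>u\<close> and one
  through both \<open>u\<close> and \<open>z\<close> have lengths 2 and 3.\<close>

lemma two_plain: "\<exists>u v. u \<noteq> v \<and> u \<in> V - {x,y,z} \<and> v \<in> V - {x,y,z}"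
proof (rule ccontr)
  assume n: "\<not> ?thesis"
  obtain u where u: "u \<in> V" "u \<noteq> x" "u \<noteq> y" "u \<noteq> z" using nonex by blast
  then have V: "V \<subseteq> {x,y,z,u}" using n by blast
  have sub: "{v\<in>V. E u v} \<subseteq> {x,y,z}" using V irr by blast
  have "k + 1 \<le> card {v\<in>V. E u v}" using deg u by blast
  also have c3: "card {v\<in>V. E u v} \<le> card {x,y,z}" by (rule card_mono[OF _ sub]) simp
  finally have "3 \<le> card {x,y,z}" "k + 1 \<le> card {x,y,z}" using k2 by auto
  moreover have c: "card {x,y,z} \<le> 3" by (simp add: card_insert_if)
  ultimately have kk: "k = 2" and zz: "z \<noteq> x" "z \<noteq> y" using k2 xy by (auto simp: card_insert_if split: if_splits)
  have "{v\<in>V. E u v} = {x,y,z}"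
    by (rule card_seteq) (use sub \<open>k + 1 \<le> card {v\<in>V. E u v}\<close> kk c in auto)
  then have e: "E u x" "E u y" "E u z" "z \<in> V" by auto
  have "\<not> clo E V {z} {u}" using c2D[of "{z}" u] zz e by auto
  then have "E z x \<or> E z y" using V irr by (auto simp: clo_def)
  then have p3: "pl E V x y 3"
  proof
    assume "E z x"
    then have "pth E V x [x,z,u,y] y" using e sym xV yV u zz xy by (auto simp: pth_def)
    then show ?thesis unfolding pl_def by (intro exI[of _ "[x,z,u,y]"]) simp
  next
    assume "E z y"
    then have "pth E V x [x,u,z,y] y" using e sym xV yV u zz xy by (auto simp: pth_def)
    then show ?thesis unfolding pl_def by (intro exI[of _ "[x,u,z,y]"]) simp
  qed
  have "pth E V x [x,u,y] y" using e sym xV yV u xy by (auto simp: pth_def)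
  then have p2: "pl E V x y 2" unfolding pl_def by (intro exI[of _ "[x,u,y]"]) simp
  have "fam k (pl E V x y)"
  proof (rule famI1[of k _ 2])
    fix i assume "i < k"
    then have "i = 0 \<or> i = 1" using kk by auto
    then show "pl E V x y (2 + i)" using p2 p3 by (elim disjE) simp_all
  qed
  then show False using ng by blast
qed

text \<open>Otherwise \<open>z\<close> is the only neighbour of \<open>y\<close> and replaces it as
  a root, which leaves no exceptional vertex.\<close>

lemma nbr_y: "\<exists>u\<in>V. E y u \<and> u \<noteq> z"
proof (rule ccontr)
  assume "\<not> ?thesis"
  then have ny: "u = z" if "u \<in> V" "E y u" for u using that by blast
  obtain v where v: "v \<in> V" "v \<noteq> x" "v \<noteq> y" "v \<noteq> z" using nonex by blast
  have "\<not> clo E V (V - {x,y}) {x}" using c2D[of "V - {x,y}" x] v by auto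
  then obtain a where "a \<in> V" "E a y" "a \<noteq> x" by (auto simp: clo_def)
  then have Eyz: "E y z" "z \<in> V" using ny sym by blast+
  have zxy: "z \<noteq> x" "z \<noteq> y" using Eyz nyx irr by auto
  have f: "fam k (pl E (V - {y}) x z)"
  proof (rule IHsub[where z'=x])
    show "conn2 E (V - {y}) x z"
    proof (rule conn2_cloI)
      fix K c assume K: "K \<noteq> {}" "K \<subseteq> V - {y}" "x \<notin> K" "z \<notin> K" "clo E (V - {y}) K {c}"
      have "clo E V K {c}"
      proof (rule cloI)
        fix a b assume ab: "a \<in> K" "b \<in> V" "E a b" "b \<notin> K"
        then have "b \<noteq> y" using ny[of a] sym K by blast
        then show "b \<in> {c}" using cloD[OF K(5), of a b] ab by auto
      qed
      then show False using c2D[of K c] K by blast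
    qed
    show "u \<noteq> x \<and> u \<noteq> y \<and> u \<noteq> z \<and> (\<forall>w\<in>V. E u w \<longrightarrow> w \<in> V - {y})"
      if "u \<in> V - {y}" "u \<noteq> x" "u \<noteq> z" "u \<noteq> x" for u
      using that ny[of u] sym by blast
  qed (use v xV yV xy zxy Eyz in auto)
  show False
  proof (rule no_shift[OF f, of 1])
    fix n assume p: "pl E (V - {y}) x z n"
    have "pl E {z,y} z y 1" using pl_edge[of E z y] Eyz sym zxy by blast
    then show "pl E V x y (n + 1)" by (rule pl_append'[OF p]) (use Eyz yV in auto)
  qed
qed

end

lemma (in mincex) nbr_x: "\<exists>u\<in>V. E x u \<and> u \<noteq> z"
  using mincex.nbr_y[OF swap] .

text \<open>Deleting \<open>z\<close> harms no degree except that of roots and of \<open>c\<close>,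
  which becomes the exceptional vertex. Rooted connectivity could fail only through a set containing
  \<open>c\<close>; adding \<open>z\<close> to it gives a cut \<open>{x,c'}\<close> of a kind
  already excluded.\<close>

lemma (in mincex) degz:
  assumes "z \<in> V" "z \<noteq> x" "z \<noteq> y" "\<And>b. b \<in> V \<Longrightarrow> E z b \<Longrightarrow> b = x \<or> b = c"
  shows False
proof -
  obtain u v where uv: "u \<noteq> v" "u \<in> V - {x,y,z}" "v \<in> V - {x,y,z}" using two_plain by blast
  define z' where "z' = (if c = y then x else c)"
  have f: "fam k (pl E (V - {z}) x y)"
  proof (rule IHsub[where z'=z'])
    show "conn2 E (V - {z}) x y"
    proof (rule conn2_cloI)
      fix K c' assume K: "K \<noteq> {}" "K \<subseteq> V - {z}" "x \<notin> K" "y \<notin> K" "clo E (V - {z}) K {c'}"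
      show False
      proof (cases "c \<in> K")
        case False
        have "clo E V K {c'}"
        proof (rule cloI)
          fix a b assume ab: "a \<in> K" "b \<in> V" "E a b" "b \<notin> K"
          then have "b \<noteq> z" using assms(4)[of a] sym K False by blast
          then show "b \<in> {c'}" using cloD[OF K(5), of a b] ab by auto
        qed
        then show False using c2D[of K c'] K by blast
      next
        case True
        let ?K = "insert z K"
        have cl: "clo E V ?K {x,c'}"
        proof (rule cloI)
          fix a b assume ab: "a \<in> ?K" "b \<in> V" "E a b" "b \<notin> ?K"
          show "b \<in> {x,c'}"
          proof (cases "a = z")
            case True then show ?thesis using assms(4)[of b] ab \<open>c \<in> K\<close> by auto
          next
            case False then show ?thesis using cloD[OF K(5), of a b] ab by auto
          qed
        qed
        have ss: "?K \<noteq> {}" "?K \<subseteq> V" "x \<notin> ?K" "y \<notin> ?K" using K assms by auto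
        consider "c' = x \<or> c' \<in> ?K" | "c' = y" | "c' \<noteq> x" "c' \<noteq> y" "c' \<notin> ?K" by blast
        then show False
        proof cases
          case 1
          then have "clo E V ?K {x}" using cl by (auto simp: clo_def)
          then show False using c2D[of ?K x] ss by blast
        next
          case 2
          obtain b where b: "b \<in> V" "E x b" "b \<noteq> z" using nbr_x by blast
          have "b \<notin> ?K"
            using cloD[OF K(5), of b x] b sym xV assms(2) K(3) 2 xy by auto
          moreover have "b \<noteq> x" "b \<noteq> y" using b irr nxy by auto
          ultimately show False using sepxy[of ?K b] ss cl 2 b by blast
        next
          case 3
          then have "?K = {z}" using sepx_raw[of ?K c'] ss cl by blast
          then show False using K by auto
        qed
      qed
    qed
    show "V - {z} - {x, y, z'} \<noteq> {}" using uv by (auto simp: z'_def)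
    show "w \<noteq> x \<and> w \<noteq> y \<and> w \<noteq> z \<and> (\<forall>u\<in>V. E w u \<longrightarrow> u \<in> V - {z})"
      if "w \<in> V - {z}" "w \<noteq> x" "w \<noteq> y" "w \<noteq> z'" for w
      using that assms(4)[of w] sym by (auto simp: z'_def split: if_splits)
  qed (use assms xV yV xy in auto)
  show False by (rule no_shift[OF f, of 0]) (use pl_mono[of E "V - {z}" x y _ V] in auto)
qed

section \<open>Cuts of size two in a least counterexample\<close>

context mincex
begin

text \<open>The case \<open>K = {z}\<close> left open by \<open>sepx_raw\<close> is excluded by
  \<open>degz\<close>.\<close>

lemma sepx:
  assumes "K \<noteq> {}" "K \<subseteq> V" "x \<notin> K" "y \<notin> K" "c \<notin> K" "c \<noteq> x" "c \<noteq> y" "clo E V K {x,c}"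
  shows False
proof -
  have K: "K = {z}" by (rule sepx_raw[OF assms])
  have "b = x \<or> b = c" if "b \<in> V" "E z b" for b
    using cloD[OF assms(8), of z b] K that irr by auto
  then show False using degz[of c] K assms by auto
qed

lemma sepx':
  assumes "K \<noteq> {}" "K \<subseteq> V" "x \<notin> K" "y \<notin> K" "c \<noteq> y" "clo E V K {x,c}"
  shows False
proof (cases "c = x \<or> c \<in> K")
  case True
  then have "clo E V K {x}" using assms(6) by (auto simp: clo_def)
  then show False using c2D[of K x] assms by blast
next
  case False then show False using sepx[of K c] assms by blast
qed

lemmas sepy' = mincex.sepx'[OF swap]

text \<open>If \<open>u\<close> is the only neighbour of \<open>y\<close> other than
  \<open>z\<close>, then \<open>u\<close> replaces \<open>y\<close> as a root; besides
  \<open>u\<close> only \<open>z\<close> can lose a neighbour.\<close>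

lemma two_nbrs_y: "\<exists>u v. u \<noteq> v \<and> u \<in> V \<and> v \<in> V \<and> E y u \<and> E y v \<and> u \<noteq> z \<and> v \<noteq> z"
proof (rule ccontr)
  assume n: "\<not> ?thesis"
  obtain u where u: "u \<in> V" "E y u" "u \<noteq> z" using nbr_y by blast
  then have ny: "v = u \<or> v = z" if "v \<in> V" "E y v" for v using n that by blast
  have ux: "u \<noteq> x" "u \<noteq> y" using u nyx irr by auto
  have f: "fam k (pl E (V - {y}) x u)"
  proof (rule IHsub[where z'=z])
    show "conn2 E (V - {y}) x u"
    proof (rule conn2_cloI)
      fix K c assume K: "K \<noteq> {}" "K \<subseteq> V - {y}" "x \<notin> K" "u \<notin> K" "clo E (V - {y}) K {c}"
      have cl: "clo E V K {y,c}" using K(5) by (auto simp: clo_def)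
      show False
      proof (cases "c = x")
        case True
        then show False using sepxy[of K u] K cl u ux by (auto simp: insert_commute)
      next
        case False
        then show False using sepy'[of K c] K cl by auto
      qed
    qed
    show "V - {y} - {x, u, z} \<noteq> {}" using two_plain by auto
    show "v \<noteq> x \<and> v \<noteq> y \<and> v \<noteq> z \<and> (\<forall>u\<in>V. E v u \<longrightarrow> u \<in> V - {y})"
      if "v \<in> V - {y}" "v \<noteq> x" "v \<noteq> u" "v \<noteq> z" for v
      using that ny[of v] sym by blast
  qed (use u ux xV yV xy in auto)
  show False
  proof (rule no_shift[OF f, of 1])
    fix n assume p: "pl E (V - {y}) x u n"
    have "pl E {u,y} u y 1" using pl_edge[of E u y] u sym ux by blast
    then show "pl E V x y (n + 1)" by (rule pl_append'[OF p]) (use u yV in auto)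
  qed
qed

text \<open>Menger's theorem links \<open>x\<close> and \<open>y\<close> to \<open>c\<close> and
  \<open>d\<close> by disjoint paths outside \<open>K\<close>; induction on
  \<open>K \<union> {c,d}\<close> with roots \<open>c\<close> and \<open>d\<close> supplies the
  middle part.\<close>

lemma star2:
  assumes "K \<noteq> {}" "K \<subseteq> V" "x \<notin> K" "y \<notin> K" "c \<notin> K" "d \<notin> K" "c \<noteq> d" "c \<notin> {x,y}" "d \<notin> {x,y}" "clo E V K {c,d}"
  shows "K = {z}"
proof (rule ccontr)
  assume "K \<noteq> {z}"
  then have Kz: "K - {z} \<noteq> {}" using assms(1) by auto
  have cV: "c \<in> V" "d \<in> V"
  proof -
    show "c \<in> V"
    proof (rule ccontr)
      assume "c \<notin> V"
      then have "clo E V K {d}" using assms(10) by (auto simp: clo_def)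
      then show False using c2D[of K d] assms by blast
    qed
    show "d \<in> V"
    proof (rule ccontr)
      assume "d \<notin> V"
      then have "clo E V K {c}" using assms(10) by (auto simp: clo_def)
      then show False using c2D[of K c] assms by blast
    qed
  qed
  let ?V = "K \<union> {c,d}"
  have f: "fam k (pl E ?V c d)"
  proof (rule IHsub[where z'=z])
    show "?V \<subset> V" using assms cV xV by auto
    show "conn2 E ?V c d"
    proof (rule conn2_cloI)
      fix K' c' assume K': "K' \<noteq> {}" "K' \<subseteq> ?V" "c \<notin> K'" "d \<notin> K'" "clo E ?V K' {c'}"
      then have sub: "K' \<subseteq> K" by auto
      have "clo E V K' {c'}" by (rule clo_sub[OF K'(5) sub assms(10)])
      then show False using c2D[of K' c'] K' sub assms by blast
    qed
    show "v \<noteq> x \<and> v \<noteq> y \<and> v \<noteq> z \<and> (\<forall>u\<in>V. E v u \<longrightarrow> u \<in> ?V)"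
      if "v \<in> ?V" "v \<noteq> c" "v \<noteq> d" "v \<noteq> z" for v
      using that assms by (auto simp: clo_def)
  qed (use assms Kz in auto)
  have sep: "\<exists>a\<in>{x,y}. \<exists>b\<in>{c,d}. con E (V - K - {s}) a b" for s
  proof (rule ccontr)
    assume n: "\<not> ?thesis"
    let ?S = "V - K - {s}"
    let ?R = "compo E ?S c \<union> compo E ?S d"
    have "x \<notin> ?R" "y \<notin> ?R" using n con_sym[OF sg, of ?S] by (auto simp: compo_def)
    moreover have "?R \<subseteq> V - K" using compo_sub[of E ?S] by blast
    moreover have "clo E V (?R \<union> K) {s}"
    proof (rule cloI)
      fix a b assume ab: "a \<in> ?R \<union> K" "b \<in> V" "E a b" "b \<notin> ?R \<union> K"
      have self: "w \<in> {c,d} \<Longrightarrow> w \<noteq> s \<Longrightarrow> w \<in> ?R" for w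
        using compo_self[of c ?S E] compo_self[of d ?S E] cV assms(5,6) by auto
      show "b \<in> {s}"
      proof (rule ccontr)
        assume bs: "b \<notin> {s}"
        have "a \<in> ?R"
        proof (rule ccontr)
          assume "a \<notin> ?R"
          then have "b \<in> {c,d}" using cloD[OF assms(10), of a b] ab by auto
          then show False using self[of b] bs ab by auto
        qed
        then show False using compo_closed[OF sg, of a ?S _ b] ab bs by blast
      qed
    qed
    ultimately show False using c2D[of "?R \<union> K" s] assms by blast
  qed
  have mm: "finite (V - K)" "{x,y} \<subseteq> V - K" "{c,d} \<subseteq> V - K" using fin xV yV cV assms by auto
  obtain S1 S2 a1 b1 a2 b2 where m: "a1 \<in> {x,y}" "a2 \<in> {x,y}" "b1 \<in> {c,d}" "b2 \<in> {c,d}" "S1 \<inter> S2 = {}"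
    "S1 \<subseteq> V - K" "S2 \<subseteq> V - K" "con E S1 a1 b1" "con E S2 a2 b2" "a1 \<noteq> a2" "b1 \<noteq> b2"
    by (rule menger2[OF sg mm sep])
  have "\<exists>S1 S2 b1 b2. b1 \<in> {c,d} \<and> b2 \<in> {c,d} \<and> b1 \<noteq> b2 \<and> S1 \<inter> S2 = {} \<and> S1 \<subseteq> V - K \<and> S2 \<subseteq> V - K \<and> con E S1 x b1 \<and> con E S2 y b2"
  proof (cases "a1 = x")
    case True
    then have "a2 = y" using m by auto
    then show ?thesis using m True by blast
  next
    case False
    then have "a1 = y" "a2 = x" using m by auto
    then show ?thesis using m by blast
  qed
  then obtain S1 S2 b1 b2 where n: "b1 \<in> {c,d}" "b2 \<in> {c,d}" "b1 \<noteq> b2" "S1 \<inter> S2 = {}" "S1 \<subseteq> V - K" "S2 \<subseteq> V - K"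
    "con E S1 x b1" "con E S2 y b2" by blast
  obtain r1 where r1: "pl E S1 x b1 r1" using n by (auto simp: con_pl)
  obtain r2 where r2: "pl E S2 b2 y r2" using con_sym[OF sg n(8)] by (auto simp: con_pl)
  have cd: "{b1,b2} = {c,d}" using n by auto
  have bb: "b1 \<notin> S2" "b2 \<notin> S1" using n con_in(2) by (metis disjoint_iff)+
  show False
  proof (rule no_shift[OF f, of "r1 + r2"])
    fix n' assume p: "pl E ?V c d n'"
    have p': "pl E ?V b1 b2 n'"
      using n(1-3) p pl_sym[OF sg p] by auto
    show "pl E V x y (n' + (r1 + r2))"
    proof (rule pl_sandwich[OF r1 p' r2])
      have "?V = K \<union> {b1,b2}" using cd by simp
      then show "S1 \<inter> ?V \<subseteq> {b1}" "S2 \<inter> ?V \<subseteq> {b2}" using n(5,6) bb by auto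
      show "S1 \<union> ?V \<union> S2 \<subseteq> V" using n(5,6) assms cV by blast
    qed (use n in auto)
  qed
qed

lemma star2':
  assumes "K \<noteq> {}" "K \<subseteq> V" "x \<notin> K" "y \<notin> K" "c \<notin> {x,y}" "clo E V K {c,d}"
  shows "K = {z}"
proof -
  consider "d = x" | "d = y" | "d = c \<or> d \<in> K \<or> c \<in> K" | "d \<notin> {x,y}" "d \<noteq> c" "d \<notin> K" "c \<notin> K" by blast
  then show ?thesis
  proof cases
    case 1 then show ?thesis using sepx'[of K c] assms by (auto simp: insert_commute)
  next
    case 2 then show ?thesis using sepy'[of K c] assms by (auto simp: insert_commute)
  next
    case 3
    then have "clo E V K {c} \<or> clo E V K {d}" using assms(6) by (auto simp: clo_def)
    then show ?thesis using c2D[of K] assms by blast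
  next
    case 4 then show ?thesis using star2[of K c d] assms by auto
  qed
qed

end

lemma successively_clique:
  assumes "\<And>a b. a \<in> set p \<Longrightarrow> b \<in> set p \<Longrightarrow> a \<noteq> b \<Longrightarrow> E a b" "distinct p"
  shows "successively E p"
  using assms
proof (induction p)
  case (Cons a p)
  then have "successively E p" by simp
  then show ?case using Cons.prems by (cases p) auto
qed simp

lemma clique_pl:
  assumes "finite K" "\<And>a b. a \<in> K \<Longrightarrow> b \<in> K \<Longrightarrow> a \<noteq> b \<Longrightarrow> E a b" "x \<in> K" "e \<in> K" "x \<noteq> e" "1 \<le> l" "l < card K"
  shows "pl E K x e l"
proof -
  have "card {x,e} = 2" using assms(5) by simp
  then have "card (K - {x,e}) = card K - 2" using assms(1,3,4) by (subst card_Diff_subset) auto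
  then have "l - 1 \<le> card (K - {x,e})" using assms(7) by simp
  then obtain A where A: "A \<subseteq> K - {x,e}" "card A = l - 1" "finite A"
    using obtain_subset_with_card_n by metis
  obtain xs where xs: "set xs = A" "distinct xs" using finite_distinct_list[OF A(3)] by blast
  have len: "length xs = l - 1" using xs A(2) distinct_card by metis
  let ?p = "x # xs @ [e]"
  have d: "distinct ?p" "set ?p \<subseteq> K" using xs A(1) assms(3-5) by auto
  have "successively E ?p" by (rule successively_clique) (use d assms(2) in auto)
  then have "pth E K x ?p e" using d by (simp add: pth_def)
  moreover have "length ?p = Suc l" using len assms(6) by simp
  ultimately show ?thesis unfolding pl_def by blast
qed

lemma pl2: "\<lbrakk>E a b; E b c; distinct [a,b,c]; {a,b,c} \<subseteq> S\<rbrakk> \<Longrightarrow> pl E S a c 2"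
  unfolding pl_def pth_def by (rule exI[of _ "[a,b,c]"]) auto

lemma pl3: "\<lbrakk>E a b; E b c; E c d; distinct [a,b,c,d]; {a,b,c,d} \<subseteq> S\<rbrakk> \<Longrightarrow> pl E S a d 3"
  unfolding pl_def pth_def by (rule exI[of _ "[a,b,c,d]"]) auto

lemma pl4: "\<lbrakk>E a b; E b c; E c d; E d e; distinct [a,b,c,d,e]; {a,b,c,d,e} \<subseteq> S\<rbrakk> \<Longrightarrow> pl E S a e 4"
  unfolding pl_def pth_def by (rule exI[of _ "[a,b,c,d,e]"]) auto

section \<open>Contracting a star or a clique at the root \<open>x\<close>\<close>

context mincex
begin

lemma fin_sub: "A \<subseteq> V \<Longrightarrow> finite A" using fin finite_subset by blast

lemma deg_split:
  assumes "w \<in> V" "w \<noteq> x" "w \<noteq> y" "w \<noteq> z" "C \<subseteq> V" "H \<subseteq> V" "\<And>b. b \<in> V \<Longrightarrow> E w b \<Longrightarrow> b \<in> C \<or> b \<in> H"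
  shows "k + 1 \<le> card {u\<in>C. E w u} + card {u\<in>H. E w u}"
proof -
  have "{u\<in>V. E w u} \<subseteq> {u\<in>C. E w u} \<union> {u\<in>H. E w u}" using assms(7) by auto
  then have "card {u\<in>V. E w u} \<le> card ({u\<in>C. E w u} \<union> {u\<in>H. E w u})"
    by (rule card_mono[rotated]) (use fin_sub assms in auto)
  also have "\<dots> \<le> card {u\<in>C. E w u} + card {u\<in>H. E w u}" by (rule card_Un_le)
  finally show ?thesis using deg[OF assms(1-4)] by linarith
qed

text \<open>Without triangles and 4-cycles at \<open>x\<close>, contracting the neighbourhood of \<open>x\<close> preserves all degrees.\<close>

lemma typeIII:
  assumes nt: "\<And>u v. u \<in> V \<Longrightarrow> v \<in> V \<Longrightarrow> E x u \<Longrightarrow> E x v \<Longrightarrow> \<not> E u v"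
    and nc: "\<And>w u v. w \<in> V \<Longrightarrow> w \<noteq> x \<Longrightarrow> w \<noteq> y \<Longrightarrow> u \<in> V \<Longrightarrow> v \<in> V \<Longrightarrow> E x u \<Longrightarrow> E x v \<Longrightarrow> E w u \<Longrightarrow> E w v \<Longrightarrow> u = v"
  shows False
proof -
  define T where "T = {u\<in>V. E x u}"
  have TV: "T \<subseteq> V" "x \<notin> T" "y \<notin> T" using irr nxy by (auto simp: T_def)
  have one: "card {u\<in>T'. E w u} \<le> (if \<exists>e\<in>T'. E e w then 1 else 0)"
    if "w \<in> V" "w \<noteq> x" "w \<noteq> y" "T' \<subseteq> T" for w T'
  proof (cases "\<exists>e\<in>T'. E e w")
    case True
    then obtain e where e: "e \<in> T'" "E e w" by blast
    then have "{u\<in>T'. E w u} \<subseteq> {e}" using nc[OF that(1-3), of _ e] that(4) sym by (auto simp: T_def)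
    then have "card {u\<in>T'. E w u} \<le> card {e}" by (rule card_mono[rotated]) simp
    then show ?thesis using True by simp
  next
    case False
    then have "{u\<in>T'. E w u} = {}" using sym by blast
    then have "card {u\<in>T'. E w u} = 0" by (metis card.empty)
    then show ?thesis by linarith
  qed
  let ?S = "V - {x} - T"
  define C where "C = compo E ?S y"
  have yS: "y \<in> ?S" using yV xy TV by auto
  have CS: "C \<subseteq> ?S" "y \<in> C" "cset E C y"
    using compo_sub[of E ?S y] compo_self[OF yS, of E] cset_compo[OF sg yS] by (auto simp: C_def)
  have nb: "b \<in> C \<or> b \<in> T" if "a \<in> C" "b \<in> V" "E a b" for a b
  proof (rule ccontr)
    assume n: "\<not> (b \<in> C \<or> b \<in> T)"
    have "b \<noteq> x" using that CS sym by (auto simp: T_def)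
    then have "b \<in> ?S" using n that by auto
    then show False using n that compo_closed[OF sg, of a ?S y b] by (simp add: C_def)
  qed
  show False
  proof (cases "C - {y,z} = {}")
    case False
    have f: "fam k (\<lambda>n. \<exists>e\<in>T. pl E (insert e C) e y n)"
    proof (rule reduce[where zs=z])
      show "T \<noteq> {}" using nbr_x by (auto simp: T_def)
      show "\<exists>a\<in>K. \<exists>e\<in>T. E e a"
        if "c \<in> C" "K \<noteq> {}" "K \<subseteq> C" "c \<notin> K" "y \<notin> K" "clo E C K {c}" for c K
      proof (rule ccontr)
        assume n: "\<not> ?thesis"
        have "clo E V K {c}"
        proof (rule cloI)
          fix a b assume ab: "a \<in> K" "b \<in> V" "E a b" "b \<notin> K"
          then have "b \<in> C" using nb[of a b] n sym that by blast
          then show "b \<in> {c}" using cloD[OF that(6), of a b] ab by auto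
        qed
        then show False using c2D[of K c] that CS by blast
      qed
      show "k + 1 \<le> card {u\<in>C. E w u} + (if \<exists>e\<in>T. E e w then 1 else 0)"
        if "2 \<le> k" "w \<in> C" "w \<noteq> y" "w \<noteq> z" for w
      proof -
        have w: "w \<in> V" "w \<noteq> x" using that CS by auto
        have "k + 1 \<le> card {u\<in>C. E w u} + card {u\<in>T. E w u}"
          by (rule deg_split) (use that w CS TV nb in auto)
        then show ?thesis using one[OF w that(3), of T] by auto
      qed
    qed (use CS TV k1 False in auto)
    show False
    proof (rule no_shift[OF f, of 1])
      fix n assume "\<exists>e\<in>T. pl E (insert e C) e y n"
      then obtain e where e: "e \<in> T" "pl E (insert e C) e y n" by blast
      have "pl E {x,e} x e 1" using e(1) TV by (intro pl_edge) (auto simp: T_def)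
      then show "pl E V x y (n + 1)" by (rule pl_append'[OF _ e(2)]) (use e CS TV xV in auto)
    qed
  next
    case True
    \<comment> \<open>If \<open>z\<close> were in the component, it would see only \<open>y\<close>
      and at most one vertex of \<open>T\<close>, as two of them would close a 4-cycle with
      \<open>x\<close>; \<open>degz\<close> with the roots exchanged excludes this.\<close>
    have C: "C = {y}"
    proof (rule ccontr)
      assume "C \<noteq> {y}"
      then have zC: "z \<in> C" "z \<noteq> y" using True CS by auto
      then have zz: "z \<in> V" "z \<noteq> x" using CS by auto
      have zb: "b = y \<or> b \<in> T" if "b \<in> V" "E z b" for b using nb[OF zC(1) that] True that irr by blast
      define t where "t = (SOME t. t \<in> T \<and> E z t)"
      have "b = y \<or> b = t" if "b \<in> V" "E z b" for b
      proof (cases "b \<in> T")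
        case bT: True
        then have "t \<in> T \<and> E z t" unfolding t_def using that by (intro someI_ex[of "\<lambda>t. t \<in> T \<and> E z t"]) blast
        then show ?thesis using nc[of z b t] zz zC that bT by (auto simp: T_def)
      qed (use zb that in blast)
      then show False using mincex.degz[OF swap, of t] zz zC by blast
    qed
    have Ny: "b \<in> T" if "b \<in> V" "E y b" for b using nb[of y b] C that irr by auto
    obtain t0 v where tv: "t0 \<noteq> v" "t0 \<in> V" "v \<in> V" "E y t0" "E y v" "t0 \<noteq> z" "v \<noteq> z" using two_nbrs_y by blast
    have tT: "t0 \<in> T" "v \<in> T" using Ny tv by auto
    \<comment> \<open>All neighbours of \<open>y\<close> lie in \<open>T\<close> now. One of them,
      \<open>t0\<close>, becomes the second root in the graph without \<open>x\<close> and
      \<open>y\<close>, and the rest of the star is contracted; the edges at \<open>x\<close> and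
      \<open>y\<close> add 2 to every length.\<close>
    let ?X = "T - {t0}"
    let ?S = "V - {x,y} - ?X"
    define C0 where "C0 = compo E ?S t0"
    have tS: "t0 \<in> ?S" using tT TV by auto
    have C0S: "C0 \<subseteq> ?S" "t0 \<in> C0" "cset E C0 t0"
      using compo_sub[of E ?S t0] compo_self[OF tS, of E] cset_compo[OF sg tS] by (auto simp: C0_def)
    have nb0: "b \<in> C0 \<or> b \<in> ?X" if "a \<in> C0" "a \<noteq> t0" "b \<in> V" "E a b" for a b
    proof (rule ccontr)
      assume n: "\<not> ?thesis"
      have aT: "a \<notin> T" using that C0S by auto
      have "b \<noteq> x" using that C0S sym aT by (auto simp: T_def)
      moreover have "b \<noteq> y" using Ny[of a] that C0S sym aT by auto
      ultimately have "b \<in> ?S" using n that by auto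
      then show False using n that compo_closed[OF sg, of a ?S t0 b] by (simp add: C0_def)
    qed
    have t0n: "b = x \<or> b = y \<or> b \<in> C0" if "b \<in> V" "E t0 b" for b
    proof -
      have "b \<notin> T" using nt[of t0 b] tT that by (auto simp: T_def)
      then show ?thesis using that compo_closed[OF sg, of t0 ?S t0 b] C0S by (auto simp: C0_def)
    qed
    have ne: "C0 - {t0,z} \<noteq> {}"
    proof
      assume e: "C0 - {t0,z} = {}"
      have sub: "{u\<in>V. E t0 u} \<subseteq> {x,y} \<union> {u. u = z \<and> u \<in> C0 \<and> E t0 u}" using t0n e irr by blast
      have "z \<in> C0 \<and> E t0 z"
      proof (rule ccontr)
        assume "\<not> ?thesis"
        then have "{u\<in>V. E t0 u} \<subseteq> {x,y}" using sub by blast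
        then have "card {u\<in>V. E t0 u} \<le> card {x,y}" by (rule card_mono[rotated]) simp
        moreover have "k + 1 \<le> card {u\<in>V. E t0 u}" using deg[of t0] tv tT TV by auto
        ultimately show False using k2 xy by auto
      qed
      then have zc: "z \<in> C0" "E t0 z" by auto
      then have zz: "z \<in> V" "z \<noteq> x" "z \<noteq> y" using C0S by auto
      have "b = x \<or> b = t0" if "b \<in> V" "E z b" for b
      proof -
        have "b \<in> T" using nb0[OF zc(1) tv(6)[symmetric] that] e irr that tT by blast
        then show ?thesis using nc[OF zz, of b t0] that tT zc sym by (auto simp: T_def)
      qed
      then show False using degz[OF zz] by blast
    qed
    have f: "fam k (\<lambda>n. \<exists>e\<in>?X. pl E (insert e C0) e t0 n)"
    proof (rule reduce[where zs=z])
      show "?X \<noteq> {}" using tT tv by auto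
      show "\<exists>a\<in>K. \<exists>e\<in>?X. E e a"
        if "c \<in> C0" "K \<noteq> {}" "K \<subseteq> C0" "c \<notin> K" "t0 \<notin> K" "clo E C0 K {c}" for c K
      proof (rule ccontr)
        assume n: "\<not> ?thesis"
        have "clo E V K {c}"
        proof (rule cloI)
          fix a b assume ab: "a \<in> K" "b \<in> V" "E a b" "b \<notin> K"
          then have "b \<in> C0" using nb0[of a b] n sym that by blast
          then show "b \<in> {c}" using cloD[OF that(6), of a b] ab by auto
        qed
        then show False using c2D[of K c] that C0S by blast
      qed
      show "k + 1 \<le> card {u\<in>C0. E w u} + (if \<exists>e\<in>?X. E e w then 1 else 0)"
        if "2 \<le> k" "w \<in> C0" "w \<noteq> t0" "w \<noteq> z" for w
      proof -
        have w: "w \<in> V" "w \<noteq> x" "w \<noteq> y" using that C0S by auto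
        have "k + 1 \<le> card {u\<in>C0. E w u} + card {u\<in>?X. E w u}"
          by (rule deg_split) (use that w C0S TV nb0 in auto)
        then show ?thesis using one[OF w, of ?X] by auto
      qed
    qed (use C0S TV k1 ne in auto)
    show False
    proof (rule no_shift[OF f, of 2])
      fix n assume "\<exists>e\<in>?X. pl E (insert e C0) e t0 n"
      then obtain e where e: "e \<in> ?X" "pl E (insert e C0) e t0 n" by blast
      have p1: "pl E {x,e} x e 1" using e(1) TV by (intro pl_edge) (auto simp: T_def)
      have p2: "pl E {t0,y} t0 y 1" using tv sym irr by (intro pl_edge) auto
      show "pl E V x y (n + 2)" by (rule pl_sandwich[OF p1 e(2) p2]) (use e C0S TV xV yV tT xy in auto)
    qed
  qed
qed

text \<open>The clique \<open>K\<close> joins \<open>x\<close> to each of its vertices by paths of all lengths below \<open>card K\<close>, and a vertex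
  outside with a non-neighbour in \<open>K\<close> loses at most \<open>card K - 2\<close> in degree.\<close>

lemma typeI_red:
  assumes K: "K \<subseteq> V" "x \<in> K" "y \<notin> K" "3 \<le> card K" "\<And>a b. a \<in> K \<Longrightarrow> b \<in> K \<Longrightarrow> a \<noteq> b \<Longrightarrow> E a b"
    and C: "C \<subseteq> V - K" "cset E C ys" "\<And>w b. w \<in> C \<Longrightarrow> w \<noteq> ys \<Longrightarrow> b \<in> V \<Longrightarrow> E w b \<Longrightarrow> b \<in> C \<or> b \<in> K"
    and y: "y \<in> C \<Longrightarrow> y = ys" and ne: "C - {ys,z} \<noteq> {}"
    and nv: "\<And>w. w \<in> C \<Longrightarrow> w \<noteq> ys \<Longrightarrow> w \<noteq> z \<Longrightarrow> \<exists>u\<in>K. \<not> E w u"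
    and T: "pl E T ys y r" "T \<inter> C \<subseteq> {ys}" "T \<subseteq> V - K"
  shows False
proof -
  define c where "c = card K"
  \<comment> \<open>The lengths 1 to c - 1 inside the clique turn k' into k' + c - 2 consecutive
    lengths by \<open>fam_clique\<close>, so k + 2 - c is enough; the maximum keeps k' positive for
    large cliques.\<close>
  define k' where "k' = max 1 (k + 2 - c)"
  let ?X = "K - {x}"
  have fK: "finite K" using K fin_sub by blast
  have Xne: "?X \<noteq> {}"
  proof
    assume "?X = {}"
    then have "K \<subseteq> {x}" by auto
    then have "card K \<le> card {x}" by (rule card_mono[rotated]) simp
    then show False using K(4) by simp
  qed
  have f: "fam k' (\<lambda>n. \<exists>e\<in>?X. pl E (insert e C) e ys n)"
  proof (rule reduce[where zs=z])
    show "\<exists>a\<in>L. \<exists>e\<in>?X. E e a"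
      if "c \<in> C" "L \<noteq> {}" "L \<subseteq> C" "c \<notin> L" "ys \<notin> L" "clo E C L {c}" for c L
    proof (rule ccontr)
      assume n: "\<not> ?thesis"
      have cl: "clo E V L {x,c}"
      proof (rule cloI)
        fix a b assume ab: "a \<in> L" "b \<in> V" "E a b" "b \<notin> L"
        then have "b \<in> C \<or> b \<in> K" using C(3)[of a b] that by blast
        then have "b \<in> C \<or> b = x" using n sym ab by blast
        then show "b \<in> {x,c}" using cloD[OF that(6), of a b] ab by auto
      qed
      have L: "L \<subseteq> V" "x \<notin> L" "y \<notin> L" using that C K y by auto
      show False
      proof (cases "c = y")
        case False then show False using sepx'[of L c] L that cl by blast
      next
        case True
        obtain u where "u \<in> ?X" using Xne by blast
        then have "u \<in> V" "u \<notin> L" "u \<noteq> x" "u \<noteq> y" using K C(1) that(3) by auto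
        then show False using sepxy[of L u] L that(2) cl True by blast
      qed
    qed
    show "k' + 1 \<le> card {u\<in>C. E w u} + (if \<exists>e\<in>?X. E e w then 1 else 0)"
      if that0: "2 \<le> k'" "w \<in> C" "w \<noteq> ys" "w \<noteq> z" for w
    proof -
      note that = that0
      have w: "w \<in> V" "w \<noteq> x" "w \<noteq> y" using that C K y by auto
      have s: "k + 1 \<le> card {u\<in>C. E w u} + card {u\<in>K. E w u}"
        by (rule deg_split) (use that w C K in auto)
      have kk: "k' = k + 2 - c" "c < k + 2" using that(1) by (auto simp: k'_def)
      obtain u where u: "u \<in> K" "\<not> E w u" using nv[OF that0(2-4)] by blast
      have "{u\<in>K. E w u} \<subseteq> K - {u}" using u by auto
      then have "card {u\<in>K. E w u} \<le> card (K - {u})" by (rule card_mono[rotated]) (use fK in auto)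
      then have r: "card {u\<in>K. E w u} \<le> c - 1" using u fK by (simp add: c_def)
      show ?thesis
      proof (cases "\<exists>e\<in>?X. E e w")
        case True then show ?thesis using s r kk K(4) by (simp add: c_def)
      next
        case False
        then have "{u\<in>K. E w u} \<subseteq> {x}" using sym by blast
        then have "card {u\<in>K. E w u} \<le> card {x}" by (rule card_mono[rotated]) simp
        then show ?thesis using s kk K(4) False by (simp add: c_def)
      qed
    qed
  qed (use K C ne Xne in \<open>auto simp: k'_def\<close>)
  have "\<exists>l. \<forall>i<k. pl E V x y (l + i + r)"
  proof (rule fam_clique[OF f, where r="c - 1"])
    show "2 \<le> c - 1" using K(4) by (simp add: c_def)
    show "k \<le> k' + (c - 1) - 1" "1 \<le> k'" using K(4) by (auto simp: k'_def c_def)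
    fix n l assume "\<exists>e\<in>?X. pl E (insert e C) e ys n" and l: "1 \<le> l" "l \<le> c - 1"
    then obtain e where e: "e \<in> ?X" "pl E (insert e C) e ys n" by blast
    have p: "pl E K x e l" by (rule clique_pl) (use fK K e l in \<open>auto simp: c_def\<close>)
    show "pl E V x y (n + l + r)"
      by (rule pl_sandwich[OF p e(2) T(1)]) (use e C K T in auto)
  qed
  then obtain l where "\<forall>i<k. pl E V x y (l + i + r)" by blast
  then have "fam k (pl E V x y)" by (intro famI1[of k _ "l + r"]) (simp add: ac_simps)
  then show False using ng by blast
qed

text \<open>A largest clique of this kind is contracted. If a vertex \<open>y0\<close> of
  \<open>C\<close> is adjacent to all of it, then adding \<open>y0\<close> must cut off
  \<open>y\<close> from everything but \<open>z\<close>; so \<open>y0\<close> replaces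
  \<open>y\<close> as the second root, with a fixed tail from \<open>y0\<close> to
  \<open>y\<close>.\<close>

lemma typeI_main:
  assumes K0: "K0 \<subseteq> V" "x \<in> K0" "y \<notin> K0" "3 \<le> card K0" "\<And>a b. a \<in> K0 \<Longrightarrow> b \<in> K0 \<Longrightarrow> a \<noteq> b \<Longrightarrow> E a b"
    "\<not> compo E (V - K0) y \<subseteq> {y,z}"
  shows False
proof -
  define F where "F K \<longleftrightarrow> K \<subseteq> V \<and> x \<in> K \<and> y \<notin> K \<and> 3 \<le> card K \<and> (\<forall>a\<in>K. \<forall>b\<in>K. a \<noteq> b \<longrightarrow> E a b) \<and>
    \<not> compo E (V - K) y \<subseteq> {y,z}" for K
  have "F K0" using K0 by (auto simp: F_def)
  moreover have "\<forall>K. F K \<longrightarrow> card K < card V + 1" using fin by (auto simp: F_def less_Suc_eq_le intro!: card_mono)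
  ultimately obtain K where K: "F K" and mx: "\<forall>K'. F K' \<longrightarrow> card K' \<le> card K"
    using ex_has_greatest_nat[of F K0 card "card V + 1"] by blast
  have Kf: "K \<subseteq> V" "x \<in> K" "y \<notin> K" "3 \<le> card K" and cl: "a \<in> K \<Longrightarrow> b \<in> K \<Longrightarrow> a \<noteq> b \<Longrightarrow> E a b" for a b
    using K by (auto simp: F_def)
  have fK: "finite K" using Kf fin_sub by blast
  let ?S = "V - K"
  define C where "C = compo E ?S y"
  have yS: "y \<in> ?S" using yV Kf by auto
  have CS: "C \<subseteq> ?S" "y \<in> C" "cset E C y"
    using compo_sub[of E ?S y] compo_self[OF yS, of E] cset_compo[OF sg yS] by (auto simp: C_def)
  have Cn: "\<not> C \<subseteq> {y,z}" using K by (auto simp: F_def C_def)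
  have nb: "b \<in> C \<or> b \<in> K" if "a \<in> C" "b \<in> V" "E a b" for a b
    using that compo_closed[OF sg, of a ?S y b] by (auto simp: C_def)
  show False
  proof (cases "\<exists>w\<in>C. w \<noteq> y \<and> w \<noteq> z \<and> (\<forall>u\<in>K. E w u)")
    case False
    show False
    proof (rule typeI_red[OF Kf cl, where C=C and ys=y and T="{y}" and r=0])
      show "pl E {y} y y 0" by (rule pl_refl) simp
    qed (use CS Cn nb False yV Kf in auto)
  next
    case True
    then obtain y0 where y0: "y0 \<in> C" "y0 \<noteq> y" "y0 \<noteq> z" "\<forall>u\<in>K. E y0 u" by blast
    have viol: "compo E (V - insert w K) y \<subseteq> {y,z}" if w: "w \<in> C" "w \<noteq> y" "w \<noteq> z" "\<forall>u\<in>K. E w u" for w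
    proof (rule ccontr)
      assume n: "\<not> ?thesis"
      have wK: "w \<notin> K" "w \<in> V" using w CS by auto
      have "F (insert w K)" unfolding F_def
        using Kf w wK n cl fK sym by auto
      then have "card (insert w K) \<le> card K" using mx by blast
      then show False using wK fK by simp
    qed
    let ?Sy = "V - insert y0 K"
    define Y where "Y = compo E ?Sy y"
    have Yz: "Y \<subseteq> {y,z}" using viol[OF y0] by (simp add: Y_def)
    have yS0: "y \<in> ?Sy" using yV Kf y0 by auto
    have Yf: "Y \<subseteq> ?Sy" "y \<in> Y" using compo_sub[of E ?Sy y] compo_self[OF yS0, of E] by (auto simp: Y_def)
    have Yc: "b \<in> Y" if "a \<in> Y" "b \<in> ?Sy" "E a b" for a b
      using that compo_closed[OF sg, of a ?Sy y b] by (simp add: Y_def)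
    have cy: "con E (insert y0 Y) y y0"
    proof -
      have "con E ?S y y0" using y0(1) by (simp add: C_def compo_def)
      then obtain w where w: "con E (?S - {y0}) y w" "E w y0" using con_last[of E ?S y y0] y0(2) by metis
      have "?S - {y0} = ?Sy" by auto
      then have "con E ?Sy y w" using w(1) by simp
      then have "con E Y y w" unfolding Y_def by (rule con_compo[OF sg])
      then have "con E (insert y0 Y) y w" by (rule con_mono) auto
      then show ?thesis by (rule con_step[OF sg]) (use w in auto)
    qed
    then obtain r where r: "pl E (insert y0 Y) y0 y r" using con_sym[OF sg] con_pl by metis
    let ?C = "C - Y"
    have YV: "Y \<subseteq> V - K" using Yf by auto
    have y0Y: "y0 \<notin> Y" using Yf by auto
    have y0V: "y0 \<in> V" "y0 \<notin> K" using y0 CS by auto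
    have sep: "b \<notin> Y" if "a \<in> ?C" "a \<noteq> y0" "E a b" for a b
      using Yc[of b a] that CS sym by auto
    have cs: "cset E ?C y0" unfolding cset_def
    proof (intro conjI allI impI)
      show "y0 \<in> ?C" using y0 y0Y by auto
      fix L assume L: "L \<noteq> {}" "L \<subseteq> ?C - {y0}"
      then obtain a b where "a \<in> L" "b \<in> C - L" "E a b" using csetD[OF CS(3), of L] Yf by auto
      then show "\<exists>a\<in>L. \<exists>b\<in>?C - L. E a b" using sep[of a b] L by blast
    qed
    show False
    proof (cases "?C - {y0,z} = {}")
      case False
      show False
      proof (rule typeI_red[OF Kf cl, where C="?C" and ys=y0 and T="insert y0 Y" and r=r])
        show "b \<in> ?C \<or> b \<in> K" if "w \<in> ?C" "w \<noteq> y0" "b \<in> V" "E w b" for w b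
          using nb[of w b] sep[of w b] that by auto
        show "\<exists>u\<in>K. \<not> E w u" if w: "w \<in> ?C" "w \<noteq> y0" "w \<noteq> z" for w
        proof (rule ccontr)
          assume "\<not> ?thesis"
          then have "compo E (V - insert w K) y \<subseteq> {y,z}" using viol[of w] w Yf by auto
          moreover have "con E (V - insert w K) y y0"
            by (rule con_mono[OF cy]) (use w YV y0V in auto)
          ultimately show False using y0 by (auto simp: compo_def)
        qed
      qed (use CS Yf r cs YV y0V False in auto)
    next
      case True
      \<comment> \<open>Too little is left for induction. The clique with \<open>y0\<close> gives
        lengths 1 to c up to \<open>y0\<close>; unless these suffice, the degree of
        \<open>y0\<close> forces k = c + 1, and a further neighbour of \<open>z\<close> supplies the
        missing length by a detour through \<open>z\<close> before or after
        \<open>y0\<close>.\<close>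
      then have C3: "C \<subseteq> {y,y0,z}" using Yz by auto
      define c where "c = card K"
      let ?K1 = "insert y0 K"
      have cl1: "a \<in> ?K1 \<Longrightarrow> b \<in> ?K1 \<Longrightarrow> a \<noteq> b \<Longrightarrow> E a b" for a b using cl y0(4) sym by auto
      have p1: "pl E ?K1 x y0 l" if "1 \<le> l" "l \<le> c" for l
        by (rule clique_pl) (use fK Kf cl1 that y0V in \<open>auto simp: c_def\<close>)
      have q: "pl E V x y (l + r)" if "1 \<le> l" "l \<le> c" for l
        by (rule pl_append'[OF p1[OF that] r]) (use YV y0V Kf in auto)
      have kc: "c < k"
      proof (rule ccontr)
        assume "\<not> c < k"
        then have "fam k (pl E V x y)" using q by (intro famI1[of k _ "1 + r"]) (metis One_nat_def Suc_leI add.assoc add.commute le_add1 linorder_not_less nat_less_le order_le_less_trans plus_1_eq_Suc)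
        then show False using ng by blast
      qed
      have sub: "{u\<in>V. E y0 u} \<subseteq> K \<union> {u\<in>{y,z}. u \<in> V \<and> E y0 u \<and> u \<notin> K}" using nb[OF y0(1)] C3 irr by blast
      have "k + 1 \<le> card {u\<in>V. E y0 u}" using deg[of y0] y0 y0V Kf by auto
      also have "\<dots> \<le> card (K \<union> {u\<in>{y,z}. u \<in> V \<and> E y0 u \<and> u \<notin> K})" by (rule card_mono[OF _ sub]) (use fK in auto)
      also have "\<dots> \<le> c + card {u\<in>{y,z}. u \<in> V \<and> E y0 u \<and> u \<notin> K}" unfolding c_def by (rule card_Un_le)
      finally have two: "2 \<le> card {u\<in>{y,z}. u \<in> V \<and> E y0 u \<and> u \<notin> K}" and le: "k + 1 \<le> c + card {u\<in>{y,z}. u \<in> V \<and> E y0 u \<and> u \<notin> K}" using kc by auto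
      have c2': "card {u\<in>{y,z}. u \<in> V \<and> E y0 u \<and> u \<notin> K} \<le> card {y,z}" by (rule card_mono) auto
      then have yz: "y \<noteq> z" using two by auto
      have "{u\<in>{y,z}. u \<in> V \<and> E y0 u \<and> u \<notin> K} = {y,z}"
        by (rule card_seteq) (use two yz in auto)
      then have e: "E y0 y" "E y0 z" "z \<in> V" "z \<notin> K" by auto
      have kk: "k = c + 1" using le kc c2' yz by auto
      have zC: "z \<in> C" using compo_closed[OF sg, of y0 ?S y z] y0 e by (auto simp: C_def)
      have ry: "pl E {y0,y} y0 y 1" using e y0 by (intro pl_edge) auto
      have zx: "z \<noteq> x" using e Kf by auto
      obtain b where b: "b \<in> V" "E z b" "b \<noteq> x" "b \<noteq> y0" using degz[of y0] e yz zx by blast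
      then consider "b = y" | "b \<in> K" using nb[OF zC, of b] C3 irr by blast
      then show False
      proof cases
        case 1
        have r2: "pl E {y0,z,y} y0 y 2" by (rule pl2[of E y0 z y]) (use e b 1 sym y0 yz in auto)
        have "pl E V x y (2 + i)" if "i < k" for i
        proof (cases "i < c")
          case True
          show ?thesis by (rule pl_append'[OF p1[of "i+1"] ry]) (use True Kf y0V yV y0 in auto)
        next
          case False
          then have "i = c" using that kk by auto
          then show ?thesis
            by (intro pl_append'[OF p1[of c] r2]) (use Kf y0V yV y0 e in \<open>auto simp: c_def\<close>)
        qed
        then show False using ng famI1[of k "pl E V x y" 2] by blast
      next
        case 2
        have pu: "pl E K x b (c - 1)"
          by (rule clique_pl) (use fK Kf cl b 2 in \<open>auto simp: c_def\<close>)
        have pz: "pl E {b,z,y0} b y0 2" by (rule pl2[of E b z y0]) (use e b 2 sym y0 y0V irr in auto)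
        have big: "pl E (insert z ?K1) x y0 (c + 1)"
          by (rule pl_append'[OF pu pz]) (use 2 e y0V Kf in \<open>auto simp: c_def\<close>)
        have "pl E V x y (2 + i)" if "i < k" for i
        proof (cases "i < c")
          case True
          show ?thesis by (rule pl_append'[OF p1[of "i+1"] ry]) (use True Kf y0V yV y0 in auto)
        next
          case False
          then have "i = c" using that kk by auto
          then show ?thesis
            by (intro pl_append'[OF big ry]) (use Kf y0V yV y0 e yz in \<open>auto simp: c_def\<close>)
        qed
        then show False using ng famI1[of k "pl E V x y" 2] by blast
      qed
    qed
  qed
qed

text \<open>By \<open>typeI_main\<close> the triangle separates \<open>y\<close> from all other
  vertices except possibly \<open>z\<close>, so the two neighbours of \<open>y\<close> other than
  \<open>z\<close> can only be \<open>u\<close> and \<open>v\<close>.\<close>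

lemma tri_x:
  assumes "u \<in> V" "v \<in> V" "E x u" "E x v" "E u v"
  shows "E y u" "E y v" "u \<noteq> z" "v \<noteq> z" "compo E (V - {x,u,v}) y \<subseteq> {y,z}"
proof -
  have uv: "u \<noteq> v" "u \<noteq> x" "v \<noteq> x" "u \<noteq> y" "v \<noteq> y" using assms irr nxy by auto
  have c: "compo E (V - {x,u,v}) y \<subseteq> {y,z}"
  proof (rule ccontr)
    assume "\<not> ?thesis"
    then show False using typeI_main[of "{x,u,v}"] assms xV uv xy sym by auto
  qed
  then show "compo E (V - {x,u,v}) y \<subseteq> {y,z}" .
  have yS: "y \<in> V - {x,u,v}" using yV uv xy by auto
  have in3: "w \<in> {u,v}" if "w \<in> V" "E y w" "w \<noteq> z" for w
  proof (rule ccontr)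
    assume "w \<notin> {u,v}"
    then have "w \<in> V - {x,u,v}" using that nyx by auto
    then have "w \<in> compo E (V - {x,u,v}) y"
      using compo_closed[OF sg compo_self[OF yS], of w] that by blast
    then show False using c that irr by auto
  qed
  obtain a b where ab: "a \<noteq> b" "a \<in> V" "b \<in> V" "E y a" "E y b" "a \<noteq> z" "b \<noteq> z" using two_nbrs_y by blast
  then have "{a,b} = {u,v}" using in3[of a] in3[of b] by auto
  then show "E y u" "E y v" "u \<noteq> z" "v \<noteq> z" using ab by (auto simp: doubleton_eq_iff)
qed

text \<open>By symmetry both roots have neighbours only among \<open>u\<close>, \<open>v\<close>,
  \<open>z\<close>, so after deleting the roots induction applies with roots \<open>u\<close> and
  \<open>v\<close>. If there are no vertices besides these five, paths of lengths 2, 3 and 4 are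
  exhibited.\<close>

lemma typeI:
  assumes "u \<in> V" "v \<in> V" "E x u" "E x v" "E u v"
  shows False
proof -
  note t = tri_x[OF assms]
  have t': "compo E (V - {y,u,v}) x \<subseteq> {x,z}" using mincex.tri_x(5)[OF swap assms(1,2) t(1,2) assms(5)] .
  have uv: "u \<noteq> v" "u \<noteq> x" "v \<noteq> x" "u \<noteq> y" "v \<noteq> y" using assms irr nxy by auto
  have xS: "x \<in> V - {y,u,v}" and yS: "y \<in> V - {x,u,v}" using xV yV uv xy by auto
  have inX: "b \<in> {x,z,y,u,v}" if "a \<in> compo E (V - {y,u,v}) x" "b \<in> V" "E a b" for a b
    using compo_closed[OF sg that(1), of b] that t' by blast
  have inY: "b \<in> {y,z,x,u,v}" if "a \<in> compo E (V - {x,u,v}) y" "b \<in> V" "E a b" for a b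
    using compo_closed[OF sg that(1), of b] that t(5) by blast
  have nx: "b \<in> {u,v,z}" if "b \<in> V" "E x b" for b
    using inX[OF compo_self[OF xS] that] that irr nxy by auto
  have ny: "b \<in> {u,v,z}" if "b \<in> V" "E y b" for b
    using inY[OF compo_self[OF yS] that] that irr nyx by auto
  have main: False if h: "V' \<subseteq> V - {x,y}" "u \<in> V'" "v \<in> V'" "\<And>a b. a \<in> V' \<Longrightarrow> a \<noteq> u \<Longrightarrow> a \<noteq> v \<Longrightarrow> b \<in> V \<Longrightarrow> E a b \<Longrightarrow> b \<in> V'"
    "V' - {u,v,z'} \<noteq> {}" "z \<in> V' \<Longrightarrow> z' = z" for V' z'
  proof -
    have f: "fam k (pl E V' u v)"
    proof (rule IHsub[where z'=z'])
      show "conn2 E V' u v"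
      proof (rule conn2_cloI)
        fix K c assume K: "K \<noteq> {}" "K \<subseteq> V'" "u \<notin> K" "v \<notin> K" "clo E V' K {c}"
        have "clo E V K {c}"
        proof (rule cloI)
          fix a b assume ab: "a \<in> K" "b \<in> V" "E a b" "b \<notin> K"
          then have "b \<in> V'" using h(4)[of a b] K by blast
          then show "b \<in> {c}" using cloD[OF K(5), of a b] ab by auto
        qed
        then show False using c2D[of K c] K h(1) by blast
      qed
      show "w \<noteq> x \<and> w \<noteq> y \<and> w \<noteq> z \<and> (\<forall>b\<in>V. E w b \<longrightarrow> b \<in> V')"
        if "w \<in> V'" "w \<noteq> u" "w \<noteq> v" "w \<noteq> z'" for w
        using that h(1,6) h(4)[of w] by blast
    qed (use h xV uv in auto)
    have p1: "pl E {x,u} x u 1" using assms uv by (intro pl_edge) auto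
    have p2: "pl E {v,y} v y 1" using t uv sym by (intro pl_edge) auto
    show False
    proof (rule no_shift[OF f, of 2])
      fix n assume p: "pl E V' u v n"
      show "pl E V x y (n + 2)" by (rule pl_sandwich[OF p1 p p2]) (use h xV yV uv xy in auto)
    qed
  qed
  have D: "V \<subseteq> {x,y,u,v,z}"
  proof (rule ccontr)
    assume "\<not> ?thesis"
    then obtain w where w: "w \<in> V" "w \<notin> {x,y,u,v,z}" by blast
    show False
    \<comment> \<open>If \<open>z\<close> sees a root, it sees nothing beyond the roots,
      \<open>u\<close> and \<open>v\<close>, and is deleted as well; otherwise it remains the
      exceptional vertex.\<close>
    proof (cases "z \<in> V \<and> (E x z \<or> E y z)")
      case True
      then have zz: "z \<noteq> x" "z \<noteq> y" using irr nxy nyx by auto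
      have nz: "b \<in> {x,y,u,v}" if "b \<in> V" "E z b" for b
      proof (cases "E x z")
        case True
        then have "z \<in> compo E (V - {y,u,v}) x"
          using compo_closed[OF sg compo_self[OF xS], of z] \<open>z \<in> V \<and> _\<close> zz t(3,4) by auto
        then show ?thesis using inX[of z b] that irr by auto
      next
        case False
        then have "z \<in> compo E (V - {x,u,v}) y"
          using compo_closed[OF sg compo_self[OF yS], of z] True zz t(3,4) by auto
        then show ?thesis using inY[of z b] that irr by auto
      qed
      show False
      proof (rule main[of "V - {x,y,z}" x])
        fix a b assume "a \<in> V - {x,y,z}" "a \<noteq> u" "a \<noteq> v" "b \<in> V" "E a b"
        then show "b \<in> V - {x,y,z}" using nx[of a] ny[of a] nz[of a] sym by auto
      qed (use assms uv t w in auto)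
    next
      case False
      show False
      proof (rule main[of "V - {x,y}" z])
        fix a b assume "a \<in> V - {x,y}" "a \<noteq> u" "a \<noteq> v" "b \<in> V" "E a b"
        then show "b \<in> V - {x,y}" using nx[of a] ny[of a] False sym by auto
      qed (use assms uv t w in auto)
    qed
  qed
  have p2: "pl E V x y 2" by (rule pl2[of E x u y]) (use assms t sym uv xy xV yV in auto)
  have p3: "pl E V x y 3" by (rule pl3[of E x u v y]) (use assms t sym uv xy xV yV in auto)
  have k3: "3 \<le> k"
  proof (rule ccontr)
    assume "\<not> 3 \<le> k"
    then have "fam k (pl E V x y)"
    proof (intro famI1[of k _ 2])
      fix i assume "i < k"
      then have "i = 0 \<or> i = 1" using \<open>\<not> 3 \<le> k\<close> by auto
      then show "pl E V x y (2 + i)" using p2 p3 by (elim disjE) simp_all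
    qed
    then show False using ng by blast
  qed
  have full: "{b\<in>V. E a b} = {x,y,a',z} \<and> k = 3" if "{a,a'} = {u,v}" for a a'
  proof -
    have sub: "{b\<in>V. E a b} \<subseteq> {x,y,a',z}" using D that irr by (auto simp: doubleton_eq_iff)
    have c4: "card {x,y,a',z} \<le> 4" by (simp add: card_insert_if)
    have "k + 1 \<le> card {b\<in>V. E a b}" using deg[of a] that assms uv t by (auto simp: doubleton_eq_iff)
    moreover have "card {b\<in>V. E a b} \<le> card {x,y,a',z}" by (rule card_mono[OF _ sub]) simp
    ultimately have "k = 3" "card {x,y,a',z} \<le> card {b\<in>V. E a b}" using k3 c4 by auto
    then show ?thesis using card_seteq[OF _ sub] by auto
  qed
  have zz: "z \<in> V" "E u z" "E v z" "k = 3" using full[of u v] full[of v u] by auto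
  have zn: "z \<noteq> x" "z \<noteq> y"
  proof -
    have "k + 1 \<le> card {b\<in>V. E u b}" using deg[of u] assms uv t by auto
    then have "4 \<le> card {x,y,v,z}" using full[of u v] by auto
    then show "z \<noteq> x" "z \<noteq> y" by (auto simp: card_insert_if split: if_splits)
  qed
  have p4: "pl E V x y 4" by (rule pl4[of E x u z v y]) (use assms t sym uv xy xV yV zz zn in auto)
  have "fam k (pl E V x y)"
  proof (rule famI2[of k _ 2])
    fix i assume "i \<le> k div 2"
    then have "i = 0 \<or> i = 1" using zz(4) by auto
    then show "pl E V x y (2 + 2 * i)" using p2 p4 by (elim disjE) simp_all
  qed
  then show False using ng by blast
qed

end

text \<open>A 4-cycle \<open>x, t, x1, s\<close> leads from \<open>x\<close> to either of \<open>t\<close>, \<open>s\<close> by paths of length 1 and 3.\<close>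

locale c4 = mincex +
  fixes x1 t s
  assumes ntx: "\<And>u v. u \<in> V \<Longrightarrow> v \<in> V \<Longrightarrow> E x u \<Longrightarrow> E x v \<Longrightarrow> \<not> E u v"
    and nty: "\<And>u v. u \<in> V \<Longrightarrow> v \<in> V \<Longrightarrow> E y u \<Longrightarrow> E y v \<Longrightarrow> \<not> E u v"
    and x1: "x1 \<in> V" "x1 \<noteq> x" "x1 \<noteq> y"
    and ts: "t \<in> V" "s \<in> V" "t \<noteq> s" "E x t" "E x s" "E x1 t" "E x1 s"
begin

lemma ts_neq: "t \<noteq> x" "t \<noteq> y" "t \<noteq> x1" "s \<noteq> x" "s \<noteq> y" "s \<noteq> x1" "\<not> E t s" "\<not> E s t" "\<not> E x x1" "\<not> E x1 x"
proof -
  show "t \<noteq> x" "t \<noteq> y" "t \<noteq> x1" "s \<noteq> x" "s \<noteq> y" "s \<noteq> x1" using ts irr nxy by auto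
  show "\<not> E t s" "\<not> E s t" "\<not> E x x1" using ntx ts x1 sym by blast+
  then show "\<not> E x1 x" using sym by blast
qed

lemma con_ty: "con E (V - {x,x1}) t y"
proof (rule ccontr)
  assume n: "\<not> ?thesis"
  have "t \<in> V - {x,x1}" using ts ts_neq by auto
  then obtain R where R: "t \<in> R" "R \<subseteq> V - {x,x1}" "y \<notin> R" "\<forall>a\<in>R. \<forall>b\<in>V - {x,x1}. E a b \<longrightarrow> b \<in> R"
    using con_or_sep[OF sg, of t "V - {x,x1}" y] n by blast
  have "clo E V R {x,x1}" using R by (intro cloI) blast
  then show False using sepx'[of R x1] R x1 by blast
qed

text \<open>For k <= 3 the progression needs only two terms, which the 4-cycle provides:
  \<open>b\<close> is the first of \<open>t\<close>, \<open>s\<close> met from \<open>y\<close>, so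
  the other one is free for the detour of length 3.\<close>

lemma k4: "4 \<le> k"
proof (rule ccontr)
  assume k: "\<not> 4 \<le> k"
  obtain b where b: "b \<in> {t,s}" "con E (V - {x,x1} - ({t,s} - {b})) y b"
    by (rule first_hit[OF con_sym[OF sg con_ty], of "{t,s}"]) auto
  let ?W = "V - {x,x1} - ({t,s} - {b})"
  obtain r where r: "pl E ?W b y r" using con_sym[OF sg b(2)] by (auto simp: con_pl)
  obtain a where a: "a \<in> {t,s}" "a \<noteq> b" "{a,b} = {t,s}" using b(1) ts(3) by auto
  have p1: "pl E {x,b} x b 1" using b(1) ts ts_neq by (intro pl_edge) auto
  have p3: "pl E {x,a,x1,b} x b 3"
    by (rule pl3[of E x a x1 b]) (use a(1,2) b(1) ts ts_neq x1 sym in auto)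
  have q1: "pl E V x y (1 + r)" by (rule pl_append'[OF p1 r]) (use b(1) xV ts in auto)
  have q3: "pl E V x y (3 + r)" by (rule pl_append'[OF p3 r]) (use a b(1) xV x1 ts in auto)
  have "fam k (pl E V x y)"
  proof (rule famI2[of k _ "1 + r"])
    fix i assume "i \<le> k div 2"
    then have "i = 0 \<or> i = 1" using k by auto
    then show "pl E V x y (1 + r + 2 * i)" using q1 q3 by (elim disjE) (simp_all add: numeral_3_eq_3)
  qed
  then show False using ng by blast
qed

text \<open>A fixed path leads from \<open>v\<close> to \<open>y\<close> outside \<open>D\<close>,
  so induction can use the roots \<open>x\<close> and \<open>v\<close>. If \<open>x1\<close> has two
  neighbours in the piece, it stays as exceptional vertex; otherwise it is dropped, and its possible
  neighbour \<open>q\<close> in \<open>D\<close> becomes exceptional.\<close>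

lemma lobe:
  assumes v: "v \<in> V" "v \<noteq> x" "v \<noteq> x1" and D: "D \<noteq> {}" "D \<subseteq> V" "x \<notin> D" "x1 \<notin> D" "v \<notin> D" "y \<notin> D" "t \<notin> D"
    "clo E V D {x,x1,v}" "z \<notin> D"
  shows False
proof -
  have tail: "con E (V - D - {x,x1}) v y"
  proof (rule ccontr)
    assume n: "\<not> ?thesis"
    have "v \<in> V - D - {x,x1}" using v D by auto
    then obtain R where R: "v \<in> R" "R \<subseteq> V - D - {x,x1}" "y \<notin> R" "\<forall>a\<in>R. \<forall>b\<in>V - D - {x,x1}. E a b \<longrightarrow> b \<in> R"
      using con_or_sep[OF sg, of v "V - D - {x,x1}" y] n by blast
    have "clo E V (R \<union> D) {x,x1}" using R D(8) unfolding clo_def by blast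
    then show False using sepx'[of "R \<union> D" x1] R x1 D by blast
  qed
  then obtain r where r: "pl E (V - D - {x,x1}) v y r" by (auto simp: con_pl)
  have fin: False if "fam k (pl E V' x v)" "V' \<subseteq> D \<union> {x,x1,v}" for V'
  proof (rule no_shift[OF that(1), of r])
    fix n assume "pl E V' x v n"
    then show "pl E V x y (n + r)" by (rule pl_append'[OF _ r]) (use that D v xV x1 in auto)
  qed
  show False
  proof (cases "\<forall>c. \<exists>b\<in>D \<union> {x,v}. b \<noteq> c \<and> E x1 b")
    case True
    let ?V = "D \<union> {x,x1,v}"
    have "fam k (pl E ?V x v)"
    proof (rule IHsub[where z'=x1])
      show "?V \<subset> V"
      proof (cases "v = y")
        case True then have "t \<notin> ?V" using D ts_neq by auto
        then show ?thesis using ts D v xV x1 by auto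
      next
        case False then have "y \<notin> ?V" using D xy x1 by auto
        then show ?thesis using yV D v xV x1 by auto
      qed
      show "conn2 E ?V x v"
      proof (rule conn2_cloI)
        fix K c assume K: "K \<noteq> {}" "K \<subseteq> ?V" "x \<notin> K" "v \<notin> K" "clo E ?V K {c}"
        let ?K = "K - {x1}"
        have KD: "?K \<subseteq> D" using K by auto
        have cl: "clo E V ?K ({c} \<union> (K \<inter> {x1}))"
        proof (rule cloI)
          fix a b assume ab: "a \<in> ?K" "b \<in> V" "E a b" "b \<notin> ?K"
          then have "b \<in> ?V" using cloD[OF D(8), of a b] KD by auto
          then show "b \<in> {c} \<union> (K \<inter> {x1})" using cloD[OF K(5), of a b] ab by auto
        qed
        show False
        proof (cases "x1 \<in> K")
          case False
          then have "?K = K" "K \<inter> {x1} = {}" by auto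
          then have "clo E V K {c}" using cl by simp
          then show False using c2D[of K c] K KD False D by blast
        next
          case x1K: True
          show False
          proof (cases "?K = {}")
            case True
            obtain b where "b \<in> D \<union> {x,v}" "b \<noteq> c" "E x1 b" using \<open>\<forall>c. _\<close> by blast
            then show False using cloD[OF K(5) x1K, of b] K True D by auto
          next
            case False
            have "clo E V ?K {x1,c}" using cl x1K by (auto simp: clo_def)
            then have "?K = {z}" using star2'[of ?K x1 c] False KD K D x1 by blast
            then show False using KD D by auto
          qed
        qed
      qed
      show "w \<noteq> x \<and> w \<noteq> y \<and> w \<noteq> z \<and> (\<forall>u\<in>V. E w u \<longrightarrow> u \<in> ?V)"
        if "w \<in> ?V" "w \<noteq> x" "w \<noteq> v" "w \<noteq> x1" for w
        using that D cloD[OF D(8), of w] by auto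
    qed (use v D in auto)
    then show False by (rule fin) auto
  next
    case False
    then obtain q where q: "\<And>b. b \<in> D \<Longrightarrow> E x1 b \<Longrightarrow> b = q" by blast
    let ?V = "D \<union> {x,v}"
    have "fam k (pl E ?V x v)"
    proof (rule IHsub[where z'=q])
      have "x1 \<notin> ?V" using D v x1 by auto
      then show "?V \<subset> V" using D v xV x1 by auto
      show "conn2 E ?V x v"
      proof (rule conn2_cloI)
        fix K c assume K: "K \<noteq> {}" "K \<subseteq> ?V" "x \<notin> K" "v \<notin> K" "clo E ?V K {c}"
        have KD: "K \<subseteq> D" using K by auto
        have "clo E V K {x1,c}"
        proof (rule cloI)
          fix a b assume ab: "a \<in> K" "b \<in> V" "E a b" "b \<notin> K"
          then have "b \<in> ?V \<or> b = x1" using cloD[OF D(8), of a b] KD by auto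
          then show "b \<in> {x1,c}" using cloD[OF K(5), of a b] ab by auto
        qed
        then have "K = {z}" using star2'[of K x1 c] KD K D x1 by blast
        then show False using KD D by auto
      qed
      show "?V - {x,v,q} \<noteq> {}"
      proof
        assume "?V - {x,v,q} = {}"
        then have Dq: "D = {q}" using D by auto
        then have sub: "{u\<in>V. E q u} \<subseteq> {x,x1,v}" using cloD[OF D(8), of q] irr by auto
        have "k + 1 \<le> card {u\<in>V. E q u}" using deg[of q] Dq D by auto
        also have "\<dots> \<le> card {x,x1,v}" by (rule card_mono[OF _ sub]) simp
        also have "\<dots> \<le> 3" by (simp add: card_insert_if)
        finally show False using k4 by simp
      qed
      show "w \<noteq> x \<and> w \<noteq> y \<and> w \<noteq> z \<and> (\<forall>u\<in>V. E w u \<longrightarrow> u \<in> ?V)"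
        if "w \<in> ?V" "w \<noteq> x" "w \<noteq> v" "w \<noteq> q" for w
        using that D cloD[OF D(8), of w] q[of w] sym by auto
    qed (use v D in auto)
    then show False by (rule fin) auto
  qed
qed

text \<open>Deleting \<open>W\<close> removes \<open>z\<close>, and apart from the roots only
  \<open>x1\<close> can lose neighbours, so \<open>x1\<close> takes over as exceptional vertex. The
  edges at \<open>t\<close> and \<open>s\<close> prevent a set around \<open>x1\<close> from having
  a single outer neighbour.\<close>

lemma omega:
  assumes W: "W \<subseteq> V" "x \<notin> W" "y \<notin> W" "x1 \<notin> W" "t \<notin> W" "s \<notin> W" "z \<in> W" "clo E V W {x,x1,y}" and yt: "E y t \<or> E y s"
  shows False
proof -
  let ?V = "V - W"
  have f: "fam k (pl E ?V x y)"
  proof (rule IHsub[where z'=x1])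
    show "conn2 E ?V x y"
    proof (rule conn2_cloI)
      fix K c assume K: "K \<noteq> {}" "K \<subseteq> ?V" "x \<notin> K" "y \<notin> K" "clo E ?V K {c}"
      show False
      proof (cases "x1 \<in> K")
        case False
        have "clo E V K {c}"
        proof (rule cloI)
          fix a b assume ab: "a \<in> K" "b \<in> V" "E a b" "b \<notin> K"
          have "b \<notin> W" using cloD[OF W(8), of b a] sym ab K False by blast
          then show "b \<in> {c}" using cloD[OF K(5), of a b] ab by auto
        qed
        then show False using c2D[of K c] K by blast
      next
        case True
        have 1: "t \<in> K \<or> t = c" "s \<in> K \<or> s = c" using cloD[OF K(5) True] ts W by auto
        have 2: "t \<in> K \<Longrightarrow> x = c" "s \<in> K \<Longrightarrow> x = c" using cloD[OF K(5), of _ x] ts sym xV W K(3) by blast+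
        have 3: "t \<in> K \<Longrightarrow> s \<in> K \<Longrightarrow> y = c" using cloD[OF K(5), of _ y] yt sym yV W K(4) by blast
        show False using 1 2 3 ts(3) xy ts_neq by metis
      qed
    qed
    show "?V - {x,y,x1} \<noteq> {}" using ts ts_neq W by auto
    show "w \<noteq> x \<and> w \<noteq> y \<and> w \<noteq> z \<and> (\<forall>u\<in>V. E w u \<longrightarrow> u \<in> ?V)"
      if "w \<in> ?V" "w \<noteq> x" "w \<noteq> y" "w \<noteq> x1" for w
    proof -
      have "u \<notin> W" if "u \<in> V" "E w u" for u using cloD[OF W(8), of u w] sym that \<open>w \<in> ?V\<close> \<open>w \<noteq> x\<close> \<open>w \<noteq> y\<close> \<open>w \<noteq> x1\<close> by blast
      then show ?thesis using that W by auto
    qed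
  qed (use W xV yV xy in auto)
  show False by (rule no_shift[OF f, of 0]) (use pl_mono[of E ?V x y _ V] in auto)
qed

text \<open>The pair \<open>{t,s}\<close> is contracted with k - 2. A vertex next to
  \<open>t\<close> or \<open>s\<close> is not adjacent to \<open>x\<close> for lack of triangles, so
  it loses at most three neighbours and regains one; any other vertex loses at most \<open>x\<close>
  and \<open>x1\<close>. The lengths 1 and 3 restore k by \<open>fam_two\<close>.\<close>

lemma typeII_red:
  assumes C: "C \<subseteq> V" "x \<notin> C" "x1 \<notin> C" "t \<notin> C" "s \<notin> C" "cset E C y"
    and nb: "\<And>w b. w \<in> C \<Longrightarrow> w \<noteq> y \<Longrightarrow> w \<noteq> zs \<Longrightarrow> b \<in> V \<Longrightarrow> E w b \<Longrightarrow> b \<in> C \<or> b \<in> {x,x1,t,s}"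
    and nz: "\<And>w. w \<in> C \<Longrightarrow> w \<noteq> y \<Longrightarrow> w \<noteq> zs \<Longrightarrow> w \<noteq> z"
    and b: "\<And>c K. c \<in> C \<Longrightarrow> K \<noteq> {} \<Longrightarrow> K \<subseteq> C \<Longrightarrow> c \<notin> K \<Longrightarrow> y \<notin> K \<Longrightarrow> clo E C K {c} \<Longrightarrow> \<exists>a\<in>K. E a t \<or> E a s"
    and ne: "C - {y,zs} \<noteq> {}"
  shows False
proof -
  have f: "fam (k - 2) (\<lambda>n. \<exists>e\<in>{t,s}. pl E (insert e C) e y n)"
  proof (rule reduce[where zs=zs])
    show "\<exists>a\<in>K. \<exists>e\<in>{t,s}. E e a"
      if "c \<in> C" "K \<noteq> {}" "K \<subseteq> C" "c \<notin> K" "y \<notin> K" "clo E C K {c}" for c K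
      using b[OF that] sym by blast
    show "k - 2 + 1 \<le> card {u\<in>C. E w u} + (if \<exists>e\<in>{t,s}. E e w then 1 else 0)"
      if w: "w \<in> C" "w \<noteq> y" "w \<noteq> zs" for w
    proof -
      have wV: "w \<in> V" "w \<noteq> x" using w C by auto
      have d: "k + 1 \<le> card {u\<in>C. E w u} + card {u\<in>{x,x1,t,s}. E w u}"
        by (rule deg_split) (use w wV C nb nz xV x1 ts in auto)
      show ?thesis
      proof (cases "\<exists>e\<in>{t,s}. E e w")
        case True
        then have "\<not> E w x" using ntx[of w t] ntx[of w s] ts sym wV by blast
        then have sub: "{u\<in>{x,x1,t,s}. E w u} \<subseteq> {x1,t,s}" by auto
        have "card {u\<in>{x,x1,t,s}. E w u} \<le> card {x1,t,s}" by (rule card_mono[OF _ sub]) simp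
        also have "\<dots> \<le> 3" by (simp add: card_insert_if)
        finally show ?thesis using d k4 True by simp
      next
        case False
        then have sub: "{u\<in>{x,x1,t,s}. E w u} \<subseteq> {x,x1}" using sym by auto
        have "card {u\<in>{x,x1,t,s}. E w u} \<le> card {x,x1}" by (rule card_mono[OF _ sub]) simp
        also have "\<dots> \<le> 2" by (simp add: card_insert_if)
        finally show ?thesis using d k4 False by simp
      qed
    qed
  qed (use C ne ts ts_neq k4 in auto)
  have "fam (k - 2 + 2) (pl E V x y)"
  proof (rule fam_two[OF f, of _ 1])
    fix n assume "\<exists>e\<in>{t,s}. pl E (insert e C) e y n"
    then obtain e where e: "e \<in> {t,s}" "pl E (insert e C) e y n" by blast
    obtain a where a: "a \<in> {t,s}" "a \<noteq> e" using e(1) ts(3) by auto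
    have p1: "pl E {x,e} x e 1" using e(1) ts ts_neq by (intro pl_edge) auto
    have p3: "pl E {x,a,x1,e} x e 3"
      by (rule pl3[of E x a x1 e]) (use a e(1) ts ts_neq x1 sym in auto)
    have "pl E V x y (n + 1)" by (rule pl_append'[OF p1 e(2)]) (use e(1) xV ts C in auto)
    moreover have "pl E V x y (n + 1 + 2)" by (rule pl_append'[OF p3 e(2)]) (use a e(1) xV x1 ts C in auto)
    ultimately show "pl E V x y (n + 1) \<and> pl E V x y (n + 1 + 2)" by blast
  qed (use k4 in auto)
  moreover have "k - 2 + 2 = k" using k4 by simp
  ultimately show False using ng by simp
qed

text \<open>The reduction fails only if some part \<open>D\<close> of \<open>C\<close> behind a cut vertex \<open>v\<close> misses \<open>t\<close> and \<open>s\<close>; such a part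
  contains \<open>z\<close>, so a largest one can be cut off with \<open>v\<close> as the new exceptional vertex.\<close>

lemma y_side:
  assumes Cd: "C = compo E (V - {x,x1,t,s}) y"
  shows "C \<subseteq> {y,z} \<or> (\<exists>v D. v \<in> C \<and> D \<subseteq> C \<and> v \<notin> D \<and> y \<notin> D \<and> z \<in> D \<and> clo E C D {v} \<and>
    (\<forall>a\<in>D. \<not> E a t \<and> \<not> E a s) \<and> C - D \<subseteq> {y,v})"
proof -
  let ?S = "V - {x,x1,t,s}"
  have yS: "y \<in> ?S" using yV xy x1 ts_neq by auto
  have CS: "C \<subseteq> ?S" "y \<in> C" "cset E C y"
    using compo_sub[of E ?S y] compo_self[OF yS, of E] cset_compo[OF sg yS] by (auto simp: Cd)
  have nb: "b \<in> C \<or> b \<in> {x,x1,t,s}" if "a \<in> C" "b \<in> V" "E a b" for a b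
    using that compo_closed[OF sg, of a ?S y b] by (auto simp: Cd)
  define bad where "bad v D \<longleftrightarrow> v \<in> C \<and> D \<noteq> {} \<and> D \<subseteq> C \<and> v \<notin> D \<and> y \<notin> D \<and> clo E C D {v} \<and> (\<forall>a\<in>D. \<not> E a t \<and> \<not> E a s)" for v D
  have badz: "z \<in> D" if "bad v D" for v D
  proof (rule ccontr)
    assume n: "z \<notin> D"
    have h: "v \<in> C" "D \<noteq> {}" "D \<subseteq> C" "v \<notin> D" "y \<notin> D" "clo E C D {v}" "\<forall>a\<in>D. \<not> E a t \<and> \<not> E a s"
      using that by (auto simp: bad_def)
    have "clo E V D {x,x1,v}"
    proof (rule cloI)
      fix a b assume ab: "a \<in> D" "b \<in> V" "E a b" "b \<notin> D"
      then have "b \<in> C \<or> b \<in> {x,x1}" using nb[of a b] h by blast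
      then show "b \<in> {x,x1,v}" using cloD[OF h(6), of a b] ab by auto
    qed
    then show False using lobe[of v D] h CS n by blast
  qed
  show ?thesis
  proof (cases "\<exists>v D. bad v D")
    case False
    have "C \<subseteq> {y,z}"
    proof (rule ccontr)
      assume n: "\<not> ?thesis"
      show False
      proof (rule typeII_red[where C=C and zs=z])
        show "\<exists>a\<in>K. E a t \<or> E a s"
          if "c \<in> C" "K \<noteq> {}" "K \<subseteq> C" "c \<notin> K" "y \<notin> K" "clo E C K {c}" for c K
          using False that unfolding bad_def by blast
      qed (use CS n nb in auto)
    qed
    then show ?thesis by blast
  next
    case True
    then obtain v0 D0 where "bad v0 D0" by blast
    define P where "P D \<longleftrightarrow> (\<exists>v. bad v D)" for D
    have P0: "P D0" using \<open>bad v0 D0\<close> by (auto simp: P_def)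
    have "\<forall>D. P D \<longrightarrow> card D < card V + 1"
    proof (intro allI impI)
      fix D assume "P D"
      then have "D \<subseteq> V" using CS by (auto simp: P_def bad_def)
      then show "card D < card V + 1" using card_mono[OF fin] by (simp add: less_Suc_eq_le)
    qed
    then obtain D where D: "P D" and mx: "\<forall>D'. P D' \<longrightarrow> card D' \<le> card D"
      using ex_has_greatest_nat[of P D0 card "card V + 1"] P0 by blast
    obtain v where bv: "bad v D" using D by (auto simp: P_def)
    have h: "v \<in> C" "D \<noteq> {}" "D \<subseteq> C" "v \<notin> D" "y \<notin> D" "clo E C D {v}" "\<forall>a\<in>D. \<not> E a t \<and> \<not> E a s"
      using bv by (auto simp: bad_def)
    have zD: "z \<in> D" by (rule badz[OF bv])
    have fD: "finite D" by (rule fin_sub) (use h CS in auto)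
    have nD: "b \<notin> D" if "a \<in> C" "a \<notin> D" "a \<noteq> v" "E a b" for a b
      using cloD[OF h(6), of b a] sym that by blast
    have "C - D \<subseteq> {y,v}"
    proof (rule ccontr)
      assume n: "\<not> ?thesis"
      show False
      proof (rule typeII_red[where C="C - D" and zs=v])
        show "cset E (C - D) y" unfolding cset_def
        proof (intro conjI allI impI)
          show "y \<in> C - D" using CS h by auto
          fix L assume L: "L \<noteq> {}" "L \<subseteq> C - D - {y}"
          show "\<exists>a\<in>L. \<exists>b\<in>C - D - L. E a b"
          proof (cases "v \<in> L")
            case True
            obtain a b where ab: "a \<in> L \<union> D" "b \<in> C - (L \<union> D)" "E a b"
              using csetD[OF CS(3), of "L \<union> D"] L h by auto
            have "a \<notin> D" using cloD[OF h(6), of a b] ab True by auto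
            then show ?thesis using ab by blast
          next
            case False
            obtain a b where ab: "a \<in> L" "b \<in> C - L" "E a b"
              using csetD[OF CS(3), of L] L h by auto
            have "b \<notin> D" using nD[of a b] ab L False by blast
            then show ?thesis using ab by blast
          qed
        qed
        show "b \<in> C - D \<or> b \<in> {x,x1,t,s}" if "w \<in> C - D" "w \<noteq> v" "b \<in> V" "E w b" for w b
          using nb[of w b] nD[of w b] that by blast
        show "\<exists>a\<in>K. E a t \<or> E a s"
          if K: "c \<in> C - D" "K \<noteq> {}" "K \<subseteq> C - D" "c \<notin> K" "y \<notin> K" "clo E (C - D) K {c}" for c K
        proof (rule ccontr)
          assume nt: "\<not> ?thesis"
          show False
          \<comment> \<open>Either \<open>K\<close> is a bad part that misses \<open>z\<close>, or
            it contains \<open>v\<close> and \<open>K \<union> D\<close> is a larger bad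
            part.\<close>
          proof (cases "v \<in> K")
            case False
            have "clo E C K {c}"
            proof (rule cloI)
              fix a b assume ab: "a \<in> K" "b \<in> C" "E a b" "b \<notin> K"
              then have "b \<notin> D" using nD[of a b] K False by blast
              then show "b \<in> {c}" using cloD[OF K(6), of a b] ab by auto
            qed
            then have "bad c K" using K nt by (auto simp: bad_def)
            then show False using badz[of c K] zD K by blast
          next
            case True
            have "clo E C (K \<union> D) {c}"
            proof (rule cloI)
              fix a b assume ab: "a \<in> K \<union> D" "b \<in> C" "E a b" "b \<notin> K \<union> D"
              have "a \<notin> D" using cloD[OF h(6), of a b] ab True by auto
              then show "b \<in> {c}" using cloD[OF K(6), of a b] ab by auto
            qed
            then have "bad c (K \<union> D)" using K nt h by (auto simp: bad_def)
            then have "card (K \<union> D) \<le> card D" using mx by (auto simp: P_def)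
            moreover have "D \<subset> K \<union> D" using True h by auto
            moreover have "finite (K \<union> D)" by (rule fin_sub) (use K h CS in auto)
            ultimately show False using psubset_card_mono[of "K \<union> D" D] by linarith
          qed
        qed
      qed (use CS n h zD in auto)
    qed
    then show ?thesis using h zD by blast
  qed
qed

lemma hit_ts:
  assumes "C = compo E (V - {x,x1,t,s}) y"
  shows "\<exists>c\<in>C. E c t \<or> E c s"
proof -
  let ?S = "V - {x,x1,t,s}"
  have yS: "y \<in> ?S" using yV xy x1 ts_neq by auto
  have y: "y \<in> C" "t \<notin> C" using compo_self[OF yS, of E] compo_sub[of E ?S y] by (auto simp: assms)
  obtain c d where cd: "c \<in> C" "d \<notin> C" "d \<in> V - {x,x1}" "E c d"
    by (rule con_exit[OF sg con_sym[OF sg con_ty] y])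
  then have "d \<in> {t,s}" using compo_closed[OF sg, of c ?S y d] by (auto simp: assms)
  then show ?thesis using cd by blast
qed

lemma c4_swap:
  assumes "x1' \<in> V" "x1' \<noteq> x" "x1' \<noteq> y" "t' \<in> V" "s' \<in> V" "t' \<noteq> s'" "E y t'" "E y s'" "E x1' t'" "E x1' s'"
  shows "c4 E V y x z k x1' t' s'"
proof (intro c4.intro swap c4_axioms.intro)
qed (use assms ntx nty in blast)+

text \<open>For lack of triangles at \<open>y\<close>, its two neighbours other than
  \<open>z\<close> are \<open>t\<close> and \<open>s\<close>, so \<open>x1\<close>,
  \<open>t\<close>, \<open>s\<close> form a 4-cycle with either root. If the side of
  \<open>x\<close> is as small, induction runs between \<open>t\<close> and \<open>s\<close> without
  the roots; otherwise \<open>omega\<close> applies to the part \<open>W\<close> at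
  \<open>x\<close>, or \<open>z\<close> or \<open>v\<close> has too few neighbours.\<close>

lemma y_near:
  assumes Cd: "C = compo E (V - {x,x1,t,s}) y" and Cy: "C \<subseteq> {y,z}"
  shows False
proof -
  let ?S = "V - {x,x1,t,s}"
  have yS: "y \<in> ?S" using yV xy x1 ts_neq by auto
  have yC: "y \<in> C" using compo_self[OF yS, of E] by (simp add: Cd)
  have nb: "b \<in> {y,z,x,x1,t,s}" if "a \<in> C" "b \<in> V" "E a b" for a b
    using that compo_closed[OF sg, of a ?S y b] Cy by (auto simp: Cd)
  obtain a b where ab: "a \<noteq> b" "a \<in> V" "b \<in> V" "E y a" "E y b" "a \<noteq> z" "b \<noteq> z" using two_nbrs_y by blast
  have "a \<in> {x1,t,s}" "b \<in> {x1,t,s}" using nb[OF yC, of a] nb[OF yC, of b] ab nyx irr by auto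
  moreover have "\<not> E a b" "\<not> E b a" using nty ab by blast+
  ultimately have "{a,b} = {t,s}" using ab ts by auto
  then have yt: "E y t" "E y s" "t \<noteq> z" "s \<noteq> z" using ab by (auto simp: doubleton_eq_iff)
  have yx1: "\<not> E y x1" using nty[of t x1] yt ts x1 sym by blast
  have Ny: "b \<in> {t,s,z}" if "b \<in> V" "E y b" for b using nb[OF yC that] that nyx irr yx1 by auto
  interpret sw: c4 E V y x z k x1 t s by (rule c4_swap) (use x1 ts yt in auto)
  define D where "D = compo E (V - {y,x1,t,s}) x"
  let ?T = "V - {y,x1,t,s}"
  have xT: "x \<in> ?T" using xV xy x1 ts_neq by auto
  have xD: "x \<in> D" "cset E D x" "D \<subseteq> ?T" using compo_self[OF xT, of E] cset_compo[OF sg xT] compo_sub[of E ?T x] by (auto simp: D_def)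
  have nbD: "b \<in> D \<or> b \<in> {y,x1,t,s}" if "a \<in> D" "b \<in> V" "E a b" for a b
    using that compo_closed[OF sg, of a ?T x b] by (auto simp: D_def)
  have zC: "z \<in> C" if "z \<in> V" "E y z"
  proof -
    have "z \<in> ?S" using that yt nyx yx1 by auto
    then show ?thesis using compo_closed[OF sg, of y ?S y z] yC that by (auto simp: Cd)
  qed
  have nzt: "\<not> E z t \<and> \<not> E z s" if "z \<in> V" "E x z \<or> E y z"
    using that ntx[of z t] ntx[of z s] nty[of z t] nty[of z s] ts yt by blast
  consider "D \<subseteq> {x,z}" | v W where "v \<in> D" "W \<subseteq> D" "v \<notin> W" "x \<notin> W" "z \<in> W" "clo E D W {v}"
      "\<forall>a\<in>W. \<not> E a t \<and> \<not> E a s" "D - W \<subseteq> {x,v}"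
    using sw.y_side[OF D_def] by blast
  then show False
  proof cases
    case 1
    have Nx: "b \<in> {t,s,z}" if "b \<in> V" "E x b" for b using nbD[OF xD(1) that] 1 that nxy irr ts_neq by auto
    have main: False if h: "V' \<subseteq> V - {x,y}" "t \<in> V'" "s \<in> V'" "x1 \<in> V'"
      "\<And>a b. a \<in> V' \<Longrightarrow> a \<noteq> t \<Longrightarrow> a \<noteq> s \<Longrightarrow> a = x1 \<longrightarrow> z' \<noteq> x1 \<Longrightarrow> b \<in> V \<Longrightarrow> E a b \<Longrightarrow> b \<in> V'"
      "V - {x,y,z} \<subseteq> V'" "z \<in> V' \<Longrightarrow> z' = z" "z' = z \<or> z' = x1" for V' z'
    proof -
      have f: "fam k (pl E V' t s)"
      proof (rule IHsub[where z'=z'])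
        show "conn2 E V' t s"
        proof (rule conn2_cloI)
          fix K c assume K: "K \<noteq> {}" "K \<subseteq> V'" "t \<notin> K" "s \<notin> K" "clo E V' K {c}"
          have "x1 \<notin> K" using cloD[OF K(5), of x1 t] cloD[OF K(5), of x1 s] h ts K by auto
          have "clo E V K {c}"
          proof (rule cloI)
            fix a b assume ab: "a \<in> K" "b \<in> V" "E a b" "b \<notin> K"
            then have "b \<in> V'" using h(5)[of a b] K \<open>x1 \<notin> K\<close> by blast
            then show "b \<in> {c}" using cloD[OF K(5), of a b] ab by auto
          qed
          then show False using c2D[of K c] K h(1) by blast
        qed
        show "V' - {t,s,z'} \<noteq> {}"
        proof
          assume e: "V' - {t,s,z'} = {}"
          have "V \<subseteq> {x,y,z} \<union> {t,s,z'}" using e h(6) by blast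
          then have sub: "{b\<in>V. E t b} \<subseteq> {x,y,z,x1}" using h(8) ts_neq irr by blast
          have "k + 1 \<le> card {b\<in>V. E t b}" using deg[of t] ts ts_neq yt by auto
          also have "\<dots> \<le> card {x,y,z,x1}" by (rule card_mono[OF _ sub]) simp
          also have "\<dots> \<le> 4" by (simp add: card_insert_if)
          finally show False using k4 by simp
        qed
        show "w \<noteq> x \<and> w \<noteq> y \<and> w \<noteq> z \<and> (\<forall>b\<in>V. E w b \<longrightarrow> b \<in> V')"
          if "w \<in> V'" "w \<noteq> t" "w \<noteq> s" "w \<noteq> z'" for w
          using that h(1,7) h(5)[of w] by blast
      qed (use h(1-3) xV ts(1-3) in auto)
      have p1: "pl E {x,t} x t 1" using ts ts_neq by (intro pl_edge) auto
      have p2: "pl E {s,y} s y 1" using ts_neq yt sym by (intro pl_edge) auto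
      show False
      proof (rule no_shift[OF f, of 2])
        fix n assume p: "pl E V' t s n"
        show "pl E V x y (n + 2)" by (rule pl_sandwich[OF p1 p p2]) (use h(1-3) xV yV ts(1-3) ts_neq(1-6) xy in auto)
      qed
    qed
    show False
    proof (cases "z \<in> V \<and> (E x z \<or> E y z)")
      case True
      then have zz: "z \<noteq> x" "z \<noteq> y" "z \<noteq> x1" using irr nxy nyx yx1 ts_neq by auto
      have Nz: "b \<in> {x,y,x1}" if "b \<in> V" "E z b" for b
      proof (cases "E x z")
        case xz: True
        have "z \<in> D" using nbD[OF xD(1), of z] True xz zz yt by auto
        then show ?thesis using nbD[of z b] that 1 irr nzt True by auto
      next
        case False
        then have "z \<in> C" using zC True by blast
        then show ?thesis using nb[of z b] that irr nzt True by auto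
      qed
      show False
      proof (rule main[of "V - {x,y,z}" x1])
        fix a b assume "a \<in> V - {x,y,z}" "a \<noteq> t" "a \<noteq> s" "a = x1 \<longrightarrow> x1 \<noteq> x1" "b \<in> V" "E a b"
        then show "b \<in> V - {x,y,z}" using Nx[of a] Ny[of a] Nz[of a] sym by auto
      qed (use ts ts_neq x1 yt zz in auto)
    next
      case False
      show False
      proof (rule main[of "V - {x,y}" z])
        fix a b assume "a \<in> V - {x,y}" "a \<noteq> t" "a \<noteq> s" "b \<in> V" "E a b"
        then show "b \<in> V - {x,y}" using Nx[of a] Ny[of a] False sym by auto
      qed (use ts ts_neq x1 in auto)
    qed
  next
    case h: 2
    have zV: "z \<in> V" "z \<noteq> x" "z \<noteq> y" "z \<noteq> x1" using h xD by auto
    show False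
    proof (cases "v = x")
      case True
      have "clo E V W {y,x1,x}"
      proof (rule cloI)
        fix a b assume ab: "a \<in> W" "b \<in> V" "E a b" "b \<notin> W"
        then have "b \<in> D \<or> b \<in> {y,x1}" using nbD[of a b] h by blast
        then show "b \<in> {y,x1,x}" using cloD[OF h(6), of a b] ab True by auto
      qed
      then show False using sw.omega[of W] h xD ts by blast
    next
      case vx: False
      have zx: "\<not> E z x" using cloD[OF h(6), of z x] h xD vx by auto
      show False
      proof (cases "E y z")
        case True
        have "b = y \<or> b = x1" if "b \<in> V" "E z b" for b
          using nb[OF zC[OF zV(1) True] that] that irr zx nzt[OF zV(1)] True by auto
        then show False using sw.degz zV by blast
      next
        case False
        have yN: "b \<in> {t,s}" if "b \<in> V" "E y b" for b using Ny[OF that] False that by auto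
        have WV: "W \<subseteq> V" "y \<notin> W" "t \<notin> W" "s \<notin> W" using h xD by auto
        have "clo E V W {x1,v}"
        proof (rule cloI)
          fix a b assume ab: "a \<in> W" "b \<in> V" "E a b" "b \<notin> W"
          have "b \<noteq> y" using yN[of a] sym ab WV by blast
          then have "b \<in> D \<or> b = x1" using nbD[of a b] h ab by blast
          then show "b \<in> {x1,v}" using cloD[OF h(6), of a b] ab by auto
        qed
        then have Wz: "W = {z}" using star2'[of W x1 v] h WV x1 by blast
        obtain a b where ab: "a \<in> D - {x}" "b \<in> D - (D - {x})" "E a b"
          using csetD[OF xD(2), of "D - {x}"] h(1) vx by blast
        then have vxE: "E v x" using h(8) Wz zx by auto
        have vV: "v \<in> V" "v \<noteq> y" "v \<noteq> z" "v \<notin> {t,s,x1}" using h xD Wz by auto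
        have sub: "{b\<in>V. E v b} \<subseteq> {x,z,x1}"
        proof
          fix b assume "b \<in> {b\<in>V. E v b}"
          then have b: "b \<in> V" "E v b" by auto
          have "b \<noteq> t" "b \<noteq> s" using ntx[of v t] ntx[of v s] ts vV vxE sym b by blast+
          moreover have "b \<noteq> y" using yN[of v] vV b sym by blast
          ultimately show "b \<in> {x,z,x1}" using nbD[OF h(1) b] h(8) Wz irr b by auto
        qed
        have "k + 1 \<le> card {b\<in>V. E v b}" using deg[of v] vV vx by auto
        also have "\<dots> \<le> card {x,z,x1}" by (rule card_mono[OF _ sub]) simp
        also have "\<dots> \<le> 3" by (simp add: card_insert_if)
        finally show False using k4 by simp
      qed
    qed
  qed
qed

text \<open>If \<open>v = y\<close>, \<open>omega\<close> removes \<open>D\<close>. Otherwise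
  \<open>y\<close> has only two neighbours, \<open>v\<close> and one vertex \<open>s'\<close> of
  \<open>x1\<close>, \<open>t\<close>, \<open>s\<close>, and they lie on a 4-cycle at
  \<open>y\<close>. Seen from that 4-cycle, the component of \<open>x\<close> contains
  \<open>t\<close> or \<open>s\<close>; its exceptional part shrinks to \<open>z\<close>, which
  leaves that vertex at most four neighbours, against k >= 4.\<close>

lemma y_far:
  assumes Cd: "C = compo E (V - {x,x1,t,s}) y"
    and h: "v \<in> C" "D \<subseteq> C" "v \<notin> D" "y \<notin> D" "z \<in> D" "clo E C D {v}"
      "\<forall>a\<in>D. \<not> E a t \<and> \<not> E a s" "C - D \<subseteq> {y,v}"
    and yc4: "\<exists>w p q. w \<in> V \<and> w \<noteq> x \<and> w \<noteq> y \<and> p \<in> V \<and> q \<in> V \<and> p \<noteq> q \<and> E y p \<and> E y q \<and> E w p \<and> E w q"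
  shows False
proof -
  let ?S = "V - {x,x1,t,s}"
  have yS: "y \<in> ?S" using yV xy x1 ts_neq by auto
  have CS: "C \<subseteq> ?S" "y \<in> C" "cset E C y"
    using compo_sub[of E ?S y] compo_self[OF yS, of E] cset_compo[OF sg yS] by (auto simp: Cd)
  have nb: "b \<in> C \<or> b \<in> {x,x1,t,s}" if "a \<in> C" "b \<in> V" "E a b" for a b
    using that compo_closed[OF sg, of a ?S y b] by (auto simp: Cd)
  have clD: "clo E V D {x,x1,v}"
  proof (rule cloI)
    fix a b assume ab: "a \<in> D" "b \<in> V" "E a b" "b \<notin> D"
    then have "b \<in> C \<or> b \<in> {x,x1}" using nb[of a b] h by blast
    then show "b \<in> {x,x1,v}" using cloD[OF h(6), of a b] ab by auto
  qed
  have DV: "D \<subseteq> V" "x \<notin> D" "x1 \<notin> D" "t \<notin> D" "s \<notin> D" using h CS by auto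
  show False
  proof (cases "v = y")
    case True
    have "E y t \<or> E y s" using hit_ts[OF Cd] h True by blast
    then show False using omega[of D] DV h clD True by blast
  next
    case vy: False
    have vV: "v \<in> V" "v \<noteq> x" "v \<notin> {x1,t,s}" using h CS by auto
    have vz: "v \<noteq> z" using h by auto
    have yD: "\<not> E a y" if "a \<in> D" for a using cloD[OF h(6) that CS(2)] h vy by auto
    have Ny: "b \<in> {x1,t,s,v}" if "b \<in> V" "E y b" for b
      using nb[OF CS(2) that] that h(8) yD[of b] sym irr nyx by blast
    \<comment> \<open>If \<open>v\<close> missed both \<open>t\<close> and \<open>s\<close>, it
      could be added to \<open>D\<close>, and \<open>omega\<close> would apply.\<close>
    have nov: False if o: "E y t \<or> E y s" "\<not> E v t" "\<not> E v s"
    proof (rule omega[of "insert v D"])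
      show "clo E V (insert v D) {x,x1,y}"
      proof (rule cloI)
        fix a b assume ab: "a \<in> insert v D" "b \<in> V" "E a b" "b \<notin> insert v D"
        show "b \<in> {x,x1,y}"
        proof (cases "a = v")
          case True
          then have "b \<in> C \<or> b \<in> {x,x1}" using nb[of v b] ab h(1) o by blast
          then show ?thesis using h(8) ab by blast
        next
          case False then show ?thesis using cloD[OF clD, of a b] ab by auto
        qed
      qed
    qed (use DV h vV vy o in auto)
    obtain y1 p q where y1: "y1 \<in> V" "y1 \<noteq> x" "y1 \<noteq> y" and pq: "p \<in> V" "q \<in> V" "p \<noteq> q" "E y p" "E y q" "E y1 p" "E y1 q"
      using yc4 by blast
    have evt: "\<not> E v t" if "E y t" "E y v" using nty[of v t] that vV ts by blast
    have evs: "\<not> E v s" if "E y s" "E y v" using nty[of v s] that vV ts by blast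
    obtain a b where ab: "a \<in> C - {y}" "b \<in> C - (C - {y})" "E a b"
      using csetD[OF CS(3), of "C - {y}"] h(1) vy by blast
    then have yv: "E y v" using h(8) yD[of a] sym by auto
    have x1t: "\<not> (E y x1 \<and> (E y t \<or> E y s))" using nty[of x1 t] nty[of x1 s] ts x1 by blast
    have tns: "\<not> (E y t \<and> E y s)" using nov evt evs yv by blast
    obtain s' where s': "{p,q} = {s',v}" "s' \<in> {x1,t,s}"
      using Ny[OF pq(1,4)] Ny[OF pq(2,5)] pq x1t tns
      by (metis doubleton_eq_iff empty_iff insert_iff)
    have s1: "E y s'" "E y1 s'" "E y1 v" "s' \<in> V" "s' \<noteq> v" using s' pq vV x1 ts by (auto simp: doubleton_eq_iff)
    have Ny2: "b \<in> {s',v}" if "b \<in> V" "E y b" for b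
      using Ny[OF that] that s1(1) s'(2) x1t tns by auto
    interpret sw: c4 E V y x z k y1 s' v by (rule c4_swap) (use y1 s1 vV yv in auto)
    define F where "F = compo E (V - {y,y1,s',v}) x"
    let ?T = "V - {y,y1,s',v}"
    have xT: "x \<in> ?T" using xV xy y1 vV s'(2) ts_neq x1 by auto
    have xF: "x \<in> F" "F \<subseteq> ?T" using compo_self[OF xT, of E] compo_sub[of E ?T x] by (auto simp: F_def)
    have nbF: "b \<in> F \<or> b \<in> {y,y1,s',v}" if "a \<in> F" "b \<in> V" "E a b" for a b
      using that compo_closed[OF sg, of a ?T x b] by (auto simp: F_def)
    have tsF: "a \<in> F" if "a \<in> {t,s}" "a \<noteq> s'" "a \<noteq> y1" for a
      using nbF[OF xF(1), of a] that ts ts_neq vV by auto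
    have tz: "t \<noteq> z" "s \<noteq> z" using DV h by auto
    have y1ts: "y1 \<notin> {t,s}" if "s' \<in> {t,s}"
      using that s1(2) ts_neq irr by auto
    obtain a where a: "a \<in> {t,s}" "a \<noteq> s'" "a \<noteq> y1"
    proof (cases "s' \<in> {t,s}")
      case True
      then show ?thesis using that[of t] that[of s] y1ts ts(3) by blast
    next
      case False
      then show ?thesis using that[of t] that[of s] ts(3) by blast
    qed
    have aF: "a \<in> F" by (rule tsF[OF a])
    have aq: "a \<in> V" "a \<noteq> x" "a \<noteq> y" "a \<noteq> z" using a ts ts_neq tz by auto
    consider "F \<subseteq> {x,z}" | v' W where "v' \<in> F" "W \<subseteq> F" "v' \<notin> W" "x \<notin> W" "z \<in> W" "clo E F W {v'}"
        "\<forall>a\<in>W. \<not> E a s' \<and> \<not> E a v" "F - W \<subseteq> {x,v'}"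
      using sw.y_side[OF F_def] by blast
    then show False
    proof cases
      case 1 then show False using aF aq by auto
    next
      case g: 2
      have WV: "W \<subseteq> V" "y \<notin> W" "s' \<notin> W" "v \<notin> W" using g xF by auto
      have "clo E V W {y1,v'}"
      proof (rule cloI)
        fix c d assume cd: "c \<in> W" "d \<in> V" "E c d" "d \<notin> W"
        have "d \<noteq> y" using Ny2[of c] sym cd WV by blast
        then have "d \<in> F \<or> d = y1" using nbF[of c d] g cd by blast
        then show "d \<in> {y1,v'}" using cloD[OF g(6), of c d] cd by auto
      qed
      then have Wz: "W = {z}" using star2'[of W y1 v'] g WV y1 by blast
      have av: "b = v'" if "b \<in> {t,s}" "b \<in> F" for b using g(8) that Wz tz ts_neq by auto
      have aN: "b \<in> {x,z,y1,s',v}" if "b \<in> V" "E a b" for b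
      proof -
        have "b \<noteq> y" using Ny2[of a] aq sym that a vV by auto
        then show ?thesis using nbF[OF aF that] g(8) Wz av[OF a(1) aF] irr that by auto
      qed
      have "\<exists>B. {b\<in>V. E a b} \<subseteq> B \<and> finite B \<and> card B \<le> 4"
      \<comment> \<open>One of the five possible neighbours drops out: \<open>s'\<close> or
        \<open>y1\<close> is the other one of \<open>t\<close>, \<open>s\<close>, which is not
        adjacent to \<open>a\<close>.\<close>
      proof (cases "s' \<in> {t,s}")
        case True
        then have "\<not> E a s'" using a ts_neq irr by auto
        then have "{b\<in>V. E a b} \<subseteq> {x,z,y1,v}" using aN by blast
        then show ?thesis by (intro exI[of _ "{x,z,y1,v}"]) (auto simp: card_insert_if)
      next
        case False
        have "y1 \<in> {t,s}"
        proof (rule ccontr)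
          assume "y1 \<notin> {t,s}"
          then have "t = v'" "s = v'" using tsF[of t] tsF[of s] av False by auto
          then show False using ts(3) by simp
        qed
        then have "\<not> E a y1" using a ts_neq irr by auto
        then have "{b\<in>V. E a b} \<subseteq> {x,z,s',v}" using aN by blast
        then show ?thesis by (intro exI[of _ "{x,z,s',v}"]) (auto simp: card_insert_if)
      qed
      then obtain B where B: "{b\<in>V. E a b} \<subseteq> B" "finite B" "card B \<le> 4" by blast
      have "k + 1 \<le> card {b\<in>V. E a b}" using deg[of a] aq by auto
      also have "\<dots> \<le> card B" by (rule card_mono[OF B(2,1)])
      finally show False using k4 B by simp
    qed
  qed
qed

lemma c4_False:
  assumes "\<exists>w p q. w \<in> V \<and> w \<noteq> x \<and> w \<noteq> y \<and> p \<in> V \<and> q \<in> V \<and> p \<noteq> q \<and> E y p \<and> E y q \<and> E w p \<and> E w q"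
  shows False
  using y_side[OF refl] y_near[OF refl] y_far[OF refl _ _ _ _ _ _ _ _ assms] by blast

end

lemma (in mincex) no_mincex: False
proof -
  have ntx: "\<not> E u v" if "u \<in> V" "v \<in> V" "E x u" "E x v" for u v using typeI that by blast
  have nty: "\<not> E u v" if "u \<in> V" "v \<in> V" "E y u" "E y v" for u v using mincex.typeI[OF swap] that by blast
  have 1: "\<exists>w p q. w \<in> V \<and> w \<noteq> x \<and> w \<noteq> y \<and> p \<in> V \<and> q \<in> V \<and> p \<noteq> q \<and> E x p \<and> E x q \<and> E w p \<and> E w q"
    using typeIII[OF ntx] by blast
  have 2: "\<exists>w p q. w \<in> V \<and> w \<noteq> x \<and> w \<noteq> y \<and> p \<in> V \<and> q \<in> V \<and> p \<noteq> q \<and> E y p \<and> E y q \<and> E w p \<and> E w q"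
    using mincex.typeIII[OF swap nty] by blast
  obtain w p q where w: "w \<in> V" "w \<noteq> x" "w \<noteq> y" "p \<in> V" "q \<in> V" "p \<noteq> q" "E x p" "E x q" "E w p" "E w q"
    using 1 by blast
  have "c4 E V x y z k w p q"
    by (intro c4.intro mincex_axioms c4_axioms.intro) (use w ntx nty in blast)+
  then show False using c4.c4_False[OF _ 2] by blast
qed

theorem rooted_fam:
  assumes "rooted E V x y z k" shows "fam k (pl E V x y)"
  using assms
proof (induction "card V" arbitrary: E V x y z k rule: less_induct)
  case less
  define E' where "E' a b \<longleftrightarrow> E a b \<and> {a,b} \<noteq> {x,y}" for a b
  have r: "sgr E" "finite V" "x \<in> V" "y \<in> V" "x \<noteq> y" "conn2 E V x y" "V - {x,y,z} \<noteq> {}" "1 \<le> k"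
    "2 \<le> k \<Longrightarrow> v \<in> V - {x,y,z} \<Longrightarrow> k + 1 \<le> card {u\<in>V. E v u}" for v
    using less.prems by (auto simp: rooted_def)
  have eq: "E' a b \<longleftrightarrow> E a b" if "a \<noteq> x" "a \<noteq> y" for a b using that by (auto simp: E'_def doubleton_eq_iff)
  have "sgr E'" using r(1) by (auto simp: sgr_def E'_def insert_commute)
  moreover have "conn2 E' V x y"
  proof (rule conn2_cloI)
    fix K c assume K: "K \<noteq> {}" "K \<subseteq> V" "x \<notin> K" "y \<notin> K" "clo E' V K {c}"
    have "clo E V K {c}"
    proof (rule cloI)
      fix a b assume ab: "a \<in> K" "b \<in> V" "E a b" "b \<notin> K"
      then have "E' a b" using eq[of a b] K by auto
      then show "b \<in> {c}" using cloD[OF K(5), of a b] ab by auto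
    qed
    then show False using conn2_cloD[OF r(6) K(1-4)] by blast
  qed
  moreover have "k + 1 \<le> card {u\<in>V. E' v u}" if "2 \<le> k" "v \<in> V - {x,y,z}" for v
  proof -
    have "{u\<in>V. E' v u} = {u\<in>V. E v u}" using eq[of v] that by auto
    then show ?thesis using r(9)[OF that] by simp
  qed
  ultimately have rt: "rooted E' V x y z k" using r by (auto simp: rooted_def)
  have "fam k (pl E' V x y)"
  proof (rule ccontr)
    assume ng: "\<not> ?thesis"
    have "mincex E' V x y z k"
    proof
      show "\<not> E' x y" by (simp add: E'_def)
    qed (use rt ng less.hyps in blast)+
    then show False by (rule mincex.no_mincex)
  qed
  moreover have "pl E V x y n" if pl': "pl E' V x y n" for n
  proof -
    obtain p where p: "pth E' V x p y" "length p = Suc n" using pl' by (auto simp: pl_def)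
    have "successively E p" by (rule successively_mono[of E' p]) (use p in \<open>auto simp: pth_def E'_def\<close>)
    then show ?thesis using p unfolding pl_def pth_def by blast
  qed
  ultimately show ?case by (rule fam_mono)
qed

section \<open>Cycles and parity\<close>

lemma pl_lastE:
  assumes "pl E T b a r" "b \<noteq> a"
  obtains w r' where "r = Suc r'" "pl E (T - {a}) b w r'" "E w a"
proof -
  obtain p where p: "pth E T b p a" "length p = Suc r" using assms(1) by (auto simp: pl_def)
  define q where "q = butlast p"
  have pq: "p = q @ [a]" using p append_butlast_last_id[of p] by (auto simp: q_def pth_def)
  have qn: "q \<noteq> []" using p assms(2) by (auto simp: pth_def pq)
  have "successively E (q @ [a])" using p by (simp add: pth_def pq)
  then have s: "successively E q" "E (last q) a" using qn by (auto simp: successively_append_iff)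
  have "pth E (T - {a}) b q (last q)" using p qn s by (auto simp: pth_def pq)
  moreover have "length q = Suc (length q - 1)" using qn by (cases q) auto
  ultimately have "pl E (T - {a}) b (last q) (length q - 1)" unfolding pl_def by blast
  moreover have "r = Suc (length q - 1)" using p(2) qn by (cases q) (auto simp: pq)
  ultimately show ?thesis using that s by blast
qed

definition cy :: "('a \<Rightarrow> 'a \<Rightarrow> bool) \<Rightarrow> 'a set \<Rightarrow> nat \<Rightarrow> bool" where
  "cy E S n \<longleftrightarrow> 3 \<le> n \<and> (\<exists>x y. pl E S x y (n - 1) \<and> E y x)"

lemma cy_mono: "cy E S n \<Longrightarrow> S \<subseteq> T \<Longrightarrow> cy E T n"
  unfolding cy_def using pl_mono by metis

lemma cyI:
  assumes "sgr E" "pl E S a b n" "pl E T a b r" "S \<inter> T \<subseteq> {a,b}" "a \<noteq> b" "3 \<le> n + r" "S \<union> T \<subseteq> U" "m = n + r"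
  shows "cy E U m"
proof -
  obtain w r' where w: "r = Suc r'" "pl E (T - {a}) b w r'" "E w a"
    using pl_lastE[OF pl_sym[OF assms(1,3)]] assms(5) by metis
  have "pl E U a w (n + r')" by (rule pl_append'[OF assms(2) w(2)]) (use assms in auto)
  then show ?thesis using w assms(6,8) unfolding cy_def by (metis One_nat_def add_Suc_right diff_Suc_1)
qed

text \<open>A cycle as a periodic sequence: arcs are images of intervals that may run past
  \<open>g\<close>, and rotations are index shifts, so a result about \<open>f 0\<close> transfers
  to every vertex of the cycle.\<close>

definition cycf :: "('a \<Rightarrow> 'a \<Rightarrow> bool) \<Rightarrow> (nat \<Rightarrow> 'a) \<Rightarrow> nat \<Rightarrow> bool" where
  "cycf E f g \<longleftrightarrow> 3 \<le> g \<and> (\<forall>i. f (i + g) = f i) \<and> inj_on f {..<g} \<and> (\<forall>i. E (f i) (f (Suc i)))"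

lemma cycf_mod: "cycf E f g \<Longrightarrow> f (i mod g) = f i"
proof -
  assume c: "cycf E f g"
  have "f (i + g * q) = f i" for i q
  proof (induction q)
    case (Suc q)
    have "f (i + g * Suc q) = f ((i + g * q) + g)" by (simp add: algebra_simps)
    also have "\<dots> = f i" using c Suc by (simp add: cycf_def)
    finally show ?case .
  qed simp
  from this[of "i mod g" "i div g"] show ?thesis by simp
qed

lemma cycf_eq: assumes "cycf E f g" shows "f i = f j \<longleftrightarrow> i mod g = j mod g"
proof
  assume "f i = f j"
  then have "f (i mod g) = f (j mod g)" using cycf_mod[OF assms] by simp
  moreover have "i mod g < g" "j mod g < g" "inj_on f {..<g}" using assms by (auto simp: cycf_def)
  ultimately show "i mod g = j mod g" by (auto dest: inj_onD)
qed (metis cycf_mod[OF assms])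

lemma cycf_inj: assumes "cycf E f g" shows "inj_on f {i..<i + g}"
proof (rule inj_onI)
  have aux: "a = b" if "f a = f b" "i \<le> a" "a \<le> b" "b < i + g" for a b
  proof -
    have "a mod g = b mod g" using cycf_eq[OF assms] that(1) by simp
    then have "g dvd b - a" using that(3) mod_eq_dvd_iff_nat by metis
    moreover have "b - a < g" using that by auto
    ultimately have "b - a = 0" by (meson dvd_imp_le linorder_not_less neq0_conv)
    then show ?thesis using that by simp
  qed
  fix a b assume "a \<in> {i..<i+g}" "b \<in> {i..<i+g}" "f a = f b"
  then show "a = b" using aux[of a b] aux[of b a] by (cases "a \<le> b") auto
qed

lemma cycf_range: assumes "cycf E f g" shows "range f = f ` {i..<i + g}"
proof -
  have "f j \<in> f ` {i..<i + g}" for j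
  proof -
    have g: "0 < g" using assms by (auto simp: cycf_def)
    \<comment> \<open>Adding the multiple g i of the period does not change the vertex and makes the
      subtraction of \<open>i\<close> exact.\<close>
    define j' where "j' = i + (j + g * i - i) mod g"
    have gi: "i \<le> g * i" using g by (cases g) auto
    have "j' mod g = (i + (j + g * i - i)) mod g" unfolding j'_def by (simp add: mod_add_right_eq)
    also have "i + (j + g * i - i) = j + g * i" using gi by linarith
    also have "(j + g * i) mod g = j mod g" by simp
    finally have "f j' = f j" using cycf_eq[OF assms] by simp
    moreover have "j' \<in> {i..<i + g}" using g by (auto simp: j'_def)
    ultimately show ?thesis by (metis imageI)
  qed
  then show ?thesis by auto
qed

lemma cycf_card: assumes "cycf E f g" shows "card (range f) = g" "finite (range f)"
  using cycf_range[OF assms, of 0] card_image[OF cycf_inj[OF assms, of 0]] by simp_all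

lemma cycf_shift: "cycf E f g \<Longrightarrow> cycf E (\<lambda>i. f (i + r)) g"
proof -
  assume c: "cycf E f g"
  have "inj_on (\<lambda>i. f (i + r)) {..<g}"
  proof (rule inj_onI)
    fix a b assume ab: "a \<in> {..<g}" "b \<in> {..<g}" "f (a + r) = f (b + r)"
    have "a + r = b + r" by (rule inj_onD[OF cycf_inj[OF c, of r] ab(3)]) (use ab in auto)
    then show "a = b" by simp
  qed
  moreover have "f (i + g + r) = f (i + r)" for i using c by (metis cycf_def add.assoc add.commute)
  ultimately show ?thesis using c by (auto simp: cycf_def)
qed

lemma cycf_shift_range: assumes "cycf E f g" shows "range (\<lambda>i. f (i + r)) = range f"
proof -
  have "(\<lambda>i. f (i + r)) ` {0..<0+g} = f ` {r..<r+g}"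
    using image_add_atLeastLessThan'[of r 0 g] by (metis add.commute add_0 image_image)
  then show ?thesis using cycf_range[OF assms, of r] cycf_range[OF cycf_shift[OF assms, of r], of 0] by simp
qed

lemma cycf_arc:
  assumes "cycf E f g" "i \<le> j" "j < i + g"
  shows "pl E (f ` {i..j}) (f i) (f j) (j - i)"
proof -
  let ?p = "map f [i..<Suc j]"
  have "inj_on f {i..<Suc j}" by (rule inj_on_subset[OF cycf_inj[OF assms(1), of i]]) (use assms(3) in auto)
  then have d: "distinct ?p" by (simp add: distinct_map del: upt_Suc)
  have s: "successively E (map f [i..<i + n])" for n
  proof (induction n)
    case (Suc n)
    show ?case
    proof (cases n)
      case (Suc n')
      have "map f [i..<i + Suc n] = map f [i..<i + n] @ [f (i + n)]" by simp
      moreover have "last (map f [i..<i + n]) = f (i + n')" using Suc by simp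
      moreover have "E (f (i + n')) (f (i + n))" using assms(1) Suc unfolding cycf_def by simp
      ultimately show ?thesis using Suc.IH by (simp only: successively_append_iff) simp
    qed simp
  qed simp
  have hd: "hd ?p = f i" using assms(2) by (simp add: upt_conv_Cons del: upt_Suc)
  have la: "last ?p = f j" using assms(2) by simp
  have su: "successively E ?p" using s[of "Suc j - i"] assms(2) by (simp del: upt_Suc)
  have ss: "set ?p \<subseteq> f ` {i..j}" by (simp del: upt_Suc) auto
  have "?p \<noteq> []" using assms(2) by simp
  then have "pth E (f ` {i..j}) (f i) ?p (f j)" unfolding pth_def using d su ss hd la by blast
  moreover have "length ?p = Suc (j - i)" using assms(2) by simp
  ultimately show ?thesis unfolding pl_def by blast
qed

text \<open>The complementary arc; it ends at the index \<open>i + g\<close>, which stands for the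
  same vertex as \<open>i\<close>.\<close>

lemma cycf_arc2:
  assumes "sgr E" "cycf E f g" "i < j" "j < i + g"
  shows "pl E (f ` {j..i + g}) (f i) (f j) (i + g - j)"
proof -
  have "pl E (f ` {j..i + g}) (f j) (f (i + g)) (i + g - j)" by (rule cycf_arc[OF assms(2)]) (use assms in auto)
  moreover have "f (i + g) = f i" using assms(2) by (simp add: cycf_def)
  ultimately show ?thesis using pl_sym[OF assms(1)] by metis
qed

lemma cycf_cy: assumes "cycf E f g" shows "cy E (range f) g"
proof -
  have g: "3 \<le> g" using assms by (simp add: cycf_def)
  have "pl E (f ` {0..g-1}) (f 0) (f (g-1)) (g - 1)" using cycf_arc[OF assms, of 0 "g-1"] g by simp
  then have "pl E (range f) (f 0) (f (g-1)) (g - 1)" by (rule pl_mono) auto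
  moreover have "E (f (g-1)) (f 0)"
  proof -
    have "E (f (g-1)) (f (Suc (g-1)))" "f (0 + g) = f 0" using assms unfolding cycf_def by blast+
    then show ?thesis using g by simp
  qed
  ultimately show ?thesis using g unfolding cy_def by blast
qed

lemma cy_cycf: assumes "cy E S n" obtains f where "cycf E f n" "range f \<subseteq> S"
proof -
  obtain x y where n: "3 \<le> n" and xy: "pl E S x y (n - 1)" "E y x" using assms by (auto simp: cy_def)
  obtain p where p: "pth E S x p y" "length p = n" using xy(1) n by (auto simp: pl_def)
  define f where "f i = p ! (i mod n)" for i
  have st: "E (f i) (f (Suc i))" for i
  proof (cases "Suc (i mod n) = n")
    case True
    then have "Suc i mod n = 0" by (metis mod_Suc)
    moreover have "p ! 0 = x" using p n by (auto simp: pth_def hd_conv_nth)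
    moreover have "p ! (i mod n) = y"
    proof -
      have "i mod n = length p - 1" using True p(2) by simp
      then show ?thesis using p n by (auto simp: pth_def last_conv_nth)
    qed
    ultimately show ?thesis using xy by (simp add: f_def)
  next
    case False
    then have "Suc i mod n = Suc (i mod n)" by (metis mod_Suc)
    moreover have "Suc (i mod n) < n" using False n by (metis Suc_lessI mod_less_divisor less_le_trans zero_less_numeral)
    ultimately show ?thesis using p by (auto simp: f_def pth_def successively_conv_nth)
  qed
  have "cycf E f n" unfolding cycf_def
  proof (intro conjI allI n st)
    show "inj_on f {..<n}" using p by (auto simp: f_def inj_on_def pth_def nth_eq_iff_index_eq)
  qed (simp add: f_def)
  moreover have "range f \<subseteq> S"
  proof
    fix v assume "v \<in> range f"
    then obtain i where "v = p ! (i mod n)" by (auto simp: f_def)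
    moreover have "i mod n < length p" using n p by simp
    ultimately show "v \<in> S" using p by (auto simp: pth_def)
  qed
  ultimately show ?thesis using that by blast
qed

text \<open>The lengths of the two arcs have the odd sum \<open>g\<close>, so there is one of each
  parity.\<close>

lemma odd_arcs:
  assumes "sgr E" "cycf E f g" "odd g" "a \<in> range f" "b \<in> range f" "a \<noteq> b"
  shows "\<exists>n. pl E (range f) a b n \<and> even n = par"
proof -
  have main: "\<exists>n. pl E (range f) (f i) (f j) n \<and> even n = par" if ij: "i < j" "j < i + g" for i j
  proof (cases "even (j - i) = par")
    case True
    have "pl E (range f) (f i) (f j) (j - i)"
      by (rule pl_mono[OF cycf_arc[OF assms(2)]]) (use ij in auto)
    then show ?thesis using True by blast
  next
    case False
    have "pl E (range f) (f i) (f j) (i + g - j)" by (rule pl_mono[OF cycf_arc2[OF assms(1,2) ij]]) auto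
    moreover have "even (i + g - j) = par"
    proof -
      have "(i + g - j) + (j - i) = g" using ij by simp
      then have "odd ((i + g - j) + (j - i))" using assms(3) by simp
      then show ?thesis using False by auto
    qed
    ultimately show ?thesis by blast
  qed
  obtain i where i: "i < g" "a = f i" using assms(4) cycf_range[OF assms(2), of 0] by auto
  obtain j where j: "j < g" "b = f j" using assms(5) cycf_range[OF assms(2), of 0] by auto
  have "i \<noteq> j" using assms(6) i j by auto
  then consider "i < j" | "j < i" by linarith
  then show ?thesis
  proof cases
    case 1 then show ?thesis using main[of i j] i j by auto
  next
    case 2
    then obtain n where "pl E (range f) b a n" "even n = par" using main[of j i] i j by auto
    then show ?thesis using pl_sym[OF assms(1)] by blast
  qed
qed

text \<open>Menger's theorem gives disjoint connections from \<open>x\<close> and \<open>y\<close>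
  to the odd cycle; cut at their first hits, they are joined by the arc of the required
  parity.\<close>

lemma oddlink:
  assumes "sgr E" "finite S" "x \<in> S" "y \<in> S" "cycf E f g" "odd g" "range f \<subseteq> S"
    and sep: "\<And>s. \<exists>a\<in>{x,y}. \<exists>b\<in>range f. con E (S - {s}) a b"
  shows "\<exists>n. pl E S x y n \<and> even n = par"
proof -
  have sub: "{x,y} \<subseteq> S" using assms by auto
  obtain S1 S2 a1 b1 a2 b2 where m: "a1 \<in> {x,y}" "a2 \<in> {x,y}" "b1 \<in> range f" "b2 \<in> range f" "S1 \<inter> S2 = {}"
    "S1 \<subseteq> S" "S2 \<subseteq> S" "con E S1 a1 b1" "con E S2 a2 b2" "a1 \<noteq> a2" "b1 \<noteq> b2"
    by (rule menger2[OF assms(1,2) sub assms(7) sep])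
  have main: "\<exists>n. pl E S a1 a2 n \<and> even n = par"
  proof -
    obtain c1 where c1: "c1 \<in> range f" "con E (S1 - (range f - {c1})) a1 c1" by (rule first_hit[OF m(8,3)])
    obtain c2 where c2: "c2 \<in> range f" "con E (S2 - (range f - {c2})) a2 c2" by (rule first_hit[OF m(9,4)])
    obtain r1 where r1: "pl E (S1 - (range f - {c1})) a1 c1 r1" using c1 by (auto simp: con_pl)
    obtain r2 where r2: "pl E (S2 - (range f - {c2})) c2 a2 r2" using con_sym[OF assms(1) c2(2)] by (auto simp: con_pl)
    have "c1 \<in> S1" "c2 \<in> S2" using con_in(2)[OF c1(2)] con_in(2)[OF c2(2)] by auto
    then have "c1 \<noteq> c2" using m(5) by auto
    then obtain n where n: "pl E (range f) c1 c2 n" "even n = (even (r1 + r2) = par)"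
      using odd_arcs[OF assms(1,5,6) c1(1) c2(1)] by blast
    have "pl E S a1 a2 (r1 + n + r2)"
      by (rule pl_sandwich[OF r1 n(1) r2]) (use m assms in auto)
    moreover have "even (r1 + n + r2) = par" using n(2) by auto
    ultimately show ?thesis by blast
  qed
  show ?thesis
  proof (cases "a1 = x")
    case True
    then have "a2 = y" using m by auto
    then show ?thesis using main True by simp
  next
    case False
    then have "a1 = y" "a2 = x" using m by auto
    then obtain n where "pl E S y x n" "even n = par" using main by auto
    then show ?thesis using pl_sym[OF assms(1)] by blast
  qed
qed

section \<open>Bipartite graphs and odd cycles\<close>

definition bip :: "('a \<Rightarrow> 'a \<Rightarrow> bool) \<Rightarrow> 'a set \<Rightarrow> bool" where
  "bip E V \<longleftrightarrow> (\<exists>A. \<forall>a\<in>V. \<forall>b\<in>V. E a b \<longrightarrow> (a \<in> A \<longleftrightarrow> b \<notin> A))"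

lemma bip_parity:
  assumes "\<forall>a\<in>V. \<forall>b\<in>V. E a b \<longrightarrow> (a \<in> A \<longleftrightarrow> b \<notin> A)" "pl E V x y n"
  shows "even n \<longleftrightarrow> (x \<in> A \<longleftrightarrow> y \<in> A)"
proof -
  obtain p where p: "pth E V x p y" "length p = Suc n" using assms(2) by (auto simp: pl_def)
  have "even n \<longleftrightarrow> (hd p \<in> A \<longleftrightarrow> last p \<in> A)" if "successively E p" "set p \<subseteq> V" "length p = Suc n" for p n
    using that
  proof (induction p arbitrary: n)
    case (Cons a p)
    show ?case
    proof (cases p)
      case (Cons b q)
      then obtain n' where n: "n = Suc n'" "length p = Suc n'" using Cons.prems by (cases n) auto
      have "even n' \<longleftrightarrow> (hd p \<in> A \<longleftrightarrow> last p \<in> A)" using Cons.IH[OF _ _ n(2)] Cons.prems Cons by auto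
      moreover have "a \<in> A \<longleftrightarrow> b \<notin> A" using assms(1) Cons.prems Cons by auto
      ultimately show ?thesis using n Cons by auto
    qed (use Cons in auto)
  qed simp
  from this[of p n] show ?thesis using p by (auto simp: pth_def)
qed

text \<open>Induction on the vertices: if \<open>S\<close> is bipartite and a new vertex
  \<open>v\<close> closes no odd cycle, then the neighbours of \<open>v\<close> in one component of
  \<open>S\<close> have the same colour, so each component can be recoloured to suit
  \<open>v\<close>.\<close>

lemma odd_cycle:
  assumes "sgr E" "finite V" "\<not> bip E V"
  shows "\<exists>n. odd n \<and> cy E V n"
  using assms(2,3)
proof (induction V rule: finite_induct)
  case empty then show ?case by (auto simp: bip_def)
next
  case (insert v S)
  show ?case
  proof (cases "bip E S")
    case False then show ?thesis using insert.IH cy_mono[of E S] by blast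
  next
    case True
    then obtain A where A: "\<forall>a\<in>S. \<forall>b\<in>S. E a b \<longrightarrow> (a \<in> A \<longleftrightarrow> b \<notin> A)" by (auto simp: bip_def)
    show ?thesis
    proof (rule ccontr)
      assume n: "\<not> ?thesis"
      have same: "u \<in> A \<longleftrightarrow> w \<in> A" if uw: "E v u" "E v w" "con E S u w" for u w
      proof (rule ccontr)
        assume d: "\<not> ?thesis"
        obtain r where r: "pl E S u w r" using uw by (auto simp: con_pl)
        have o: "odd r" using bip_parity[OF A r] d by blast
        have uS: "u \<in> S" "w \<in> S" using pl_in[OF r] by auto
        have uwn: "u \<noteq> w" using d by auto
        have "pl E {u,v,w} u w 2" by (rule pl2[of E u v w]) (use uw uS insert.hyps uwn sgr_sym[OF assms(1)] in auto)
        then have "cy E (insert v S) (r + 2)"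
          by (rule cyI[OF assms(1) r]) (use uS insert.hyps uwn odd_pos[OF o] in auto)
        moreover have "odd (r + 2)" using o by simp
        ultimately show False using n by blast
      qed
      \<comment> \<open>In a component with a neighbour \<open>u\<close> of \<open>v\<close> the new
        class is the colour class of \<open>u\<close>; all other components keep their
        colouring.\<close>
      define B where "B = {w\<in>S. if \<exists>u. E v u \<and> con E S u w then \<exists>u. E v u \<and> con E S u w \<and> (u \<in> A \<longleftrightarrow> w \<in> A) else w \<in> A}"
      have Bu: "w \<in> B \<longleftrightarrow> (u \<in> A \<longleftrightarrow> w \<in> A)" if "E v u" "con E S u w" for u w
      proof -
        have wS: "w \<in> S" using con_in[OF that(2)] by simp
        have eqA: "u' \<in> A \<longleftrightarrow> u \<in> A" if "E v u'" "con E S u' w" for u'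
        proof (rule same[OF that(1) \<open>E v u\<close>])
          show "con E S u' u" by (rule con_trans[OF assms(1) that(2) con_sym[OF assms(1) \<open>con E S u w\<close>]])
        qed
        have ex: "\<exists>u. E v u \<and> con E S u w" using that by blast
        have "(\<exists>u'. E v u' \<and> con E S u' w \<and> (u' \<in> A \<longleftrightarrow> w \<in> A)) \<longleftrightarrow> (u \<in> A \<longleftrightarrow> w \<in> A)"
        proof
          assume "\<exists>u'. E v u' \<and> con E S u' w \<and> (u' \<in> A \<longleftrightarrow> w \<in> A)"
          then obtain u' where "E v u'" "con E S u' w" "u' \<in> A \<longleftrightarrow> w \<in> A" by blast
          then show "u \<in> A \<longleftrightarrow> w \<in> A" using eqA[of u'] by simp
        qed (use that in blast)
        then show ?thesis unfolding B_def mem_Collect_eq if_P[OF ex] using wS by simp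
      qed
      have "bip E (insert v S)" unfolding bip_def
      proof (rule exI[of _ B], intro ballI impI)
        have vB: "v \<notin> B" using insert.hyps by (auto simp: B_def)
        have eB: "b \<in> B" if "E v b" "b \<in> S" for b using Bu[OF that(1) con_refl[OF that(2)]] by simp
        have SS: "a \<in> B \<longleftrightarrow> b \<notin> B" if ab: "E a b" "a \<in> S" "b \<in> S" for a b
        proof (cases "\<exists>u. E v u \<and> con E S u a")
          case True
          then obtain u where u: "E v u" "con E S u a" by blast
          have "con E S u b" by (rule con_step[OF assms(1) u(2) ab(1,3)])
          then show ?thesis using Bu[OF u] Bu[OF u(1), of b] A ab by simp
        next
          case False
          have nb: "\<not> (\<exists>u. E v u \<and> con E S u b)"
            using False con_step[OF assms(1) _ sgr_sym[OF assms(1) ab(1)] ab(2)] by blast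
          have "b \<in> B \<longleftrightarrow> b \<in> A" unfolding B_def mem_Collect_eq if_not_P[OF nb] using ab by simp
          moreover have "a \<in> B \<longleftrightarrow> a \<in> A" unfolding B_def mem_Collect_eq if_not_P[OF False] using ab by simp
          ultimately show ?thesis using A ab by blast
        qed
        fix a b assume ab: "a \<in> insert v S" "b \<in> insert v S" "E a b"
        show "a \<in> B \<longleftrightarrow> b \<notin> B"
        proof (cases "a = v")
          case True
          then have "b \<in> S" using ab sgr_irrefl[OF assms(1)] by auto
          then show ?thesis using True vB eB ab by auto
        next
          case False
          show ?thesis
          proof (cases "b = v")
            case True then show ?thesis using vB eB[of a] sgr_sym[OF assms(1) ab(3)] ab False by auto
          next
            case bv: False then show ?thesis using SS ab False by auto
          qed
        qed
      qed
      then show False using insert.prems by blast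
    qed
  qed
qed

definition con2 :: "('a \<Rightarrow> 'a \<Rightarrow> bool) \<Rightarrow> 'a set \<Rightarrow> bool" where
  "con2 E V \<longleftrightarrow> (\<forall>s. \<forall>a\<in>V-{s}. \<forall>b\<in>V-{s}. con E (V - {s}) a b)"

lemma con2D: "con2 E V \<Longrightarrow> a \<in> V \<Longrightarrow> b \<in> V \<Longrightarrow> a \<noteq> s \<Longrightarrow> b \<noteq> s \<Longrightarrow> con E (V - {s}) a b"
  by (auto simp: con2_def)

lemma con2_bd:
  assumes "sgr E" "con2 E V" "K \<noteq> {}" "K \<subseteq> V" "clo E V K {c}" "w \<in> V" "w \<notin> K" "w \<noteq> c" "\<not> K \<subseteq> {c}"
  shows False
proof -
  obtain u where u: "u \<in> K" "u \<noteq> c" using assms by blast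
  have "con E (V - {c}) u w" by (rule con2D[OF assms(2)]) (use assms u in auto)
  then obtain a b where "a \<in> K" "b \<notin> K" "b \<in> V - {c}" "E a b"
    by (rule con_exit[OF assms(1) _ u(1) assms(7)]) blast
  then show False using cloD[OF assms(5), of a b] by auto
qed

lemma con2_conn2:
  assumes "sgr E" "con2 E V" "x \<noteq> y" "x \<in> V" "y \<in> V" shows "conn2 E V x y"
proof (rule conn2_cloI)
  fix K c assume K: "K \<noteq> {}" "K \<subseteq> V" "x \<notin> K" "y \<notin> K" "clo E V K {c}"
  have "\<exists>w\<in>{x,y}. w \<noteq> c" using assms(3) by auto
  then obtain w where w: "w \<in> {x,y}" "w \<noteq> c" by blast
  show False
  proof (cases "K \<subseteq> {c}")
    case False then show False using con2_bd[OF assms(1,2) K(1,2,5), of w] w K assms by blast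
  next
    case True
    then have Kc: "K = {c}" using K by auto
    then have "clo E V K {x}" using K(5) by (auto simp: clo_def)
    moreover have "\<not> K \<subseteq> {x}" using Kc K by auto
    ultimately show False using con2_bd[OF assms(1,2) K(1,2), of x y] K assms by blast
  qed
qed

text \<open>In a 2-connected graph no single vertex separates \<open>x\<close> and \<open>y\<close>
  from an odd cycle, so \<open>oddlink\<close> applies.\<close>

lemma both_parity:
  assumes "sgr E" "finite V" "con2 E V" "\<not> bip E V" "x \<in> V" "y \<in> V" "x \<noteq> y"
  shows "\<exists>n. pl E V x y n \<and> even n = par"
proof -
  obtain g where g: "odd g" "cy E V g" using odd_cycle[OF assms(1,2,4)] by blast
  obtain f where f: "cycf E f g" "range f \<subseteq> V" using cy_cycf[OF g(2)] .
  show ?thesis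
  proof (rule oddlink[OF assms(1,2,5,6) f(1) g(1) f(2)])
    fix s
    obtain a where a: "a \<in> {x,y}" "a \<noteq> s" using assms(7) by auto
    have "\<not> range f \<subseteq> {s}"
    proof
      assume "range f \<subseteq> {s}"
      then have "card (range f) \<le> card {s}" by (rule card_mono[rotated]) simp
      then show False using cycf_card[OF f(1)] f(1) by (simp add: cycf_def)
    qed
    then obtain b where b: "b \<in> range f" "b \<noteq> s" by blast
    have "con E (V - {s}) a b" by (rule con2D[OF assms(3)]) (use a b f assms in auto)
    then show "\<exists>a\<in>{x,y}. \<exists>b\<in>range f. con E (V - {s}) a b" using a b by blast
  qed
qed

section \<open>Cuts of size two and triangles\<close>

text \<open>A path of length at least 2 between the contracted vertices has a nonempty interior,
  which lies in \<open>C\<close>. The relation \<open>R\<close> is left general because it occurs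
  both with and without an edge between the contracted vertices.\<close>

lemma lift2:
  assumes "sgr E" "x \<noteq> y" "x \<notin> C" "y \<notin> C" "X \<inter> C = {}" "Y \<inter> C = {}" "X \<inter> Y = {}"
    and R: "\<And>a b. a \<in> C \<Longrightarrow> b \<in> C \<Longrightarrow> R a b \<Longrightarrow> E a b" "\<And>b. b \<in> C \<Longrightarrow> R x b \<Longrightarrow> \<exists>e\<in>X. E e b"
      "\<And>b. b \<in> C \<Longrightarrow> R b y \<Longrightarrow> \<exists>e\<in>Y. E b e"
    and p: "pl R (C \<union> {x,y}) x y n" "2 \<le> n"
  shows "\<exists>e\<in>X. \<exists>d\<in>Y. pl E (C \<union> {e,d}) e d n"
proof -
  obtain p where p': "pth R (C \<union> {x,y}) x p y" "length p = Suc n" using p(1) by (auto simp: pl_def)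
  obtain p1 where p1: "p = x # p1" using p' by (cases p) (auto simp: pth_def)
  have "p1 \<noteq> []" using p' p(2) p1 by auto
  then obtain q where q: "p1 = q @ [y]" using p' p1 by (metis append_butlast_last_id last_ConsR pth_def)
  have qn: "q \<noteq> []" using p' p(2) p1 q by auto
  have pq: "p = x # q @ [y]" using p1 q by simp
  have qC: "set q \<subseteq> C" using p' by (auto simp: pth_def pq)
  have "successively R (x # q @ [y])" using p' by (simp add: pth_def pq)
  then have s: "R x (hd q)" "successively R q" "R (last q) y"
    using qn by (auto simp: successively_Cons successively_append_iff)
  have hl: "hd q \<in> C" "last q \<in> C" using qC qn by auto
  obtain e where e: "e \<in> X" "E e (hd q)" using R(2)[OF hl(1) s(1)] by blast
  obtain d where d: "d \<in> Y" "E (last q) d" using R(3)[OF hl(2) s(3)] by blast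
  have "successively E q" by (rule successively_mono[OF s(2)]) (use qC R(1) in blast)
  then have "successively E (e # q @ [d])" using e d qn by (auto simp: successively_Cons successively_append_iff)
  moreover have "distinct (e # q @ [d])" using p' e d qC assms(5-7) by (auto simp: pth_def pq)
  ultimately have "pth E (C \<union> {e,d}) e (e # q @ [d]) d" using qC by (auto simp: pth_def)
  moreover have "length (e # q @ [d]) = Suc n" using p'(2) pq by simp
  ultimately show ?thesis using e(1) d(1) unfolding pl_def by blast
qed

text \<open>Both cores are contracted at once. Edges between \<open>X\<close> and \<open>Y\<close>
  are left out, so every path between the contracted vertices runs through \<open>C\<close>.\<close>

definition ctr2 :: "('a \<Rightarrow> 'a \<Rightarrow> bool) \<Rightarrow> 'a \<Rightarrow> 'a set \<Rightarrow> 'a \<Rightarrow> 'a set \<Rightarrow> 'a set \<Rightarrow> 'a \<Rightarrow> 'a \<Rightarrow> bool" where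
  "ctr2 E x X y Y C a b \<longleftrightarrow> a \<in> C \<and> b \<in> C \<and> E a b \<or>
     a = x \<and> b \<in> C \<and> (\<exists>e\<in>X. E b e) \<or> b = x \<and> a \<in> C \<and> (\<exists>e\<in>X. E a e) \<or>
     a = y \<and> b \<in> C \<and> (\<exists>e\<in>Y. E b e) \<or> b = y \<and> a \<in> C \<and> (\<exists>e\<in>Y. E a e)"

lemma ctr2_simps:
  assumes "x \<notin> C" "y \<notin> C" "x \<noteq> y"
  shows "a \<in> C \<Longrightarrow> b \<in> C \<Longrightarrow> ctr2 E x X y Y C a b \<longleftrightarrow> E a b"
    "b \<in> C \<Longrightarrow> ctr2 E x X y Y C x b \<longleftrightarrow> (\<exists>e\<in>X. E b e)" "b \<in> C \<Longrightarrow> ctr2 E x X y Y C b x \<longleftrightarrow> (\<exists>e\<in>X. E b e)"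
    "b \<in> C \<Longrightarrow> ctr2 E x X y Y C y b \<longleftrightarrow> (\<exists>e\<in>Y. E b e)" "b \<in> C \<Longrightarrow> ctr2 E x X y Y C b y \<longleftrightarrow> (\<exists>e\<in>Y. E b e)"
    "\<not> ctr2 E x X y Y C x y" "\<not> ctr2 E x X y Y C y x"
  using assms by (auto simp: ctr2_def)

lemma sgr_ctr2: "sgr E \<Longrightarrow> x \<notin> C \<Longrightarrow> y \<notin> C \<Longrightarrow> sgr (ctr2 E x X y Y C)"
  by (auto simp: sgr_def ctr2_def)

text \<open>The rooted statement for the contracted graph, with a root in place of \<open>z\<close>,
  so that no vertex of \<open>C\<close> is exceptional. All of \<open>C\<close> has both roots as
  outer neighbours, and a smaller set with one neighbour \<open>c\<close> in \<open>C\<close> gets a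
  second one from assumption \<open>b\<close>.\<close>

lemma core_fam:
  assumes sg: "sgr E" and fC: "finite C" and cs: "cset E C w0" and X: "X \<inter> C = {}" "Y \<inter> C = {}" "X \<inter> Y = {}"
    and aX: "\<exists>a\<in>C. \<exists>e\<in>X. E a e" and aY: "\<exists>a\<in>C. \<exists>e\<in>Y. E a e"
    and b: "\<And>c K. c \<in> C \<Longrightarrow> K \<noteq> {} \<Longrightarrow> K \<subseteq> C \<Longrightarrow> c \<notin> K \<Longrightarrow> clo E C K {c} \<Longrightarrow> \<exists>a\<in>K. \<exists>e\<in>X \<union> Y. E a e"
    and k: "1 \<le> k"
    and d: "\<And>w. 2 \<le> k \<Longrightarrow> w \<in> C \<Longrightarrow> k + 1 \<le> card {u\<in>C. E w u} +
      (if \<exists>e\<in>X. E w e then 1 else 0) + (if \<exists>e\<in>Y. E w e then 1 else 0)"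
  shows "fam k (\<lambda>n. 2 \<le> n \<and> (\<exists>e\<in>X. \<exists>d\<in>Y. pl E (C \<union> {e,d}) e d n))"
proof -
  obtain x where x: "x \<in> X" using aX by blast
  obtain y where y: "y \<in> Y" using aY by blast
  have xy: "x \<notin> C" "y \<notin> C" "x \<noteq> y" using x y X by auto
  let ?R = "ctr2 E x X y Y C" and ?W = "C \<union> {x,y}"
  note cs2 = ctr2_simps[OF xy, where E=E and X=X and Y=Y]
  have sR: "sgr ?R" by (rule sgr_ctr2[OF sg xy(1,2)])
  have c2': "conn2 ?R ?W x y"
  proof (rule conn2_cloI)
    fix K c assume K: "K \<noteq> {}" "K \<subseteq> ?W" "x \<notin> K" "y \<notin> K" "clo ?R ?W K {c}"
    have KC: "K \<subseteq> C" using K by auto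
    have cl: "clo E C K {c}"
    proof (rule cloI)
      fix a b assume ab: "a \<in> K" "b \<in> C" "E a b" "b \<notin> K"
      then have "?R a b" using cs2(1) KC by blast
      then show "b \<in> {c}" using cloD[OF K(5), of a b] ab by auto
    qed
    have xc: "x = c" if "a \<in> K" "e \<in> X" "E a e" for a e
      using cloD[OF K(5), of a x] cs2(3)[of a] that KC K(3) by auto
    have yc: "y = c" if "a \<in> K" "e \<in> Y" "E a e" for a e
      using cloD[OF K(5), of a y] cs2(5)[of a] that KC K(4) by auto
    show False
    proof (cases "c \<in> C \<and> c \<notin> K")
      case True
      then obtain a e where "a \<in> K" "e \<in> X \<union> Y" "E a e" using b[of c K] K KC cl by blast
      then show False using xc yc True xy by blast
    next
      case False
      have "K = C"
      proof (rule ccontr)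
        assume "K \<noteq> C"
        then obtain u where u: "u \<in> C" "u \<notin> K" using KC by auto
        obtain a b where ab: "a \<in> K" "b \<in> C - K" "E a b"
          using csetD[OF cset_any[OF sg cs u(1)] K(1) KC u(2)] by blast
        then show False using cloD[OF cl, of a b] False by auto
      qed
      then have "x = c" "y = c" using xc yc aX aY by blast+
      then show False using xy by simp
    qed
  qed
  have "k + 1 \<le> card {u\<in>?W. ?R w u}" if k2: "2 \<le> k" and w: "w \<in> ?W - {x,y,x}" for w
  proof -
    have wC: "w \<in> C" using w by auto
    have "{u\<in>?W. ?R w u} = {u\<in>C. E w u} \<union> (if \<exists>e\<in>X. E w e then {x} else {}) \<union> (if \<exists>e\<in>Y. E w e then {y} else {})"
      using cs2(1)[OF wC] cs2(3)[OF wC] cs2(5)[OF wC] by auto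
    moreover have "card ({u\<in>C. E w u} \<union> (if \<exists>e\<in>X. E w e then {x} else {}) \<union> (if \<exists>e\<in>Y. E w e then {y} else {})) =
      card {u\<in>C. E w u} + (if \<exists>e\<in>X. E w e then 1 else 0) + (if \<exists>e\<in>Y. E w e then 1 else 0)"
      using fC xy by (auto simp: card_insert_if)
    ultimately show ?thesis using d[OF k2 wC] by simp
  qed
  moreover have "?W - {x,y,x} \<noteq> {}" using aX xy by auto
  ultimately have "rooted ?R ?W x y x k"
    unfolding rooted_def using sR fC xy c2' k by blast
  then have "fam k (pl ?R ?W x y)" by (rule rooted_fam)
  then show ?thesis
  proof (rule fam_mono)
    fix n assume p: "pl ?R ?W x y n"
    have n2: "2 \<le> n"
    proof (rule ccontr)
      assume "\<not> 2 \<le> n"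
      then have "n = 0 \<or> n = 1" by auto
      then show False
      proof
        assume "n = 0" then show False using pl_0[of ?R ?W x y] p xy by simp
      next
        assume n: "n = 1"
        obtain w r where w: "n = Suc r" "pl ?R (?W - {y}) x w r" "?R w y" by (rule pl_lastE[OF p xy(3)])
        then have "x = w" using n pl_0[of ?R "?W - {y}" x w] by simp
        then show False using w cs2(6) by simp
      qed
    qed
    have "\<exists>e\<in>X. \<exists>d\<in>Y. pl E (C \<union> {e,d}) e d n"
    proof (rule lift2[OF sg xy(3,1,2) X, where R = ?R])
      show "\<exists>e\<in>X. E e b" if "b \<in> C" "?R x b" for b using cs2(2)[OF that(1)] that sgr_sym[OF sg] by blast
      show "\<exists>e\<in>Y. E b e" if "b \<in> C" "?R b y" for b using cs2(5)[OF that(1)] that by blast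
    qed (use cs2(1) p n2 in auto)
    then show "2 \<le> n \<and> (\<exists>e\<in>X. \<exists>d\<in>Y. pl E (C \<union> {e,d}) e d n)" using n2 by blast
  qed
qed

lemma fam_odd: assumes "fam (2 * m - 1) P" "1 \<le> m" shows "\<exists>l. \<forall>i<m. P (l + 2 * i)"
  using assms(1) unfolding fam_def
proof (elim disjE exE)
  fix l assume "\<forall>i<2 * m - 1. P (l + i)"
  then have "\<forall>i<m. P (l + 2 * i)" by auto
  then show ?thesis by blast
next
  fix l assume "\<forall>i\<le>(2 * m - 1) div 2. P (l + 2 * i)"
  moreover have "i \<le> (2 * m - 1) div 2" if "i < m" for i using that by auto
  ultimately show ?thesis by blast
qed

text \<open>The path meets \<open>x\<close> and \<open>y\<close> only at its ends, so from a vertex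
  of \<open>A\<close> it cannot leave \<open>A\<close> in either direction before it ends.\<close>

lemma side_path:
  assumes "sgr E" "pl E V x y n" "clo E V A {x,y}" "x \<notin> A" "y \<notin> A" "A \<subseteq> V"
  shows "pl E (A \<union> {x,y}) x y n \<or> pl E (V - A) x y n"
proof -
  obtain p where p: "pth E V x p y" "length p = Suc n" using assms(2) by (auto simp: pl_def)
  show ?thesis
  proof (cases "set p \<inter> A = {}")
    case True
    then have "pth E (V - A) x p y" using p by (auto simp: pth_def)
    then show ?thesis using p unfolding pl_def by blast
  next
    case False
    then obtain a where a: "a \<in> set p" "a \<in> A" by blast
    obtain p1 p2 where s: "p = p1 @ a # p2" using a by (meson split_list)
    have suc: "successively E (p1 @ a # p2)" and dis: "distinct (p1 @ a # p2)" using p s by (auto simp: pth_def)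
    have right: "set q \<subseteq> A \<union> {x,y}" if "successively E (b # q)" "b \<in> A" "set q \<subseteq> V" "distinct (b # q)" "\<forall>c\<in>set (butlast q). c \<noteq> x \<and> c \<noteq> y" for b q
      using that
    proof (induction q arbitrary: b)
      case (Cons c q)
      have c: "c \<in> A \<or> c \<in> {x,y}" using cloD[OF assms(3) Cons.prems(2), of c] Cons.prems by auto
      show ?case
      proof (cases "q = []")
        case True then show ?thesis using c by auto
      next
        case False
        then have "c \<in> A" using c Cons.prems by auto
        then have "set q \<subseteq> A \<union> {x,y}" using Cons.IH[of c] Cons.prems False by auto
        then show ?thesis using \<open>c \<in> A\<close> by auto
      qed
    qed simp
    have p2: "set p2 \<subseteq> A \<union> {x,y}"
    proof (rule right[of a])
      show "successively E (a # p2)" using suc by (auto simp: successively_append_iff)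
      have "x \<in> set p1" using p s a assms(4) by (cases p1) (auto simp: pth_def)
      moreover have "y \<notin> set (butlast p2)"
      proof
        assume y: "y \<in> set (butlast p2)"
        then have "p2 \<noteq> []" by auto
        then have "p2 = butlast p2 @ [y]" using p s by (auto simp: pth_def)
        then have "distinct (butlast p2 @ [y])" using dis by (metis distinct.simps(2) distinct_append)
        then show False using y by simp
      qed
      ultimately show "\<forall>c\<in>set (butlast p2). c \<noteq> x \<and> c \<noteq> y" using dis in_set_butlastD[of _ p2] by fastforce
    qed (use a p s dis in \<open>auto simp: pth_def\<close>)
    have p1: "set (rev p1) \<subseteq> A \<union> {x,y}"
    proof (rule right[of a])
      have "pth E V y (rev p) x" by (rule pth_rev[OF assms(1) p(1)])
      then have "successively E (rev p2 @ a # rev p1)" by (simp add: pth_def s)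
      then show "successively E (a # rev p1)" by (auto simp: successively_append_iff)
      have "p2 \<noteq> []" using p s a assms(5) by (auto simp: pth_def)
      then have "y \<in> set p2" using p s by (auto simp: pth_def)
      moreover have "x \<notin> set (butlast (rev p1))"
      proof
        assume x: "x \<in> set (butlast (rev p1))"
        then have p1n: "p1 \<noteq> []" by auto
        then have "p1 = x # tl p1" using p s by (cases p1) (auto simp: pth_def)
        moreover have "butlast (rev p1) = rev (tl p1)" by (simp add: butlast_rev)
        ultimately have "distinct (x # tl p1)" "x \<in> set (tl p1)" using dis x by (metis distinct_append, simp)
        then show False by simp
      qed
      ultimately show "\<forall>c\<in>set (butlast (rev p1)). c \<noteq> x \<and> c \<noteq> y" using dis in_set_butlastD[of _ "rev p1"] by fastforce
    qed (use a p s dis in \<open>auto simp: pth_def\<close>)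
    have "set p \<subseteq> A \<union> {x,y}" using p1 p2 a s by auto
    then have "pth E (A \<union> {x,y}) x p y" using p by (auto simp: pth_def)
    then show ?thesis using p unfolding pl_def by blast
  qed
qed

lemma odd_sum_ge3: "odd (n + r) \<Longrightarrow> 1 \<le> n \<Longrightarrow> 1 \<le> r \<Longrightarrow> 3 \<le> n + (r::nat)"
  by (metis One_nat_def Suc_1 add_mono dvd_refl le_antisym not_less_eq_eq numeral_3_eq_3 one_add_one)

lemma pl_pos: "pl E S x y n \<Longrightarrow> x \<noteq> y \<Longrightarrow> 1 \<le> n"
  using pl_0[of E S x y] by (cases n) auto

lemma loss_cases:
  "\<lbrakk>n \<le> 3; \<not> A \<Longrightarrow> n \<le> 2; \<not> B \<Longrightarrow> n \<le> 2; \<not> A \<Longrightarrow> \<not> B \<Longrightarrow> n = 0\<rbrakk> \<Longrightarrow>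
    n \<le> 1 + (if A then 1 else 0) + (if B then 1 else (0::nat))"
  by (cases A; cases B) auto

section \<open>Counterexamples to the theorem have no cuts of size two\<close>

locale cex =
  fixes E :: "'a \<Rightarrow> 'a \<Rightarrow> bool" and V :: "'a set" and m :: nat
  assumes sg: "sgr E" and fin: "finite V" and c2: "con2 E V" and nb: "\<not> bip E V"
    and deg: "\<And>v. v \<in> V \<Longrightarrow> 2 * m \<le> card {u\<in>V. E v u}"
    and ng: "\<And>l. odd l \<Longrightarrow> (\<And>i. i < m \<Longrightarrow> cy E V (l + 2 * i)) \<Longrightarrow> False"
begin

lemma sym: "E a b \<Longrightarrow> E b a" using sgr_sym[OF sg] .
lemma irr: "\<not> E a a" using sgr_irrefl[OF sg] .

lemma m2: "2 \<le> m"
proof (rule ccontr)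
  assume "\<not> 2 \<le> m"
  obtain n where "odd n" "cy E V n" using odd_cycle[OF sg fin nb] by blast
  then show False using ng[of n] \<open>\<not> 2 \<le> m\<close> by (metis One_nat_def add.right_neutral less_2_cases mult_0_right not_less less_trans less_one not_numeral_le_zero one_less_numeral_iff)
qed

text \<open>Whatever the parity of \<open>l\<close>, 2m consecutive lengths contain m consecutive
  odd ones.\<close>

lemma consec: assumes "\<And>i. i < 2 * m \<Longrightarrow> cy E V (l + i)" shows False
proof (cases "odd l")
  case True then show False by (rule ng) (rule assms, simp)
next
  case False
  then have "odd (l + 1)" by simp
  then show False
  proof (rule ng)
    fix i assume "i < m"
    then show "cy E V (l + 1 + 2 * i)" using assms[of "1 + 2 * i"] by (simp add: ac_simps)
  qed
qed

lemma cardV: assumes "v \<in> V" shows "2 * m + 1 \<le> card V"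
proof -
  have "insert v {u\<in>V. E v u} \<subseteq> V" using assms by auto
  then have "card (insert v {u\<in>V. E v u}) \<le> card V" by (rule card_mono[OF fin])
  moreover have "card (insert v {u\<in>V. E v u}) = card {u\<in>V. E v u} + 1" using fin irr by simp
  ultimately show ?thesis using deg[OF assms] by linarith
qed

text \<open>Vertices on one side of a 2-cut keep their full degree, so the rooted statement holds
  with k = 2m - 1 and without exceptional vertex.\<close>

lemma side_fam:
  assumes "x \<in> V" "y \<in> V" "x \<noteq> y" "A \<noteq> {}" "A \<subseteq> V" "x \<notin> A" "y \<notin> A" "clo E V A {x,y}"
  shows "\<exists>l. \<forall>i<m. pl E (A \<union> {x,y}) x y (l + 2 * i)"
proof (rule fam_odd)
  let ?W = "A \<union> {x,y}"
  have "conn2 E ?W x y"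
  proof (rule conn2_cloI)
    fix K c assume K: "K \<noteq> {}" "K \<subseteq> ?W" "x \<notin> K" "y \<notin> K" "clo E ?W K {c}"
    then have KA: "K \<subseteq> A" by auto
    have cl: "clo E V K {c}" by (rule clo_sub[OF K(5) KA assms(8)])
    show False
      by (rule conn2_cloD[OF con2_conn2[OF sg c2 assms(3,1,2)] K(1) _ K(3,4) cl]) (use KA assms in blast)
  qed
  moreover have "2 * m - 1 + 1 \<le> card {u\<in>?W. E v u}" if "v \<in> ?W - {x,y,x}" for v
  proof -
    have "v \<in> A" using that by auto
    then have "{u\<in>?W. E v u} = {u\<in>V. E v u}" using cloD[OF assms(8), of v] assms by auto
    then show ?thesis using deg[of v] \<open>v \<in> A\<close> assms m2 by auto
  qed
  moreover have "finite ?W" using assms fin finite_subset by auto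
  ultimately have "rooted E ?W x y x (2 * m - 1)" unfolding rooted_def using assms sg m2 by auto
  then show "fam (2 * m - 1) (pl E ?W x y)" by (rule rooted_fam)
qed (use m2 in simp)

text \<open>Both sides of the cut supply m lengths of difference 2, starting at \<open>l\<close> and
  \<open>r\<close>. If l + r is odd, a path on one side closes the family of the other to odd
  cycles. If it is even, some path has the parity that suits both families, and as it lies on one
  side, it closes the family of the other.\<close>

lemma sep2:
  assumes "x \<in> V" "y \<in> V" "x \<noteq> y" "A \<noteq> {}" "A \<subseteq> V" "x \<notin> A" "y \<notin> A" "clo E V A {x,y}" "w \<in> V" "w \<notin> A" "w \<noteq> x" "w \<noteq> y"
  shows False
proof -
  let ?B = "V - A - {x,y}"
  have clB: "clo E V ?B {x,y}"
  proof (rule cloI)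
    fix a b assume "a \<in> ?B" "b \<in> V" "E a b" "b \<notin> ?B"
    then show "b \<in> {x,y}" using cloD[OF assms(8), of b a] sym by blast
  qed
  obtain l where l: "\<forall>i<m. pl E (A \<union> {x,y}) x y (l + 2 * i)" using side_fam[OF assms(1-8)] by blast
  have "\<exists>l. \<forall>i<m. pl E (?B \<union> {x,y}) x y (l + 2 * i)" by (rule side_fam) (use assms clB in auto)
  moreover have B: "?B \<union> {x,y} = V - A" using assms by auto
  ultimately obtain r where r: "\<forall>i<m. pl E (V - A) x y (r + 2 * i)" by auto
  have l0: "pl E (A \<union> {x,y}) x y l" and r0: "pl E (V - A) x y r" using l r m2 by (metis add.right_neutral mult_0_right not_less not_numeral_le_zero order_refl le_trans not_gr0 less_le_trans zero_less_numeral)+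
  have f1: False if "pl E (V - A) x y n" "odd (l + n)" for n
  proof (rule ng[of "l + n"])
    fix i assume i: "i < m"
    then have p: "pl E (A \<union> {x,y}) x y (l + 2 * i)" using l by blast
    have "odd ((l + 2 * i) + n)" using that(2) by simp
    then have "3 \<le> (l + 2 * i) + n" by (rule odd_sum_ge3) (use pl_pos[OF p assms(3)] pl_pos[OF that(1) assms(3)] in auto)
    then show "cy E V (l + n + 2 * i)"
      by (intro cyI[OF sg p that(1)]) (use assms in auto)
  qed (rule that)
  have f2: False if "pl E (A \<union> {x,y}) x y n" "odd (r + n)" for n
  proof (rule ng[of "r + n"])
    fix i assume i: "i < m"
    then have p: "pl E (V - A) x y (r + 2 * i)" using r by blast
    have "odd (n + (r + 2 * i))" using that(2) by simp
    then have "3 \<le> n + (r + 2 * i)" by (rule odd_sum_ge3) (use pl_pos[OF p assms(3)] pl_pos[OF that(1) assms(3)] in auto)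
    then show "cy E V (r + n + 2 * i)"
      by (intro cyI[OF sg that(1) p]) (use assms in auto)
  qed (rule that)
  have lr: "even (l + r)" using f1[OF r0] by blast
  obtain n where n: "pl E V x y n" "even n = odd l" using both_parity[OF sg fin c2 nb assms(1-3)] by metis
  have "odd (l + n)" "odd (r + n)" using n(2) lr by auto
  then show False using side_path[OF sg n(1) assms(8,6,7,5)] f1 f2 by blast
qed

text \<open>3-connectivity in a form that tolerates \<open>a\<close> or \<open>b\<close> inside
  \<open>K\<close>, outside \<open>V\<close>, or equal.\<close>

lemma sep3:
  assumes "K \<subseteq> V" "clo E V K {a,b}" "u \<in> K" "u \<noteq> a" "u \<noteq> b" "w \<in> V" "w \<notin> K" "w \<noteq> a" "w \<noteq> b"
  shows False
proof -
  let ?K = "K - {a,b}"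
  have cl: "clo E V ?K {a,b}" using assms(2) by (auto simp: clo_def)
  have ne: "?K \<noteq> {}" "?K \<subseteq> V" "w \<notin> ?K" using assms by auto
  show False
  proof (cases "a \<in> V \<and> b \<in> V \<and> a \<noteq> b")
    case True then show False using sep2[of a b ?K w] cl ne assms by blast
  next
    case False
    then have "clo E V ?K {a} \<or> clo E V ?K {b}" using cl by (auto simp: clo_def)
    then show False
    proof
      assume c: "clo E V ?K {a}"
      show False by (rule con2_bd[OF sg c2 ne(1,2) c, of w]) (use assms in auto)
    next
      assume c: "clo E V ?K {b}"
      show False by (rule con2_bd[OF sg c2 ne(1,2) c, of w]) (use assms in auto)
    qed
  qed
qed

text \<open>Contracting \<open>X\<close> and \<open>Y\<close> costs at most \<open>l\<close> in degree, while the \<open>r\<close> lengths available inside \<open>X \<union> Y\<close> gain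
  at least \<open>l + 1\<close>.\<close>

lemma top_core:
  assumes X: "X \<subseteq> V" "Y \<subseteq> V" "X \<inter> Y = {}" and C: "C = compo E (V - (X \<union> Y)) w0" "w0 \<in> V - (X \<union> Y)"
    and aX: "\<exists>a\<in>C. \<exists>e\<in>X. E a e" and aY: "\<exists>a\<in>C. \<exists>e\<in>Y. E a e"
    and loss: "\<And>w. w \<in> C \<Longrightarrow> card {u\<in>X \<union> Y. E w u} \<le>
      l + (if \<exists>e\<in>X. E w e then 1 else 0) + (if \<exists>e\<in>Y. E w e then 1 else 0)"
    and pa: "\<And>e d n. e \<in> X \<Longrightarrow> d \<in> Y \<Longrightarrow> 1 \<le> n \<Longrightarrow> n \<le> r \<Longrightarrow> pl E (X \<union> Y) e d n"
    and r: "l + 2 \<le> r"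
  shows False
proof -
  let ?S = "V - (X \<union> Y)"
  \<comment> \<open>\<open>fam_clique\<close> yields k + r - 1 consecutive cycle lengths, which is
    at least 2m because r >= l + 2; the maximum keeps k positive for large \<open>l\<close>.\<close>
  define k where "k = max 1 (2 * m - 1 - l)"
  have CS: "C \<subseteq> ?S" "cset E C w0"
    using compo_sub[of E ?S w0] cset_compo[OF sg C(2)] by (auto simp: C)
  have nb: "b \<in> C \<or> b \<in> X \<union> Y" if "a \<in> C" "b \<in> V" "E a b" for a b
    using that compo_closed[OF sg, of a ?S w0 b] by (auto simp: C(1))
  have fC: "finite C" using CS fin finite_subset[of C V] by auto
  have f: "fam k (\<lambda>n. 2 \<le> n \<and> (\<exists>e\<in>X. \<exists>d\<in>Y. pl E (C \<union> {e,d}) e d n))"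
  proof (rule core_fam[OF sg fC CS(2)])
    show "\<exists>a\<in>K. \<exists>e\<in>X \<union> Y. E a e"
      if K: "c \<in> C" "K \<noteq> {}" "K \<subseteq> C" "c \<notin> K" "clo E C K {c}" for c K
    proof (rule ccontr)
      assume n: "\<not> ?thesis"
      have cl: "clo E V K {c}"
      proof (rule cloI)
        fix a b assume ab: "a \<in> K" "b \<in> V" "E a b" "b \<notin> K"
        then have "b \<in> C" using nb[of a b] n K by blast
        then show "b \<in> {c}" using cloD[OF K(5), of a b] ab by auto
      qed
      obtain e where e: "e \<in> X" using aX by blast
      then have "e \<in> V" "e \<notin> K" "e \<noteq> c" using X CS K by auto
      then show False using con2_bd[OF sg c2 K(2) _ cl, of e] K CS by blast
    qed
    show "k + 1 \<le> card {u\<in>C. E w u} + (if \<exists>e\<in>X. E w e then 1 else 0) + (if \<exists>e\<in>Y. E w e then 1 else 0)"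
      if k2: "2 \<le> k" and w: "w \<in> C" for w
    proof -
      have kk: "k = 2 * m - 1 - l" using k2 by (auto simp: k_def)
      have sub: "{u\<in>V. E w u} \<subseteq> {u\<in>C. E w u} \<union> {u\<in>X \<union> Y. E w u}" using nb[OF w] by auto
      have fin': "finite ({u\<in>C. E w u} \<union> {u\<in>X \<union> Y. E w u})" using fC X fin finite_subset[of X V] finite_subset[of Y V] by auto
      have "2 * m \<le> card {u\<in>V. E w u}" using deg w CS by auto
      also have "\<dots> \<le> card ({u\<in>C. E w u} \<union> {u\<in>X \<union> Y. E w u})" by (rule card_mono[OF fin' sub])
      also have "\<dots> \<le> card {u\<in>C. E w u} + card {u\<in>X \<union> Y. E w u}" by (rule card_Un_le)
      finally show ?thesis using loss[OF w] kk k2 by linarith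
    qed
  qed (use CS X aX aY in \<open>auto simp: k_def\<close>)
  have "\<exists>l. \<forall>i<2 * m. cy E V (l + i)"
  proof (rule fam_clique[OF f, where r=r])
    show "2 \<le> r" using r by simp
    show "2 * m \<le> k + r - 1" "1 \<le> k" using r m2 by (auto simp: k_def)
    fix n l assume "2 \<le> n \<and> (\<exists>e\<in>X. \<exists>d\<in>Y. pl E (C \<union> {e,d}) e d n)" and l: "1 \<le> l" "l \<le> r"
    then obtain e d where n: "2 \<le> n" and e: "e \<in> X" "d \<in> Y" "pl E (C \<union> {e,d}) e d n" by blast
    show "cy E V (n + l)"
      by (rule cyI[OF sg e(3) pa[OF e(1,2) l]]) (use e CS X n l in auto)
  qed
  then show False using consec by blast
qed

text \<open>A clique with more than 2m vertices contains cycles of lengths 3, 5, ..., 2m + 1 itself.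
  A smaller one is split into two cores with loss c - 3, joined by paths of all lengths from 1 to c
  - 1.\<close>

lemma big_clique:
  assumes K: "K \<subseteq> V" "4 \<le> card K" "\<And>a b. a \<in> K \<Longrightarrow> b \<in> K \<Longrightarrow> a \<noteq> b \<Longrightarrow> E a b"
    and mx: "\<And>w. w \<in> V - K \<Longrightarrow> \<exists>u\<in>K. \<not> E w u"
  shows False
proof -
  define c where "c = card K"
  have fK: "finite K" using K fin finite_subset by blast
  have pK: "pl E K e d n" if "e \<in> K" "d \<in> K" "e \<noteq> d" "1 \<le> n" "n < c" for e d n
    by (rule clique_pl) (use fK K that in \<open>auto simp: c_def\<close>)
  have "c \<le> 2 * m"
  proof (rule ccontr)
    assume big: "\<not> c \<le> 2 * m"
    obtain e where e: "e \<in> K" using K(2) by fastforce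
    have "card (K - {e}) \<noteq> 0" using K(2) e fK by simp
    then obtain d where d: "d \<in> K" "d \<noteq> e" by (metis Diff_iff card.empty ex_in_conv singletonI)
    have "pl E V e d (2 + n)" if "n < 2 * m - 1" for n
      by (rule pl_mono[OF pK[of e d "2 + n"]]) (use e d that big K in auto)
    then show False
    proof (intro ng[of 3])
      fix i assume h: "\<And>n. n < 2 * m - 1 \<Longrightarrow> pl E V e d (2 + n)" "i < m"
      then have "pl E V e d (2 + 2 * i)" by auto
      moreover have "E d e" using K(3) e d by auto
      ultimately show "cy E V (3 + 2 * i)" unfolding cy_def by (intro conjI exI[of _ e] exI[of _ d]) (auto simp: numeral_3_eq_3)
    qed simp
  qed
  moreover obtain e0 where e0: "e0 \<in> K" using K(2) by fastforce
  then have "2 * m + 1 \<le> card V" using cardV K by blast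
  ultimately have "\<not> V \<subseteq> K" using card_mono[OF fK, of V] by (auto simp: c_def)
  then obtain w0 where w0: "w0 \<in> V" "w0 \<notin> K" by blast
  define C where "C = compo E (V - K) w0"
  have w0S: "w0 \<in> V - K" using w0 by auto
  have CS: "C \<subseteq> V - K" "w0 \<in> C" using compo_sub[of E "V - K" w0] compo_self[OF w0S, of E] by (auto simp: C_def)
  have nb: "b \<in> C \<or> b \<in> K" if "a \<in> C" "b \<in> V" "E a b" for a b
    using that compo_closed[OF sg, of a "V - K" w0 b] by (auto simp: C_def)
  have at: "\<exists>e\<in>K. e \<noteq> c \<and> (\<exists>a\<in>C. E a e)" for c
  proof (rule ccontr)
    assume n: "\<not> ?thesis"
    have cl: "clo E V C {c}" using nb n by (intro cloI) blast
    obtain e where e: "e \<in> K" "e \<noteq> c"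
    proof -
      have "\<not> K \<subseteq> {c}" using K(2) card_mono[of "{c}" K] by auto
      then show ?thesis using that by blast
    qed
    show False
    proof (cases "C \<subseteq> {c}")
      case False
      show False by (rule con2_bd[OF sg c2 _ _ cl, of e]) (use CS e K False in auto)
    next
      case True
      then have "c \<notin> K" using CS by auto
      then have "C = {c}" using True CS by auto
      then have "clo E V C {e}" using cl by (auto simp: clo_def)
      moreover obtain e' where "e' \<in> K" "e' \<noteq> e"
      proof -
        have "\<not> K \<subseteq> {e}" using K(2) card_mono[of "{e}" K] by auto
        then show ?thesis using that by blast
      qed
      ultimately show False using con2_bd[OF sg c2, of C e e'] CS e K \<open>C = {c}\<close> \<open>c \<notin> K\<close> by blast
    qed
  qed
  obtain e1 where e1: "e1 \<in> K" "\<exists>a\<in>C. E a e1" using at by blast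
  obtain e2 where e2: "e2 \<in> K" "e2 \<noteq> e1" "\<exists>a\<in>C. E a e2" using at by blast
  have "card {e1,e2} = 2" using e2 by simp
  then have "card (K - {e1,e2}) = card K - 2" using fK e1 e2 by (subst card_Diff_subset) auto
  then have "K - {e1,e2} \<noteq> {}" using K(2) by (metis card.empty diff_is_0_eq numeral_le_iff not_le semiring_norm(69,72,78) le_trans nat_le_linear numeral_Bit0 add_le_imp_le_diff)
  then obtain e3 where e3: "e3 \<in> K" "e3 \<noteq> e1" "e3 \<noteq> e2" by blast
  \<comment> \<open>\<open>X\<close> gets a second vertex because a vertex that sees all of
    \<open>Y\<close> but nothing of \<open>X\<close> may lose only c - 2; \<open>e1\<close> and
    \<open>e2\<close> attach both cores to \<open>C\<close>.\<close>
  let ?X = "{e1,e3}" and ?Y = "K - {e1,e3}"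
  have XY: "?X \<union> ?Y = K" using e1 e3 by auto
  have cX: "card ?X = 2" using e3 by simp
  have cY: "card ?Y = c - 2" unfolding c_def using fK e1 e3 cX by (subst card_Diff_subset) auto
  show False
  proof (rule top_core[of ?X ?Y C w0 "c - 3" "c - 1"])
    show "C = compo E (V - (?X \<union> ?Y)) w0" using XY by (simp add: C_def)
    show "c - 3 + 2 \<le> c - 1" using K(2) by (simp add: c_def)
    show "pl E (?X \<union> ?Y) e d n" if "e \<in> ?X" "d \<in> ?Y" "1 \<le> n" "n \<le> c - 1" for e d n
      unfolding XY by (rule pK) (use that e1 e3 K(2) in \<open>auto simp: c_def\<close>)
    show "card {u\<in>?X \<union> ?Y. E w u} \<le> c - 3 + (if \<exists>e\<in>?X. E w e then 1 else 0) + (if \<exists>e\<in>?Y. E w e then 1 else 0)"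
      if w: "w \<in> C" for w
    proof -
      obtain u where u: "u \<in> K" "\<not> E w u" using mx w CS by blast
      have "card {u\<in>K. E w u} \<le> card (K - {u})" by (rule card_mono) (use fK u in auto)
      then have a: "card {u\<in>K. E w u} \<le> c - 1" using u fK by (simp add: c_def)
      have b: "card {u\<in>K. E w u} \<le> c - 2" if "\<not> (\<exists>e\<in>?X. E w e)"
      proof -
        have "card {u\<in>K. E w u} \<le> card ?Y" by (rule card_mono) (use fK that in auto)
        then show ?thesis using cY by simp
      qed
      have d: "card {u\<in>K. E w u} \<le> 2" if "\<not> (\<exists>e\<in>?Y. E w e)"
      proof -
        have "card {u\<in>K. E w u} \<le> card ?X" by (rule card_mono) (use that in auto)
        then show ?thesis using cX by simp
      qed
      have e: "card {u\<in>K. E w u} = 0" if "\<not> (\<exists>e\<in>?X. E w e)" "\<not> (\<exists>e\<in>?Y. E w e)"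
      proof -
        have "{u\<in>K. E w u} = {}" using that by blast
        then show ?thesis by (metis card.empty)
      qed
      have c4: "4 \<le> c" using K(2) by (simp add: c_def)
      show ?thesis unfolding XY using a b d e c4
        by (cases "\<exists>e\<in>?X. E w e"; cases "\<exists>e\<in>?Y. E w e") auto
    qed
  qed (use XY w0 e1 e2 e3 K in auto)
qed

lemma no_K4:
  assumes K0: "K0 \<subseteq> V" "4 \<le> card K0" "\<And>a b. a \<in> K0 \<Longrightarrow> b \<in> K0 \<Longrightarrow> a \<noteq> b \<Longrightarrow> E a b"
  shows False
proof -
  define P where "P K \<longleftrightarrow> K \<subseteq> V \<and> (\<forall>a\<in>K. \<forall>b\<in>K. a \<noteq> b \<longrightarrow> E a b)" for K
  have "P K0" using K0 by (auto simp: P_def)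
  moreover have "\<forall>K. P K \<longrightarrow> card K < card V + 1" using card_mono[OF fin] by (auto simp: P_def less_Suc_eq_le)
  ultimately obtain K where K: "P K" and mx: "\<forall>K'. P K' \<longrightarrow> card K' \<le> card K"
    using ex_has_greatest_nat[of P K0 card "card V + 1"] by blast
  have fK: "finite K" using K fin finite_subset by (auto simp: P_def)
  show False
  proof (rule big_clique[of K])
    show "4 \<le> card K" using mx \<open>P K0\<close> K0(2) by fastforce
    show "\<exists>u\<in>K. \<not> E w u" if "w \<in> V - K" for w
    proof (rule ccontr)
      assume n: "\<not> ?thesis"
      have "P (insert w K)" using K n that sym by (auto simp: P_def)
      then have "card (insert w K) \<le> card K" using mx by blast
      then show False using that fK by simp
    qed
  qed (use K in \<open>auto simp: P_def\<close>)
qed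

lemma outside:
  assumes "H \<subseteq> V" "card H \<le> 4" "v \<in> V" obtains w where "w \<in> V - H"
proof -
  have "5 \<le> card V" using cardV[OF assms(3)] m2 by linarith
  then have "\<not> V \<subseteq> H" using card_mono[OF finite_subset[OF assms(1) fin], of V] assms(2) by linarith
  then show ?thesis using that by blast
qed

text \<open>With the edge between \<open>t\<close> and \<open>t'\<close>, the pairs
  \<open>{v,v'}\<close> and \<open>{t,t'}\<close> are joined by paths of lengths 1, 2 and 3. A
  vertex outside sees at most three of the four vertices, since otherwise it would form a clique
  with \<open>v\<close>, \<open>t\<close>, \<open>t'\<close>; both pairs are attached to
  \<open>C\<close> by 3-connectivity.\<close>

lemma no_K4m:
  assumes V: "v \<in> V" "v' \<in> V" "t \<in> V" "t' \<in> V" and e: "E v t" "E v t'" "E v' t" "E v' t'" "E t t'" and vv: "v \<noteq> v'"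
  shows False
proof -
  have ne: "v \<noteq> t" "v \<noteq> t'" "v' \<noteq> t" "v' \<noteq> t'" "t \<noteq> t'" using e irr by auto
  let ?X = "{v,v'}" and ?Y = "{t,t'}"
  have "card (?X \<union> ?Y) \<le> 4" using ne vv by simp
  then obtain w0 where w0: "w0 \<in> V - (?X \<union> ?Y)" using outside[of "?X \<union> ?Y" v] V by auto
  define C where "C = compo E (V - (?X \<union> ?Y)) w0"
  have CS: "C \<subseteq> V - (?X \<union> ?Y)" "w0 \<in> C" using compo_sub[of E "V - (?X \<union> ?Y)" w0] compo_self[OF w0, of E] by (auto simp: C_def)
  have nb: "b \<in> C \<or> b \<in> ?X \<union> ?Y" if "a \<in> C" "b \<in> V" "E a b" for a b
    using that compo_closed[OF sg, of a "V - (?X \<union> ?Y)" w0 b] by (auto simp: C_def)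
  show False
  proof (rule top_core[of ?X ?Y C w0 1 3])
    show "\<exists>a\<in>C. \<exists>e\<in>?X. E a e"
    proof (rule ccontr)
      assume n: "\<not> ?thesis"
      have "clo E V C ?Y" using nb n by (intro cloI) blast
      then show False using sep3[of C t t' w0 v] CS w0 V ne by blast
    qed
    show "\<exists>a\<in>C. \<exists>e\<in>?Y. E a e"
    proof (rule ccontr)
      assume n: "\<not> ?thesis"
      have "clo E V C ?X" using nb n by (intro cloI) blast
      then show False using sep3[of C v v' w0 t] CS w0 V ne by blast
    qed
    show "card {u\<in>?X \<union> ?Y. E w u} \<le> 1 + (if \<exists>e\<in>?X. E w e then 1 else 0) + (if \<exists>e\<in>?Y. E w e then 1 else 0)"
      if w: "w \<in> C" for w
    proof -
      have c3: "card {u\<in>?X \<union> ?Y. E w u} \<le> 3"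
      proof (rule ccontr)
        assume "\<not> ?thesis"
        moreover have "card (?X \<union> ?Y) = 4" using ne vv by simp
        ultimately have "{u\<in>?X \<union> ?Y. E w u} = ?X \<union> ?Y" by (intro card_seteq) auto
        then have ew: "E w v" "E w t" "E w t'" by auto
        have wn: "w \<noteq> v" "w \<noteq> t" "w \<noteq> t'" using ew irr by auto
        show False
        proof (rule no_K4[of "{w,v,t,t'}"])
          show "4 \<le> card {w,v,t,t'}" using wn ne by simp
        qed (use w CS V e ew sym in auto)
      qed
      have cx: "card {u\<in>?X \<union> ?Y. E w u} \<le> 2" if n: "\<not> (\<exists>e\<in>?X. E w e)"
      proof -
        have sub: "{u\<in>?X \<union> ?Y. E w u} \<subseteq> ?Y" using n by auto
        have "card {u\<in>?X \<union> ?Y. E w u} \<le> card ?Y" by (rule card_mono[OF _ sub]) simp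
        also have "\<dots> \<le> 2" by (simp add: card_insert_if)
        finally show ?thesis .
      qed
      have cyy: "card {u\<in>?X \<union> ?Y. E w u} \<le> 2" if n: "\<not> (\<exists>e\<in>?Y. E w e)"
      proof -
        have sub: "{u\<in>?X \<union> ?Y. E w u} \<subseteq> ?X" using n by auto
        have "card {u\<in>?X \<union> ?Y. E w u} \<le> card ?X" by (rule card_mono[OF _ sub]) simp
        also have "\<dots> \<le> 2" by (simp add: card_insert_if)
        finally show ?thesis .
      qed
      have c0: "card {u\<in>?X \<union> ?Y. E w u} = 0" if "\<not> (\<exists>e\<in>?X. E w e)" "\<not> (\<exists>e\<in>?Y. E w e)"
      proof -
        have "{u\<in>?X \<union> ?Y. E w u} = {}" using that by blast
        then show ?thesis by (metis card.empty)
      qed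
      show ?thesis by (rule loss_cases[OF c3 cx cyy c0])
    qed
    show "pl E (?X \<union> ?Y) e d n" if ed: "e \<in> ?X" "d \<in> ?Y" "1 \<le> n" "n \<le> 3" for e d n
    proof -
      obtain e' where e': "e' \<in> ?X" "e' \<noteq> e" using ed(1) vv by auto
      obtain d' where d': "d' \<in> ?Y" "d' \<noteq> d" using ed(2) ne(5) by auto
      have ad: "E a b" if "a \<in> ?X" "b \<in> ?Y" for a b using that assms(5-8) by auto
      have dd: "E d' d" using d' ed(2) assms(9) sym by auto
      have dj: "a \<noteq> b" if "a \<in> ?X" "b \<in> ?Y" for a b using that ne by auto
      have es: "E e d'" "E e' d" "E d' e'" using ad[OF ed(1) d'(1)] ad[OF e'(1) ed(2)] sym[OF ad[OF e'(1) d'(1)]] by auto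
      have ds: "e \<noteq> d" "e \<noteq> d'" "e' \<noteq> d" "e' \<noteq> d'" by (rule dj[OF ed(1,2)], rule dj[OF ed(1) d'(1)], rule dj[OF e'(1) ed(2)], rule dj[OF e'(1) d'(1)])
      have "n = 1 \<or> n = 2 \<or> n = 3" using ed by auto
      then show ?thesis
      proof (elim disjE)
        assume "n = 1" then show ?thesis using pl_edgeI[OF sg ad[OF ed(1,2)], of "?X \<union> ?Y"] ed by auto
      next
        assume n: "n = 2"
        show ?thesis unfolding n by (rule pl2[of E e d' d, OF es(1) dd]) (use ed(1,2) d' ds in auto)
      next
        assume n: "n = 3"
        show ?thesis unfolding n by (rule pl3[of E e d' e' d, OF es(1,3,2)]) (use ed(1,2) d' e' ds in auto)
      qed
    qed
  qed (use V w0 ne in \<open>auto simp: C_def\<close>)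
qed

text \<open>A vertex outside sees at most one vertex of the triangle, as two would give the
  configuration of \<open>no_K4m\<close>. So contraction loses nothing, and the lengths 1 and 2
  within the triangle suffice.\<close>

lemma no_tri:
  assumes "a \<in> V" "b \<in> V" "c \<in> V" "E a b" "E b c" "E a c"
  shows False
proof -
  let ?H = "{a,b,c}"
  have ne: "a \<noteq> b" "b \<noteq> c" "a \<noteq> c" using assms irr by auto
  have adj: "E u v" if "u \<in> ?H" "v \<in> ?H" "u \<noteq> v" for u v using that assms sym by auto
  obtain w0 where w0: "w0 \<in> V - ?H" using outside[of ?H a] assms ne by auto
  define C where "C = compo E (V - ?H) w0"
  have CS: "C \<subseteq> V - ?H" "w0 \<in> C" using compo_sub[of E "V - ?H" w0] compo_self[OF w0, of E] by (auto simp: C_def)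
  have nb: "v \<in> C \<or> v \<in> ?H" if "u \<in> C" "v \<in> V" "E u v" for u v
    using that compo_closed[OF sg, of u "V - ?H" w0 v] by (auto simp: C_def)
  have at: "\<exists>e\<in>?H. e \<noteq> d \<and> (\<exists>u\<in>C. E u e)" if d: "d \<in> ?H" for d
  proof (rule ccontr)
    assume n: "\<not> ?thesis"
    have cl: "clo E V C {d}" using nb n by (intro cloI) blast
    obtain e where e: "e \<in> ?H" "e \<noteq> d" using d ne by auto
    show False by (rule con2_bd[OF sg c2 _ _ cl, of e]) (use CS e d assms in auto)
  qed
  obtain e1 where e1: "e1 \<in> ?H" "\<exists>u\<in>C. E u e1" using at[of a] by blast
  obtain e2 where e2: "e2 \<in> ?H" "e2 \<noteq> e1" "\<exists>u\<in>C. E u e2" using at[OF e1(1)] by blast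
  let ?Y = "?H - {e1}"
  have XY: "{e1} \<union> ?Y = ?H" using e1 by auto
  show False
  proof (rule top_core[of "{e1}" ?Y C w0 0 2])
    show "C = compo E (V - ({e1} \<union> ?Y)) w0" unfolding XY by (simp add: C_def)
    show "w0 \<in> V - ({e1} \<union> ?Y)" unfolding XY by (rule w0)
    show "card {u\<in>{e1} \<union> ?Y. E w u} \<le> 0 + (if \<exists>e\<in>{e1}. E w e then 1 else 0) + (if \<exists>e\<in>?Y. E w e then 1 else 0)"
      if w: "w \<in> C" for w
    proof (cases "\<exists>e\<in>?H. E w e")
      case True
      then obtain e where e: "e \<in> ?H" "E w e" by blast
      have "{u\<in>?H. E w u} \<subseteq> {e}"
      proof
        fix u assume u: "u \<in> {u\<in>?H. E w u}"
        show "u \<in> {e}"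
        proof (rule ccontr)
          assume ue: "u \<notin> {e}"
          obtain v where v: "v \<in> ?H" "v \<noteq> u" "v \<noteq> e" using u e ue ne by auto
          have "E v e" "E v u" "E e u" using adj v u e ue by auto
          moreover have "w \<in> V" "w \<noteq> v" using w CS v by auto
          moreover have "v \<in> V" "e \<in> V" "u \<in> V" using v e u assms by auto
          ultimately show False using no_K4m[of w v e u] e u by blast
        qed
      qed
      then have "card {u\<in>?H. E w u} \<le> card {e}" by (rule card_mono[rotated]) simp
      moreover have "e = e1 \<or> e \<in> ?Y" using e by auto
      ultimately show ?thesis unfolding XY using e by auto
    next
      case False
      then have "{u\<in>?H. E w u} = {}" by blast
      then have "card {u\<in>?H. E w u} = 0" by (metis card.empty)
      then show ?thesis unfolding XY by linarith
    qed
    show "pl E ({e1} \<union> ?Y) e d n" if ed: "e \<in> {e1}" "d \<in> ?Y" "1 \<le> n" "n \<le> 2" for e d n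
    proof -
      have d: "d \<in> ?H" "d \<noteq> e1" "e = e1" using ed by auto
      obtain u where u: "u \<in> ?H" "u \<noteq> d" "u \<noteq> e1" using d e1(1) ne by auto
      have "n = 1 \<or> n = 2" using ed by auto
      then show ?thesis unfolding XY
      proof
        assume n: "n = 1"
        then show "pl E ?H e d n" using pl_edgeI[OF sg adj[OF e1(1) d(1)], of ?H] d e1 by auto
      next
        assume n: "n = 2"
        show "pl E ?H e d n" unfolding n d(3) by (rule pl2[of E e1 u d, OF adj[OF e1(1) u(1)] adj[OF u(1) d(1)]]) (use d u e1(1) in auto)
      qed
    qed
  qed (use assms e1 e2 in auto)
qed

end

section \<open>A shortest odd cycle\<close>

lemma cset_lobe:
  assumes "sgr E" "cset E C y" "clo E C D {v}" "v \<in> C" "v \<notin> D"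
  shows "cset E (C - D) v"
  unfolding cset_def
proof (intro conjI allI impI)
  show "v \<in> C - D" using assms by auto
  fix L assume L: "L \<noteq> {}" "L \<subseteq> C - D - {v}"
  obtain a b where ab: "a \<in> L" "b \<in> C - L" "E a b"
    using csetD[OF cset_any[OF assms(1,2,4)], of L] L by auto
  have "b \<notin> D" using cloD[OF assms(3), of b a] sgr_sym[OF assms(1) ab(3)] ab L by auto
  then show "\<exists>a\<in>L. \<exists>b\<in>C - D - L. E a b" using ab by blast
qed

lemma cycf_con:
  assumes "sgr E" "cycf E f g" "a \<in> range f" "b \<in> range f" "a \<noteq> s" "b \<noteq> s"
  shows "con E (range f - {s}) a b"
proof -
  have main: "con E (range f - {s}) a b" if s: "s \<in> range f" "a \<noteq> s" "b \<noteq> s" for s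
  proof -
    obtain i where i: "s = f i" using s by blast
    have rg: "range f = f ` {i..<i + g}" by (rule cycf_range[OF assms(2)])
    have "a \<in> f ` {i..<i + g}" using assms(3) unfolding rg .
    then obtain p where p0: "a = f p" "i \<le> p" "p < i + g" by auto
    then have "i \<noteq> p" using s(2) i by blast
    with p0 have p: "a = f p" "i < p" "p < i + g" by auto
    have "b \<in> f ` {i..<i + g}" using assms(4) unfolding rg .
    then obtain q where q0: "b = f q" "i \<le> q" "q < i + g" by auto
    then have "i \<noteq> q" using s(3) i by blast
    with q0 have q: "b = f q" "i < q" "q < i + g" by auto
    have arc: "con E (range f - {s}) (f p) (f q)" if pq: "p \<le> q" "i < p" "q < i + g" for p q
    proof -
      have pl: "pl E (f ` {p..q}) (f p) (f q) (q - p)" by (rule cycf_arc[OF assms(2)]) (use pq in auto)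
      have "f ` {p..q} \<subseteq> range f - {s}"
      proof
        fix u assume "u \<in> f ` {p..q}"
        then obtain j where j: "u = f j" "p \<le> j" "j \<le> q" by auto
        have "f j \<noteq> f i"
        proof
          assume "f j = f i"
          then have "j = i" by (rule inj_onD[OF cycf_inj[OF assms(2), of i]]) (use j pq in auto)
          then show False using j pq by simp
        qed
        then show "u \<in> range f - {s}" using j i by auto
      qed
      then have "pl E (range f - {s}) (f p) (f q) (q - p)" by (rule pl_mono[OF pl])
      then show ?thesis by (auto simp: con_pl)
    qed
    show ?thesis
    proof (cases "p \<le> q")
      case True then show ?thesis using arc[of p q] p q by simp
    next
      case False then show ?thesis using con_sym[OF assms(1) arc[of q p]] p q by simp
    qed
  qed
  show ?thesis
  proof (cases "s \<in> range f")
    case True then show ?thesis using main assms by blast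
  next
    case False
    have "\<not> range f \<subseteq> {a,b}"
    proof
      assume "range f \<subseteq> {a,b}"
      then have "card (range f) \<le> card {a,b}" by (rule card_mono[rotated]) simp
      also have "\<dots> \<le> 2" by (simp add: card_insert_if)
      finally show False using cycf_card[OF assms(2)] assms(2) by (simp add: cycf_def)
    qed
    then obtain s' where "s' \<in> range f" "a \<noteq> s'" "b \<noteq> s'" by blast
    then have "con E (range f - {s'}) a b" by (rule main)
    then show ?thesis by (rule con_mono) (use False in auto)
  qed
qed

locale cex_odd = cex +
  fixes f g h
  assumes cf: "cycf E f g" and gh: "g = 2 * h + 1" and fV: "range f \<subseteq> V"
    and mn: "\<And>n. odd n \<Longrightarrow> cy E V n \<Longrightarrow> g \<le> n"
begin

abbreviation "O1 \<equiv> range f"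

lemma og: "odd g" using gh by simp

lemma per: "f (i + g) = f i" and stp: "E (f i) (f (Suc i))"
  using cf unfolding cycf_def by blast+

lemma g5: "5 \<le> g"
proof (rule ccontr)
  assume "\<not> 5 \<le> g"
  moreover have "3 \<le> g" using cf by (simp add: cycf_def)
  ultimately have g: "g = 3" using gh by auto
  have "E (f 0) (f 1)" "E (f 1) (f 2)" "E (f 2) (f 3)" using stp[of 0] stp[of 1] stp[of 2] by (simp_all add: numeral_2_eq_2 numeral_3_eq_3)
  moreover have "f 3 = f 0" using per[of 0] g by simp
  ultimately show False using no_tri[of "f 0" "f 1" "f 2"] fV sym by (metis rangeI subsetD)
qed

lemma rot: "cex_odd E V m (\<lambda>i. f (i + r)) g h"
proof (intro cex_odd.intro cex_odd_axioms.intro)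
  show "cex E V m" by (rule cex_axioms)
  show "cycf E (\<lambda>i. f (i + r)) g" by (rule cycf_shift[OF cf])
  show "range (\<lambda>i. f (i + r)) \<subseteq> V" using cycf_shift_range[OF cf] fV by simp
qed (use gh mn in auto)

lemma f_neq: "i < j \<Longrightarrow> j < i + g \<Longrightarrow> f i \<noteq> f j"
  using cycf_inj[OF cf, of i] by (auto dest!: inj_onD[where x=i and y=j])

text \<open>The odd one of the two arcs closes through \<open>w\<close> to an odd cycle, which is
  not shorter than \<open>g\<close>; so the other arc has length at most 2 and, being even, exactly
  2.\<close>

lemma two_nbrs:
  assumes "w \<in> V" "w \<notin> O1" "E w (f i)" "E w (f j)" "i < j" "j < i + g"
  shows "j = i + 2 \<or> j + 2 = i + g"
proof -
  have p: "pl E {f i, w, f j} (f i) (f j) 2"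
    by (rule pl2[of E "f i" w "f j"]) (use assms sym f_neq[OF assms(5,6)] in auto)
  show ?thesis
  proof (cases "odd (j - i)")
    case True
    have "cy E V (j - i + 2)"
      by (rule cyI[OF sg cycf_arc[OF cf] p]) (use assms fV f_neq[OF assms(5,6)] in auto)
    then have "g \<le> j - i + 2" using mn[of "j - i + 2"] True by simp
    moreover have "j - i \<noteq> g - 1"
    proof
      assume "j - i = g - 1"
      then have "j - i = 2 * h" using gh by simp
      then show False using True by simp
    qed
    ultimately show ?thesis using assms(5,6) by auto
  next
    case False
    have "(i + g - j) + (j - i) = g" using assms by simp
    then have "odd (i + g - j)" using False og by (metis even_add)
    have "cy E V (i + g - j + 2)"
      by (rule cyI[OF sg cycf_arc2[OF sg cf assms(5,6)] p]) (use assms fV f_neq[OF assms(5,6)] in auto)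
    then have "g \<le> i + g - j + 2" using mn[of "i + g - j + 2"] \<open>odd (i + g - j)\<close> by simp
    moreover have "j - i \<noteq> 1"
    proof
      assume "j - i = 1"
      then show False using False by simp
    qed
    ultimately show ?thesis using assms(5,6) by auto
  qed
qed

text \<open>A chord would close one of the arcs to a shorter odd cycle.\<close>

lemma chord:
  assumes "E (f i) (f j)" "i < j" "j < i + g"
  shows "j = i + 1 \<or> j + 1 = i + g"
proof (rule ccontr)
  assume n: "\<not> ?thesis"
  have p: "pl E {f i, f j} (f i) (f j) 1" by (rule pl_edge) (use assms f_neq[OF assms(2,3)] in auto)
  show False
  proof (cases "even (j - i)")
    case True
    have "cy E V (j - i + 1)"
      by (rule cyI[OF sg cycf_arc[OF cf] p]) (use assms n fV f_neq[OF assms(2,3)] in auto)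
    then have "g \<le> j - i + 1" using mn[of "j - i + 1"] True by simp
    then show False using n assms by auto
  next
    case False
    have s: "(i + g - j) + (j - i) = g" using assms by simp
    have "even (i + g - j)" using False og s by (metis even_add)
    have "cy E V (i + g - j + 1)"
      by (rule cyI[OF sg cycf_arc2[OF sg cf assms(2,3)] p]) (use assms n fV f_neq[OF assms(2,3)] in auto)
    then have "g \<le> i + g - j + 1" using mn[of "i + g - j + 1"] \<open>even (i + g - j)\<close> by simp
    then show False using n assms by auto
  qed
qed

text \<open>A third neighbour would be two steps along the cycle from both \<open>f 0\<close> and
  \<open>f 2\<close>, which forces g = 6, but \<open>g\<close> is odd.\<close>

lemma pair_only:
  assumes "w \<in> V" "w \<notin> O1" "E w (f 0)" "E w (f 2)"
  shows "{u\<in>O1. E w u} = {f 0, f 2}"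
proof -
  have "u \<in> {f 0, f 2}" if u: "u \<in> O1" "E w u" for u
  proof (rule ccontr)
    assume n: "u \<notin> {f 0, f 2}"
    obtain j where j: "u = f j" "j < g" using u(1) cycf_range[OF cf, of 0] by auto
    have j0: "j \<noteq> 0" "j \<noteq> 2" using n j by (auto intro: ccontr)
    have a: "j = 2 \<or> j + 2 = g" using two_nbrs[OF assms(1-3), of j] u j j0 by auto
    have "2 < j" using a j0 g5 by auto
    then have "j = 4 \<or> j = g" using two_nbrs[OF assms(1,2,4), of j] u j by auto
    then show False using a j j0 og by auto
  qed
  then show ?thesis using assms by auto
qed

lemma nbr_cases:
  assumes "w \<in> V" "w \<notin> O1"
  shows "(\<forall>a\<in>O1. \<forall>b\<in>O1. E w a \<longrightarrow> E w b \<longrightarrow> a = b) \<or> (\<exists>r. {u\<in>O1. E w u} = {f r, f (r + 2)})"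
proof (rule disjCI)
  assume "\<not> (\<exists>r. {u\<in>O1. E w u} = {f r, f (r + 2)})"
  then have n: "{u\<in>O1. E w u} \<noteq> {f r, f (r + 2)}" for r by blast
  show "\<forall>a\<in>O1. \<forall>b\<in>O1. E w a \<longrightarrow> E w b \<longrightarrow> a = b"
  proof (intro ballI impI)
    fix a b assume ab: "a \<in> O1" "b \<in> O1" "E w a" "E w b"
    show "a = b"
    proof (rule ccontr)
      assume nab: "a \<noteq> b"
      obtain i where i: "a = f i" "i < g" using ab(1) cycf_range[OF cf, of 0] by auto
      obtain j where j: "b = f j" "j < g" using ab(2) cycf_range[OF cf, of 0] by auto
      have key: False if r: "E w (f r)" "E w (f (r + 2))" for r
      proof -
        interpret t: cex_odd E V m "\<lambda>i. f (i + r)" g h by (rule rot)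
        have "{u\<in>range (\<lambda>i. f (i + r)). E w u} = {f (0 + r), f (2 + r)}"
          by (rule t.pair_only) (use assms r cycf_shift_range[OF cf] in \<open>auto simp: add.commute\<close>)
        then have "{u\<in>O1. E w u} = {f r, f (r + 2)}" unfolding cycf_shift_range[OF cf] by (simp add: add.commute)
        then show False using n[of r] by simp
      qed
      have main: False if h: "i < j" "j < i + g" "E w (f i)" "E w (f j)" for i j
      proof -
        consider "j = i + 2" | "j + 2 = i + g" using two_nbrs[OF assms h(3,4,1,2)] by blast
        then show False
        proof cases
          case 1 then show False using key[of i] h by simp
        next
          case 2
          then have "f (j + 2) = f i" using per[of i] by simp
          then show False using key[of j] h by simp
        qed
      qed
      have "i \<noteq> j" using nab i j by auto
      then show False using main[of i j] main[of j i] ab i j by (cases "i < j") auto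
    qed
  qed
qed

lemma nbr_le2: assumes "w \<in> V" "w \<notin> O1" shows "card {u\<in>O1. E w u} \<le> 2"
  using nbr_cases[OF assms]
proof
  assume a: "\<forall>a\<in>O1. \<forall>b\<in>O1. E w a \<longrightarrow> E w b \<longrightarrow> a = b"
  have "finite {u\<in>O1. E w u}" using cycf_card(2)[OF cf] by simp
  then have "card {u\<in>O1. E w u} \<le> Suc 0" using a by (simp only: card_le_Suc0_iff_eq) blast
  then show ?thesis by simp
next
  assume "\<exists>r. {u\<in>O1. E w u} = {f r, f (r + 2)}"
  then obtain r where "{u\<in>O1. E w u} = {f r, f (r + 2)}" by blast
  then show ?thesis by (simp add: card_insert_if)
qed

text \<open>The cycle has no chords, while every degree is at least 4.\<close>

lemma out_nbr: assumes e: "e \<in> O1" shows "\<exists>a\<in>V - O1. E e a"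
proof (rule ccontr)
  assume n: "\<not> ?thesis"
  obtain i where i: "e = f i" using e by blast
  have "{u\<in>V. E e u} \<subseteq> {f (i + 1), f (i + (g - 1))}"
  proof
    fix u assume "u \<in> {u\<in>V. E e u}"
    then have u: "u \<in> V" "E e u" by auto
    then have "u \<in> O1" using n by blast
    then obtain j where j: "u = f j" "i \<le> j" "j < i + g" using cycf_range[OF cf, of i] by auto
    have "i \<noteq> j" using u j i irr by auto
    then have "j = i + 1 \<or> j + 1 = i + g" using chord[of i j] u j i by auto
    then have "j = i + 1 \<or> j = i + (g - 1)" using g5 by arith
    then show "u \<in> {f (i + 1), f (i + (g - 1))}" using j by auto
  qed
  then have "card {u\<in>V. E e u} \<le> card {f (i + 1), f (i + (g - 1))}" by (rule card_mono[rotated]) simp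
  also have "\<dots> \<le> 2" by (simp add: card_insert_if)
  finally show False using deg[of e] e fV m2 by auto
qed

end

section \<open>Components outside a shortest odd cycle, for \<open>m\<close> at least 3\<close>

locale cex_comp = cex_odd +
  fixes C w0
  assumes Cd: "C = compo E (V - range f) w0" and w0: "w0 \<in> V - range f" and m3: "3 \<le> m"
begin

lemma CS: "C \<subseteq> V - O1" "w0 \<in> C" "cset E C w0" "finite C"
proof -
  show C: "C \<subseteq> V - O1" "w0 \<in> C" "cset E C w0" using compo_sub[of E "V - O1" w0] compo_self[OF w0, of E] cset_compo[OF sg w0] by (auto simp: Cd)
  show "finite C" using C fin finite_subset[of C V] by auto
qed

lemma Cnb: "a \<in> C \<Longrightarrow> b \<in> V \<Longrightarrow> E a b \<Longrightarrow> b \<in> C \<or> b \<in> O1"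
  using compo_closed[OF sg, of a "V - O1" w0 b] by (auto simp: Cd)

lemma Cdeg: assumes "w \<in> C" shows "2 * m \<le> card {u\<in>C. E w u} + card {u\<in>O1. E w u}"
proof -
  have "2 * m \<le> card {u\<in>V. E w u}" using deg assms CS by auto
  also have "\<dots> \<le> card ({u\<in>C. E w u} \<union> {u\<in>O1. E w u})"
    by (rule card_mono) (use CS cycf_card[OF cf] Cnb[OF assms] in auto)
  also have "\<dots> \<le> card {u\<in>C. E w u} + card {u\<in>O1. E w u}" by (rule card_Un_le)
  finally show ?thesis .
qed

lemma Cdeg2: assumes "w \<in> C" shows "2 * m - 2 \<le> card {u\<in>C. E w u}"
  using Cdeg[OF assms] nbr_le2[of w] assms CS by auto

text \<open>As \<open>o1\<close> and \<open>o2\<close> differ, some arc between them has the parity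
  that makes all resulting cycles odd.\<close>

lemma finC:
  assumes "y \<in> C" "y' \<in> C" "y \<noteq> y'" "o1 \<in> O1" "o2 \<in> O1" "o1 \<noteq> o2" "E y o1" "E y' o2"
    and p: "\<And>i. i < m \<Longrightarrow> pl E C y y' (l + 2 * i)"
  shows False
proof -
  obtain n where n: "pl E O1 o1 o2 n" "even n = odd l" using odd_arcs[OF sg cf og assms(4-6)] by blast
  have yO: "y \<notin> O1" "y' \<notin> O1" "y \<in> V" "y' \<in> V" using assms CS by auto
  have e1: "pl E {y,o1} y o1 1" by (rule pl_edge) (use assms yO in auto)
  have e2: "pl E {o2,y'} o2 y' 1" by (rule pl_edge) (use assms yO sym in auto)
  have q: "pl E (O1 \<union> {y,y'}) y y' (n + 2)"
    by (rule pl_sandwich[OF e1 n(1) e2]) (use assms yO in auto)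
  show False
  proof (rule ng[of "l + (n + 2)"])
    show "odd (l + (n + 2))" using n(2) by auto
    fix i assume i: "i < m"
    show "cy E V (l + (n + 2) + 2 * i)"
      by (rule cyI[OF sg p[OF i] q]) (use assms yO CS fV pl_pos[OF p[OF i] assms(3)] in auto)
  qed
qed

text \<open>A nonempty set \<open>C - {v}\<close> is a lobe too; \<open>ncut\<close> will show that
  there are no others, that is, \<open>C\<close> has no cut vertex.\<close>

definition lobe :: "'a \<Rightarrow> 'a set \<Rightarrow> bool" where
  "lobe v D \<longleftrightarrow> v \<in> C \<and> D \<noteq> {} \<and> D \<subseteq> C \<and> v \<notin> D \<and> clo E C D {v}"

lemma lobeI:
  assumes "v \<in> C" "v \<notin> K" "K \<noteq> {}" "K \<subseteq> C" "clo E C K {c}"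
  obtains c' where "lobe c' K"
proof (cases "c \<in> C \<and> c \<notin> K")
  case True then show ?thesis using that[of c] assms by (auto simp: lobe_def)
next
  case False
  then have "clo E C K {v}" using assms(5) by (auto simp: clo_def)
  then show ?thesis using that[of v] assms by (auto simp: lobe_def)
qed

text \<open>Minimality of the lobe gives rooted connectivity with roots \<open>y\<close> and
  \<open>v\<close>. Each vertex has at most two neighbours on the odd cycle, so degrees of 2m - 2
  remain, enough for the rooted statement with 2(m - 1) - 1.\<close>

lemma lobe_fam:
  assumes L: "lobe v D" and mnl: "\<And>c K. lobe c K \<Longrightarrow> K \<subset> D \<Longrightarrow> False" and y: "y \<in> D"
  shows "\<exists>l. \<forall>i<m-1. pl E (insert v D) y v (l + 2 * i)"
proof (rule fam_odd)
  let ?W = "insert v D"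
  have h: "v \<in> C" "D \<subseteq> C" "v \<notin> D" "clo E C D {v}" using L by (auto simp: lobe_def)
  have yv: "y \<noteq> v" using y h by auto
  have eq: "{u\<in>?W. E w u} = {u\<in>C. E w u}" if "w \<in> D" for w
    using cloD[OF h(4) that] h by auto
  have c2': "conn2 E ?W y v"
  proof (rule conn2_cloI)
    fix K c assume K: "K \<noteq> {}" "K \<subseteq> ?W" "y \<notin> K" "v \<notin> K" "clo E ?W K {c}"
    have KD: "K \<subset> D" using K y by auto
    have cl: "clo E C K {c}"
    proof (rule cloI)
      fix a b assume ab: "a \<in> K" "b \<in> C" "E a b" "b \<notin> K"
      then have "b \<in> ?W" using cloD[OF h(4), of a b] KD by auto
      then show "b \<in> {c}" using cloD[OF K(5), of a b] ab by auto
    qed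
    obtain c' where "lobe c' K" by (rule lobeI[OF h(1) K(4,1) _ cl]) (use KD h in auto)
    then show False using mnl KD by blast
  qed
  have dg: "2 * (m - 1) - 1 + 1 \<le> card {u\<in>?W. E w u}" if "w \<in> D" for w
    using Cdeg2[of w] eq[OF that] that h m3 by auto
  have "\<not> {u\<in>?W. E y u} \<subseteq> {v}"
  proof
    assume "{u\<in>?W. E y u} \<subseteq> {v}"
    then have "card {u\<in>?W. E y u} \<le> card {v}" by (rule card_mono[rotated]) simp
    then show False using dg[OF y] m3 by simp
  qed
  then have ne: "?W - {y,v,y} \<noteq> {}" using irr by auto
  have "finite ?W" using h CS finite_subset[of D C] by auto
  then have "rooted E ?W y v y (2 * (m - 1) - 1)"
    unfolding rooted_def using sg y yv c2' ne m3 dg by auto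
  then show "fam (2 * (m - 1) - 1) (pl E ?W y v)" by (rule rooted_fam)
qed (use m3 in simp)

text \<open>Otherwise \<open>v\<close> and \<open>e\<close> would separate the lobe from the rest of
  the odd cycle.\<close>

lemma attach:
  assumes "lobe v D" "e \<in> O1" shows "\<exists>a\<in>D. \<exists>d\<in>O1. d \<noteq> e \<and> E a d"
proof (rule ccontr)
  assume n: "\<not> ?thesis"
  have h: "v \<in> C" "D \<subseteq> C" "v \<notin> D" "clo E C D {v}" "D \<noteq> {}" using assms by (auto simp: lobe_def)
  have cl: "clo E V D {v,e}"
  proof (rule cloI)
    fix a b assume ab: "a \<in> D" "b \<in> V" "E a b" "b \<notin> D"
    then have "b \<in> C \<or> b = e" using Cnb[of a b] h n by blast
    then show "b \<in> {v,e}" using cloD[OF h(4), of a b] ab by auto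
  qed
  obtain u where u: "u \<in> D" using h by blast
  obtain i where i: "e = f i" using assms by blast
  have "f i \<noteq> f (Suc i)" using stp irr by metis
  then have "f (Suc i) \<in> O1" "f (Suc i) \<noteq> e" using i by auto
  then show False using sep3[of D v e u "f (Suc i)"] cl u h CS fV assms by blast
qed

lemma min_lobe:
  assumes "lobe v0 D0" "D0 \<subseteq> R"
  obtains v D where "lobe v D" "D \<subseteq> R" "\<forall>c K. lobe c K \<longrightarrow> K \<subseteq> R \<longrightarrow> card D \<le> card K"
proof -
  define P where "P D \<longleftrightarrow> (\<exists>v. lobe v D) \<and> D \<subseteq> R" for D
  have "P D0" using assms by (auto simp: P_def)
  then obtain D where D: "P D" "\<forall>K. P K \<longrightarrow> card D \<le> card K" using ex_has_least_nat[of P D0 card] by blast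
  then show ?thesis using that unfolding P_def by blast
qed

text \<open>If a smallest lobe is not everything, a second one is disjoint from it, and \<open>m - 1\<close> lengths from each
  add up to \<open>2m - 3 \<ge> m\<close>.\<close>

lemma lobe_compl:
  assumes L: "lobe v D" and mnl: "\<And>c K. lobe c K \<Longrightarrow> card D \<le> card K"
  shows "D = C - {v}"
proof (rule ccontr)
  assume n: "\<not> ?thesis"
  have h: "v \<in> C" "D \<subseteq> C" "v \<notin> D" "clo E C D {v}" "D \<noteq> {}" using L by (auto simp: lobe_def)
  let ?R = "C - D - {v}"
  have RD: "b \<notin> D" if "a \<in> ?R" "E a b" for a b using cloD[OF h(4), of b a] sym that by blast
  have fC: "finite C" by (rule CS)
  have Rne: "?R \<noteq> {}" using n h by auto
  have "lobe v ?R" unfolding lobe_def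
  proof (intro conjI)
    show "clo E C ?R {v}" using RD by (intro cloI) blast
  qed (use h Rne in auto)
  then obtain v' D' where L': "lobe v' D'" "D' \<subseteq> ?R" and mn': "\<forall>c K. lobe c K \<longrightarrow> K \<subseteq> ?R \<longrightarrow> card D' \<le> card K"
    by (rule min_lobe[OF _ subset_refl])
  have h': "v' \<in> C" "D' \<subseteq> C" "v' \<notin> D'" "clo E C D' {v'}" "D' \<noteq> {}" using L' by (auto simp: lobe_def)
  have v'D: "v' \<notin> D"
  proof
    assume v: "v' \<in> D"
    obtain a b where ab: "a \<in> D'" "b \<in> C - D'" "E a b"
      using csetD[OF cset_any[OF sg CS(3) h'(1)] h'(5,2,3)] by blast
    have "b = v'" using cloD[OF h'(4), of a b] ab by auto
    then show False using RD[of a b] ab L'(2) v by blast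
  qed
  have c1: "cset E (C - D) v" by (rule cset_lobe[OF sg CS(3) h(4,1,3)])
  have "clo E (C - D) D' {v'}" using h'(4) by (auto simp: clo_def)
  then have c2': "cset E (C - D - D') v'" by (rule cset_lobe[OF sg c1]) (use h' v'D in auto)
  have "v \<in> C - D - D'" using h L'(2) by auto
  then have "con E (C - D - D') v v'" by (rule cset_con[OF sg c2'])
  then obtain r where r: "pl E (C - D - D') v v' r" by (auto simp: con_pl)
  obtain y' o2 where y': "y' \<in> D'" "o2 \<in> O1" "E y' o2" using attach[OF L'(1), of "f 0"] by blast
  obtain y o1 where y: "y \<in> D" "o1 \<in> O1" "o1 \<noteq> o2" "E y o1" using attach[OF L y'(2)] by blast
  have sm: False if "lobe c K" "K \<subset> D" for c K
    using mnl[OF that(1)] psubset_card_mono[OF finite_subset[OF h(2) fC] that(2)] by linarith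
  have sm': False if "lobe c K" "K \<subset> D'" for c K
  proof -
    have "card D' \<le> card K" using mn' that L'(2) by blast
    then show False using psubset_card_mono[OF finite_subset[OF h'(2) fC] that(2)] by linarith
  qed
  obtain l1 where l1: "\<forall>i<m-1. pl E (insert v D) y v (l1 + 2 * i)" using lobe_fam[OF L _ y(1)] sm by blast
  obtain l2 where l2: "\<forall>i<m-1. pl E (insert v' D') y' v' (l2 + 2 * i)" using lobe_fam[OF L'(1) _ y'(1)] sm' by blast
  show False
  proof (rule finC[of y y' o1 o2 "l1 + r + l2"])
    fix t assume t: "t < m"
    \<comment> \<open>Indices up to m - 2 are available in each lobe, and t <= m - 1 is a sum of two
      of them because m >= 3.\<close>
    define i where "i = min t (m - 2)"
    define j where "j = t - i"
    have ij: "i < m - 1" "j < m - 1" "i + j = t" using t m3 by (auto simp: i_def j_def)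
    have p1: "pl E (insert v D) y v (l1 + 2 * i)" using l1 ij by blast
    have p2: "pl E (insert v' D') v' y' (l2 + 2 * j)" using l2 ij pl_sym[OF sg] by blast
    have "pl E (C - D') y v' (l1 + 2 * i + r)"
      by (rule pl_append'[OF p1 r]) (use h L'(2) in auto)
    then show "pl E C y y' (l1 + r + l2 + 2 * t)"
      by (rule pl_append'[OF _ p2]) (use h' ij in auto)
  qed (use y y' h h' L'(2) in auto)
qed

text \<open>A smallest lobe is the complement of a single vertex, so every lobe contains all
  vertices of \<open>C\<close> but one.\<close>

lemma ncut: assumes "lobe v D" shows "D = C - {v}"
proof -
  have DC: "D \<subseteq> C" using assms by (simp add: lobe_def)
  obtain v0 D0 where L: "lobe v0 D0" and "D0 \<subseteq> C" and mn0: "\<forall>c K. lobe c K \<longrightarrow> K \<subseteq> C \<longrightarrow> card D0 \<le> card K"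
    by (rule min_lobe[OF assms DC])
  have mn1: "card D0 \<le> card K" if "lobe c K" for c K
  proof -
    have "K \<subseteq> C" using that by (simp add: lobe_def)
    then show ?thesis using mn0 that by blast
  qed
  have D0: "D0 = C - {v0}" by (rule lobe_compl[OF L mn1])
  have v0: "v0 \<in> C" using L by (simp add: lobe_def)
  have "card (C - {v0}) \<le> card D" using mn1[OF assms] D0 by simp
  then have "card (C - {v}) \<le> card D" using assms v0 by (auto simp: lobe_def)
  moreover have "D \<subseteq> C - {v}" using assms by (auto simp: lobe_def)
  ultimately show ?thesis using card_seteq[of "C - {v}" D] CS(4) by auto
qed

lemma famC:
  assumes "x \<in> C" "y \<in> C" "x \<noteq> y" shows "\<exists>l. \<forall>i<m-1. pl E C x y (l + 2 * i)"
proof -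
  have "lobe y (C - {y})" using assms by (auto simp: lobe_def clo_def)
  then have "\<exists>l. \<forall>i<m-1. pl E (insert y (C - {y})) x y (l + 2 * i)"
  proof (rule lobe_fam)
    fix c K assume K: "lobe c K" "K \<subset> C - {y}"
    have "K = C - {c}" by (rule ncut[OF K(1)])
    moreover have "c \<in> C" using K by (simp add: lobe_def)
    ultimately show False using K(2) assms by auto
  qed (use assms in auto)
  moreover have "insert y (C - {y}) = C" using assms by auto
  ultimately show ?thesis by simp
qed

text \<open>Entering the cycle from \<open>u\<close> at \<open>f 0\<close> or at \<open>f 2\<close>
  gives two paths to \<open>y\<close> whose lengths differ by 2, and the direction around the cycle
  decides their parity. With the m - 1 lengths inside \<open>C\<close> this makes m odd
  lengths.\<close>

lemma two_close:
  assumes u: "u \<in> C" "E u (f 0)" "E u (f 2)" and y: "y \<in> C" "y \<noteq> u" "E y (f j)" "2 < j" "j < g"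
  shows False
proof -
  obtain l where l: "\<forall>i<m-1. pl E C u y (l + 2 * i)" using famC[OF u(1) y(1)] y(2) by blast
  have uO: "u \<notin> O1" "y \<notin> O1" "u \<in> V" "y \<in> V" using u y CS by auto
  have ed: "pl E {u, f i} u (f i) 1" if "E u (f i)" for i by (rule pl_edge) (use that uO in auto)
  have ey: "pl E {f j, y} (f j) y 1" by (rule pl_edge) (use y uO sym in auto)
  have cl: "pl E (O1 \<union> {u,y}) u y (n + 2)" if "pl E O1 (f i) (f j) n" "E u (f i)" "f i \<noteq> f j" for i n
    by (rule pl_sandwich[OF ed[OF that(2)] that(1) ey]) (use y uO that(3) in auto)
  have fj: "f 0 \<noteq> f j" "f 2 \<noteq> f j" using f_neq[of 0 j] f_neq[of 2 j] y by auto
  have a1: "pl E O1 (f 2) (f j) (j - 2)" by (rule pl_mono[OF cycf_arc[OF cf]]) (use y in auto)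
  have a2: "pl E O1 (f 0) (f j) j" using pl_mono[OF cycf_arc[OF cf, of 0 j], of O1] y by auto
  have a3: "pl E O1 (f 0) (f j) (g - j)" using pl_mono[OF cycf_arc2[OF sg cf, of 0 j], of O1] y by auto
  have a4: "pl E O1 (f 2) (f j) (g - j + 2)"
  proof -
    have "pl E O1 (f 2) (f j) (2 + g - j)" using pl_mono[OF cycf_arc2[OF sg cf, of 2 j], of O1] y by auto
    moreover have "2 + g - j = g - j + 2" using y by linarith
    ultimately show ?thesis by simp
  qed
  have "\<exists>c. odd (l + c) \<and> pl E (O1 \<union> {u,y}) u y c \<and> pl E (O1 \<union> {u,y}) u y (c + 2)"
  proof (cases "odd (l + j)")
    case True
    have "j - 2 + 2 = j" using y by simp
    then show ?thesis using True cl[OF a1 u(3) fj(2)] cl[OF a2 u(2) fj(1)] by (intro exI[of _ j]) auto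
  next
    case False
    have "(g - j) + j = g" using y by simp
    then have "even (g - j) \<longleftrightarrow> odd j" using og by (metis even_add)
    then have "odd (l + (g - j + 2))" using False by auto
    then show ?thesis using cl[OF a3 u(2) fj(1)] cl[OF a4 u(3) fj(2)] by (intro exI[of _ "g - j + 2"]) auto
  qed
  then obtain c where c: "odd (l + c)" "pl E (O1 \<union> {u,y}) u y c" "pl E (O1 \<union> {u,y}) u y (c + 2)" by blast
  show False
  proof (rule ng[OF c(1)])
    fix i assume i: "i < m"
    have cc: "cy E V (l + 2 * i' + c')" if "i' < m - 1" "pl E (O1 \<union> {u,y}) u y c'" "odd (l + c')" for i' c'
    proof -
      have p: "pl E C u y (l + 2 * i')" using l that by blast
      have "odd ((l + 2 * i') + c')" using that(3) by simp
      then have "3 \<le> (l + 2 * i') + c'" by (rule odd_sum_ge3) (use pl_pos[OF p] pl_pos[OF that(2)] y in auto)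
      then show ?thesis by (intro cyI[OF sg p that(2)]) (use uO CS fV y in auto)
    qed
    show "cy E V (l + c + 2 * i)"
    proof (cases "i < m - 1")
      case True then show ?thesis using cc[OF True c(2,1)] by (simp add: ac_simps)
    next
      case False
      then have "i = (m - 2) + 1" "m - 2 < m - 1" using i m3 by auto
      then show ?thesis using cc[of "m - 2" "c + 2"] c by (simp add: ac_simps)
    qed
  qed
qed

text \<open>With k = 2m - 2 the second alternative of the rooted statement gives m lengths of
  difference 2, which an arc of suitable parity closes to odd cycles; so the first alternative must
  hold.\<close>

lemma pair_ap1:
  assumes ed: "e \<in> O1" "d \<in> O1" "e \<noteq> d" and at: "\<exists>a\<in>C. E a e" "\<exists>a\<in>C. E a d"
    and b: "\<And>c. c \<in> C \<Longrightarrow> C - {c} \<noteq> {} \<Longrightarrow> \<exists>a\<in>C - {c}. E a e \<or> E a d"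
    and dg: "\<And>w. w \<in> C \<Longrightarrow> card {u\<in>O1. E w u} \<le> 1 + (if E w e then 1 else 0) + (if E w d then 1 else 0)"
  shows "\<exists>l\<ge>2. \<forall>i<2*m-2. pl E (C \<union> {e,d}) e d (l + i)"
proof -
  have f: "fam (2 * m - 2) (\<lambda>n. 2 \<le> n \<and> (\<exists>e'\<in>{e}. \<exists>d'\<in>{d}. pl E (C \<union> {e',d'}) e' d' n))"
  proof (rule core_fam[OF sg CS(4,3)])
    show "\<exists>a\<in>K. \<exists>e'\<in>{e} \<union> {d}. E a e'" if "c \<in> C" "K \<noteq> {}" "K \<subseteq> C" "c \<notin> K" "clo E C K {c}" for c K
    proof -
      have "lobe c K" using that by (simp add: lobe_def)
      then have "K = C - {c}" by (rule ncut)
      then show ?thesis using b[OF that(1)] that(2) by auto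
    qed
    show "2 * m - 2 + 1 \<le> card {u\<in>C. E w u} + (if \<exists>e'\<in>{e}. E w e' then 1 else 0) + (if \<exists>e'\<in>{d}. E w e' then 1 else 0)"
      if "w \<in> C" for w using Cdeg[OF that] dg[OF that] m3 by simp
  qed (use ed at CS m3 in auto)
  show ?thesis
  proof (rule ccontr)
    assume n: "\<not> ?thesis"
    have "\<exists>l. \<forall>i\<le>m-1. pl E (C \<union> {e,d}) e d (l + 2 * i)"
    proof -
      have "(2 * m - 2) div 2 = m - 1" by simp
      moreover have "\<not> (\<forall>i<2*m-2. 2 \<le> l + i \<and> (\<exists>e'\<in>{e}. \<exists>d'\<in>{d}. pl E (C \<union> {e',d'}) e' d' (l + i)))" for l
      proof
        assume a: "\<forall>i<2*m-2. 2 \<le> l + i \<and> (\<exists>e'\<in>{e}. \<exists>d'\<in>{d}. pl E (C \<union> {e',d'}) e' d' (l + i))"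
        then have "2 \<le> l + 0" using m3 by (intro a[rule_format, THEN conjunct1]) auto
        then show False using n a by auto
      qed
      ultimately show ?thesis using f unfolding fam_def by auto
    qed
    then obtain l where l: "\<forall>i\<le>m-1. pl E (C \<union> {e,d}) e d (l + 2 * i)" by blast
    obtain n where n: "pl E O1 e d n" "even n = odd l" using odd_arcs[OF sg cf og ed] by blast
    show False
    proof (rule ng[of "l + n"])
      show o: "odd (l + n)" using n(2) by auto
      fix i assume i: "i < m"
      then have p: "pl E (C \<union> {e,d}) e d (l + 2 * i)" using l by auto
      have "odd ((l + 2 * i) + n)" using o by simp
      then have "3 \<le> (l + 2 * i) + n" by (rule odd_sum_ge3) (use pl_pos[OF p ed(3)] pl_pos[OF n(1) ed(3)] in auto)
      then show "cy E V (l + n + 2 * i)"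
        by (intro cyI[OF sg p n(1)]) (use ed CS fV in auto)
    qed
  qed
qed

lemma rotc: "cex_comp E V m (\<lambda>i. f (i + r)) g h C w0"
  by (intro cex_comp.intro rot cex_comp_axioms.intro) (use Cd w0 m3 cycf_shift_range[OF cf] in auto)

lemma single_nbr:
  assumes one: "\<And>w a b. w \<in> C \<Longrightarrow> a \<in> O1 \<Longrightarrow> b \<in> O1 \<Longrightarrow> E w a \<Longrightarrow> E w b \<Longrightarrow> a = b"
    and ed: "e \<in> O1" "d \<in> O1" "e \<noteq> d" and at: "\<exists>a\<in>C. E a e" "\<exists>a\<in>C. E a d"
  shows "\<exists>l\<ge>2. \<forall>i<2*m-2. pl E (C \<union> {e,d}) e d (l + i)"
proof (rule pair_ap1[OF ed at])
  show "\<exists>a\<in>C - {c}. E a e \<or> E a d" if "c \<in> C" for c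
  proof (rule ccontr)
    assume "\<not> ?thesis"
    then have "E c e" "E c d" using at by auto
    then show False using one[OF that ed(1,2)] ed by blast
  qed
  show "card {u\<in>O1. E w u} \<le> 1 + (if E w e then 1 else 0) + (if E w d then 1 else 0)" if "w \<in> C" for w
  proof -
    have "card {u\<in>O1. E w u} \<le> 1"
    proof (cases "\<exists>a\<in>O1. E w a")
      case True
      then obtain a where a: "a \<in> O1" "E w a" by blast
      have "card {u\<in>O1. E w u} \<le> card {a}" by (rule card_mono) (use one[OF that] a in auto)
      then show ?thesis by simp
    next
      case False
      then have "{u\<in>O1. E w u} = {}" by blast
      then have "card {u\<in>O1. E w u} = 0" by (metis card.empty)
      then show ?thesis by simp
    qed
    then show ?thesis by simp
  qed
qed

text \<open>Attachments beyond \<open>f 2\<close> are excluded by \<open>two_close\<close>, and for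
  \<open>u\<close> itself by \<open>pair_only\<close>. So for the pair \<open>f 0\<close>,
  \<open>f 2\<close> only an edge to \<open>f 1\<close> is lost, and a part behind a cut vertex
  \<open>c\<close> must be attached to the pair, since \<open>c\<close> and \<open>f 1\<close> do
  not separate the graph.\<close>

lemma confined:
  assumes u: "u \<in> C" "E u (f 0)" "E u (f 2)"
  shows "(\<forall>a\<in>C. \<forall>d\<in>O1. E a d \<longrightarrow> d \<in> {f 0, f 1, f 2}) \<and> (\<exists>l\<ge>2. \<forall>i<2*m-2. pl E (C \<union> {f 0,f 2}) (f 0) (f 2) (l + i))"
proof -
  have uV: "u \<in> V" "u \<notin> O1" using u CS by auto
  have con3: "d \<in> {f 0, f 1, f 2}" if ad: "a \<in> C" "d \<in> O1" "E a d" for a d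
  proof (rule ccontr)
    assume n: "d \<notin> {f 0, f 1, f 2}"
    obtain j where j: "d = f j" "j < g" using ad(2) cycf_range[OF cf, of 0] by auto
    have "j \<noteq> 0" "j \<noteq> 1" "j \<noteq> 2" using n j by (metis insertI1, metis insert_iff, metis insert_iff)
    then have j3: "2 < j" by linarith
    have "a \<noteq> u" using pair_only[OF uV u(2,3)] ad n by blast
    then show False using two_close[OF u ad(1) _ _ j3 j(2)] ad(3) j(1) by simp
  qed
  have f02: "f 0 \<noteq> f 2" "f 0 \<noteq> f 1" "f 1 \<noteq> f 2" using f_neq[of 0 2] f_neq[of 0 1] f_neq[of 1 2] g5 by auto
  have "\<exists>l\<ge>2. \<forall>i<2*m-2. pl E (C \<union> {f 0,f 2}) (f 0) (f 2) (l + i)"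
  proof (rule pair_ap1)
    show "\<exists>a\<in>C - {c}. E a (f 0) \<or> E a (f 2)" if c: "c \<in> C" "C - {c} \<noteq> {}" for c
    proof (rule ccontr)
      assume n: "\<not> ?thesis"
      have cl: "clo E V (C - {c}) {c, f 1}"
      proof (rule cloI)
        fix a b assume ab: "a \<in> C - {c}" "b \<in> V" "E a b" "b \<notin> C - {c}"
        then have "b = c \<or> b \<in> O1" using Cnb[of a b] by auto
        then show "b \<in> {c, f 1}" using con3[of a b] ab n by auto
      qed
      obtain v where v: "v \<in> C - {c}" using c by blast
      show False by (rule sep3[OF _ cl v, of "f 0"]) (use v CS fV c f02 in auto)
    qed
    show "card {v\<in>O1. E w v} \<le> 1 + (if E w (f 0) then 1 else 0) + (if E w (f 2) then 1 else 0)" if w: "w \<in> C" for w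
    proof -
      have "{v\<in>O1. E w v} \<subseteq> insert (f 1) ((if E w (f 0) then {f 0} else {}) \<union> (if E w (f 2) then {f 2} else {}))"
      proof
        fix v assume "v \<in> {v\<in>O1. E w v}"
        then have v: "v \<in> O1" "E w v" by auto
        then have "v \<in> {f 0, f 1, f 2}" by (rule con3[OF w])
        then show "v \<in> insert (f 1) ((if E w (f 0) then {f 0} else {}) \<union> (if E w (f 2) then {f 2} else {}))" using v by auto
      qed
      then have "card {v\<in>O1. E w v} \<le> card (insert (f 1) ((if E w (f 0) then {f 0} else {}) \<union> (if E w (f 2) then {f 2} else {})))"
        by (rule card_mono[rotated]) auto
      also have "\<dots> \<le> 1 + (if E w (f 0) then 1 else 0) + (if E w (f 2) then 1 else 0)" by (auto simp: card_insert_if)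
      finally show ?thesis .
    qed
  qed (use u f02 in auto)
  then show ?thesis using con3 by blast
qed

lemma any_fam: "\<exists>e d l. e \<in> O1 \<and> d \<in> O1 \<and> e \<noteq> d \<and> 2 \<le> l \<and> (\<forall>i<2*m-2. pl E (C \<union> {e,d}) e d (l + i))"
proof (cases "\<exists>w\<in>C. \<exists>r. {u\<in>O1. E w u} = {f r, f (r + 2)}")
  case True
  then obtain w r where w: "w \<in> C" "{u\<in>O1. E w u} = {f r, f (r + 2)}" by blast
  then have e: "E w (f r)" "E w (f (r + 2))" by auto
  interpret t: cex_comp E V m "\<lambda>i. f (i + r)" g h C w0 by (rule rotc)
  have "E w (f (0 + r))" "E w (f (2 + r))" using e by (simp_all add: add.commute)
  then have "\<exists>l\<ge>2. \<forall>i<2*m-2. pl E (C \<union> {f (0 + r), f (2 + r)}) (f (0 + r)) (f (2 + r)) (l + i)" using t.confined[OF w(1)] by blast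
  moreover have "f r \<noteq> f (r + 2)" using f_neq[of r "r + 2"] g5 by auto
  ultimately show ?thesis by (intro exI[of _ "f r"] exI[of _ "f (r + 2)"]) (auto simp: add.commute)
next
  case False
  have one: "a = b" if "w \<in> C" "a \<in> O1" "b \<in> O1" "E w a" "E w b" for w a b
    using nbr_cases[of w] False that CS by blast
  have at: "\<exists>d\<in>O1. d \<noteq> e \<and> (\<exists>a\<in>C. E a d)" if "e \<in> O1" for e
  proof -
    have "2 * m - 2 \<le> card {u\<in>C. E w0 u}" by (rule Cdeg2) (rule CS)
    then have "4 \<le> card {u\<in>C. E w0 u}" using m3 by linarith
    then have "{u\<in>C. E w0 u} \<noteq> {}" by (metis card.empty not_numeral_le_zero)
    then obtain v where v: "v \<in> C" "v \<noteq> w0" using irr by auto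
    have "lobe w0 (C - {w0})" using CS v by (auto simp: lobe_def clo_def)
    then show ?thesis using attach[OF _ that] by blast
  qed
  obtain e where e: "e \<in> O1" "\<exists>a\<in>C. E a e" using at[of "f 0"] by blast
  obtain d where d: "d \<in> O1" "d \<noteq> e" "\<exists>a\<in>C. E a d" using at[OF e(1)] by blast
  have "\<exists>l\<ge>2. \<forall>i<2*m-2. pl E (C \<union> {e,d}) e d (l + i)" by (rule single_nbr[OF one]) (use e d in auto)
  then obtain l where l: "2 \<le> l" "\<forall>i<2*m-2. pl E (C \<union> {e,d}) e d (l + i)" by blast
  show ?thesis
    by (rule exI[of _ e], rule exI[of _ d], rule exI[of _ l]) (use e(1) d(1,2) l in simp)
qed

text \<open>If the complement of the cycle were connected, every vertex of the cycle would be
  attached to it, against \<open>confined\<close>; so any two of them would give 2m - 2 consecutive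
  lengths. Between \<open>f 0\<close> and \<open>f (h - 1)\<close> the arcs have lengths h - 1 and h
  + 2, and the shifts by 0 and 3 cover 2m consecutive lengths.\<close>

lemma not_single: assumes "C = V - O1" shows False
proof -
  have at: "\<exists>a\<in>C. E a e" if e: "e \<in> O1" for e
    using out_nbr[OF e] assms sym by blast
  have one: "a = b" if w: "w \<in> C" "a \<in> O1" "b \<in> O1" "E w a" "E w b" for w a b
  proof (rule ccontr)
    assume "a \<noteq> b"
    then obtain r where "{u\<in>O1. E w u} = {f r, f (r + 2)}" using nbr_cases[of w] w CS by blast
    then have e: "E w (f (0 + r))" "E w (f (2 + r))" by (auto simp: add.commute)
    interpret t: cex_comp E V m "\<lambda>i. f (i + r)" g h C w0 by (rule rotc)
    obtain v where v: "v \<in> C" "E v (f (3 + r))" using at[of "f (3 + r)"] by blast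
    have "f (3 + r) \<in> {f (0 + r), f (1 + r), f (2 + r)}" using t.confined[OF w(1) e] v by blast
    then show False using f_neq[of r "3 + r"] f_neq[of "1 + r" "3 + r"] f_neq[of "2 + r" "3 + r"] g5 by auto
  qed
  have h2: "2 \<le> h" using g5 gh by auto
  have ne: "f 0 \<noteq> f (h - 1)" using f_neq[of 0 "h - 1"] h2 gh by auto
  obtain l where l2: "2 \<le> l" and l: "\<forall>i<2*m-2. pl E (C \<union> {f 0,f (h-1)}) (f 0) (f (h-1)) (l + i)"
  proof -
    have "\<exists>l\<ge>2. \<forall>i<2*m-2. pl E (C \<union> {f 0,f (h-1)}) (f 0) (f (h-1)) (l + i)"
      by (rule single_nbr[OF one]) (use ne at in auto)
    then show ?thesis using that by blast
  qed
  have "pl E O1 (f 0) (f (h-1)) (h - 1 - 0)" by (rule pl_mono[OF cycf_arc[OF cf]]) (use gh in auto)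
  then have a1: "pl E O1 (f 0) (f (h-1)) (h - 1)" by simp
  have a2: "pl E O1 (f 0) (f (h-1)) (h + 2)"
  proof -
    have "pl E O1 (f 0) (f (h-1)) (0 + g - (h - 1))" by (rule pl_mono[OF cycf_arc2[OF sg cf]]) (use h2 gh in auto)
    moreover have "0 + g - (h - 1) = h + 2" using h2 gh by simp
    ultimately show ?thesis by simp
  qed
  show False
  proof (rule consec[of "l + (h - 1)"])
    fix i assume i: "i < 2 * m"
    show "cy E V (l + (h - 1) + i)"
    proof (cases "i < 2 * m - 2")
      case True
      then have p: "pl E (C \<union> {f 0,f (h-1)}) (f 0) (f (h-1)) (l + i)" using l by blast
      show ?thesis by (rule cyI[OF sg p a1]) (use l2 h2 CS fV ne in auto)
    next
      case False
      then have "i - 3 < 2 * m - 2" "3 \<le> i" using i m3 by auto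
      then have p: "pl E (C \<union> {f 0,f (h-1)}) (f 0) (f (h-1)) (l + (i - 3))" using l by blast
      show ?thesis by (rule cyI[OF sg p a2]) (use l2 h2 CS fV ne \<open>3 \<le> i\<close> in auto)
    qed
  qed
qed

end

text \<open>For m >= 3 there are two components outside the cycle, each with 2m - 2 consecutive
  lengths between two cycle vertices. Disjoint paths along the cycle link them, and the sums cover
  4m - 5 >= 2m consecutive lengths.\<close>

lemma (in cex_odd) m_eq_2: "m = 2"
proof (rule ccontr)
  assume "m \<noteq> 2"
  then have m3: "3 \<le> m" using m2 by simp
  obtain w0 where w0: "w0 \<in> V - O1" using out_nbr[of "f 0"] by blast
  define C where "C = compo E (V - O1) w0"
  interpret c: cex_comp E V m f g h C w0 by unfold_locales (use w0 m3 in \<open>auto simp: C_def\<close>)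
  obtain w1 where w1: "w1 \<in> V - O1" "w1 \<notin> C" using c.not_single c.CS by blast
  define C' where "C' = compo E (V - O1) w1"
  interpret c': cex_comp E V m f g h C' w1 by unfold_locales (use w1 m3 in \<open>auto simp: C'_def\<close>)
  have dis: "C \<inter> C' = {}"
  proof (rule ccontr)
    assume "C \<inter> C' \<noteq> {}"
    then obtain u where "con E (V - O1) w0 u" "con E (V - O1) w1 u" by (auto simp: C_def C'_def compo_def)
    then have "con E (V - O1) w0 w1" using con_trans[OF sg] con_sym[OF sg] by metis
    then show False using w1 by (simp add: C_def compo_def)
  qed
  obtain e d l where e: "e \<in> O1" "d \<in> O1" "e \<noteq> d" "2 \<le> l" "\<forall>i<2*m-2. pl E (C \<union> {e,d}) e d (l + i)"
    using c.any_fam by blast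
  obtain e' d' l' where e': "e' \<in> O1" "d' \<in> O1" "e' \<noteq> d'" "2 \<le> l'" "\<forall>i<2*m-2. pl E (C' \<union> {e',d'}) e' d' (l' + i)"
    using c'.any_fam by blast
  have sep: "\<exists>a\<in>{e,d}. \<exists>b\<in>{e',d'}. con E (O1 - {s}) a b" for s
  proof -
    obtain a where a: "a \<in> {e,d}" "a \<noteq> s" using e(3) by auto
    obtain b where b: "b \<in> {e',d'}" "b \<noteq> s" using e'(3) by auto
    have "con E (O1 - {s}) a b" by (rule cycf_con[OF sg cf]) (use a b e e' in auto)
    then show ?thesis using a b by blast
  qed
  have sub: "{e,d} \<subseteq> O1" "{e',d'} \<subseteq> O1" using e e' by auto
  obtain S1 S2 a1 b1 a2 b2 where mm: "a1 \<in> {e,d}" "a2 \<in> {e,d}" "b1 \<in> {e',d'}" "b2 \<in> {e',d'}" "S1 \<inter> S2 = {}"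
    "S1 \<subseteq> O1" "S2 \<subseteq> O1" "con E S1 a1 b1" "con E S2 a2 b2" "a1 \<noteq> a2" "b1 \<noteq> b2"
    by (rule menger2[OF sg cycf_card(2)[OF cf] sub sep])
  obtain r1 where r1: "pl E S1 a1 b1 r1" using mm by (auto simp: con_pl)
  obtain r2 where r2: "pl E S2 a2 b2 r2" using mm by (auto simp: con_pl)
  have ab: "{a1,a2} = {e,d}" "{b1,b2} = {e',d'}" using mm by auto
  have q: "pl E (C \<union> {a1,a2}) a1 a2 n" if "pl E (C \<union> {e,d}) e d n" for n
    using that pl_sym[OF sg that] ab(1) by (auto simp: doubleton_eq_iff insert_commute)
  have q': "pl E (C' \<union> {b1,b2}) b1 b2 n" if "pl E (C' \<union> {e',d'}) e' d' n" for n
    using that pl_sym[OF sg that] ab(2) by (auto simp: doubleton_eq_iff insert_commute)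
  have S: "a1 \<in> S1" "b1 \<in> S1" "a2 \<in> S2" "b2 \<in> S2" using pl_in[OF r1] pl_in[OF r2] by auto
  then have SS: "a1 \<notin> S2" "b1 \<notin> S2" "a2 \<notin> S1" "b2 \<notin> S1" using mm(5) by auto
  have CO: "C \<inter> O1 = {}" "C' \<inter> O1 = {}" "C \<subseteq> V" "C' \<subseteq> V" using c.CS c'.CS by auto
  show False
  proof (rule consec[of "l + l' + r1 + r2"])
    fix t assume t: "t < 2 * m"
    define i where "i = min t (2 * m - 3)"
    define j where "j = t - i"
    have ij: "i < 2 * m - 2" "j < 2 * m - 2" "i + j = t" using t m3 by (auto simp: i_def j_def)
    have p: "pl E (C \<union> {a1,a2}) a1 a2 (l + i)" using q e(5) ij by blast
    have p': "pl E (C' \<union> {b1,b2}) b1 b2 (l' + j)" using q' e'(5) ij by blast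
    have w: "pl E (S1 \<union> (C' \<union> {b1,b2}) \<union> S2) a1 a2 (r1 + (l' + j) + r2)"
      by (rule pl_sandwich[OF r1 p' pl_sym[OF sg r2]]) (use mm(5-7) CO SS in auto)
    show "cy E V (l + l' + r1 + r2 + t)"
    proof (rule cyI[OF sg p w])
      show "(C \<union> {a1,a2}) \<inter> (S1 \<union> (C' \<union> {b1,b2}) \<union> S2) \<subseteq> {a1,a2}"
        using dis CO mm(6,7) S by blast
      show "C \<union> {a1,a2} \<union> (S1 \<union> (C' \<union> {b1,b2}) \<union> S2) \<subseteq> V" using CO mm(6,7) S fV by blast
    qed (use mm(10) e(4) e'(4) ij in auto)
  qed
qed

section \<open>Minimum degree four\<close>

lemma con_image:
  assumes "sgr E" "sgr R" "con E S u v" "\<phi> ` S \<subseteq> T" "\<And>a b. a \<in> S \<Longrightarrow> b \<in> S \<Longrightarrow> E a b \<Longrightarrow> R (\<phi> a) (\<phi> b)"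
  shows "con R T (\<phi> u) (\<phi> v)"
proof (rule ccontr)
  assume n: "\<not> ?thesis"
  define W where "W = {a. \<phi> a \<in> compo R T (\<phi> u)}"
  have "u \<in> S" using con_in[OF assms(3)] by simp
  then have uT: "\<phi> u \<in> T" using assms(4) by auto
  have uW: "u \<in> W" using compo_self[OF uT, of R] by (simp add: W_def)
  have vW: "v \<notin> W" using n by (simp add: W_def compo_def)
  obtain a b where ab: "a \<in> W" "b \<notin> W" "a \<in> S" "b \<in> S" "E a b" by (rule con_exit[OF assms(1,3) uW vW])
  have "R (\<phi> a) (\<phi> b)" "\<phi> b \<in> T" using assms(4,5) ab by auto
  then show False using compo_closed[OF assms(2), of "\<phi> a" T "\<phi> u" "\<phi> b"] ab by (simp add: W_def)
qed

lemma seq_arc: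
  assumes "sgr E" "a \<le> b" "inj_on f {a..b}" "\<And>i. a \<le> i \<Longrightarrow> i < b \<Longrightarrow> E (f i) (f (Suc i))"
  shows "pl E (f ` {a..b}) (f a) (f b) (b - a)"
  using assms(2-4)
proof (induction b rule: dec_induct)
  case base then show ?case using pl_refl[of "f a" "{f a}"] by simp
next
  case (step n)
  have p: "pl E (f ` {a..n}) (f a) (f n) (n - a)"
    by (rule step.IH) (use step.prems in \<open>auto intro: inj_on_subset\<close>)
  have e: "E (f n) (f (Suc n))" using step by simp
  have q: "pl E {f n, f (Suc n)} (f n) (f (Suc n)) 1" by (rule pl_edge[of E "f n" "f (Suc n)", OF e sgr_neq[OF assms(1) e]])
  have "f (Suc n) \<notin> f ` {a..n}"
  proof
    assume "f (Suc n) \<in> f ` {a..n}"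
    then obtain i where "f (Suc n) = f i" "a \<le> i" "i \<le> n" by auto
    then have "Suc n = i" using inj_onD[OF step.prems(1), of "Suc n" i] step.hyps by auto
    then show False using \<open>i \<le> n\<close> by simp
  qed
  then show ?case by (intro pl_append'[OF p q]) (use step.hyps in auto)
qed

text \<open>The two edges from \<open>f 0\<close> give cycles of lengths i + 1, j + 1 and j - i + 2,
  which are not all odd.\<close>

lemma theta_even:
  assumes "sgr E" "inj_on f {0..j}" "\<And>i. i < j \<Longrightarrow> E (f i) (f (Suc i))" "2 \<le> i" "i < j" "E (f 0) (f i)" "E (f 0) (f j)"
  shows "\<exists>n. even n \<and> cy E (f ` {0..j}) n"
proof -
  have arc: "pl E (f ` {a..b}) (f a) (f b) (b - a)" if "a \<le> b" "b \<le> j" for a b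
    by (rule seq_arc[OF assms(1) that(1)]) (use assms(2,3) that in \<open>auto intro: inj_on_subset\<close>)
  have inj: "f a \<noteq> f b" if "a < b" "b \<le> j" for a b
    using inj_onD[OF assms(2), of a b] that by auto
  have c: "cy E (f ` {0..j}) (b + 1)" if "2 \<le> b" "b \<le> j" "E (f 0) (f b)" for b
  proof (rule cyI[OF assms(1) arc[of 0 b]])
    show "pl E {f 0, f b} (f 0) (f b) 1" by (rule pl_edge) (use that inj[of 0 b] in auto)
  qed (use that inj[of 0 b] in auto)
  have d: "cy E (f ` {0..j}) (j - i + 2)"
  proof (rule cyI[OF assms(1) arc[of i j]])
    show "pl E {f i, f 0, f j} (f i) (f j) 2"
      by (rule pl2[of E "f i" "f 0" "f j"]) (use assms inj[of 0 i] inj[of 0 j] inj[of i j] sgr_sym[OF assms(1,6)] in auto)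
    have n0: "f 0 \<notin> f ` {i..j}"
    proof
      assume "f 0 \<in> f ` {i..j}"
      then obtain a where "f 0 = f a" "i \<le> a" "a \<le> j" by auto
      then show False using inj[of 0 a] assms(4) by auto
    qed
    show "f ` {i..j} \<inter> {f i, f 0, f j} \<subseteq> {f i, f j}"
    proof
      fix x assume x: "x \<in> f ` {i..j} \<inter> {f i, f 0, f j}"
      have "x \<in> f ` {i..j}" by (rule IntD1[OF x])
      then have "x \<noteq> f 0" using n0 by metis
      then show "x \<in> {f i, f j}" using x by simp
    qed
  qed (use assms inj[of i j] in auto)
  consider "odd i" | "odd j" | "even i" "even j" by blast
  then show ?thesis
  proof cases
    case 1
    have "even (i + 1)" using 1 by simp
    then show ?thesis using c[of i] assms by (intro exI[of _ "i + 1"]) auto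
  next
    case 2
    have "even (j + 1)" using 2 by simp
    then show ?thesis using c[of j] assms by (intro exI[of _ "j + 1"]) auto
  next
    case 3
    then have "even (j - i + 2)" by simp
    then show ?thesis using d by blast
  qed
qed

lemma two_in_set:
  fixes I :: "nat set"
  assumes "finite I" "2 \<le> card I" obtains i j where "i \<in> I" "j \<in> I" "i < j"
proof -
  have "\<not> card I \<le> Suc 0" using assms(2) by simp
  then obtain a b where "a \<in> I" "b \<in> I" "a \<noteq> b" using card_le_Suc0_iff_eq[OF assms(1)] by blast
  then show ?thesis using that[of a b] that[of b a] by (meson linorder_neqE_nat)
qed

text \<open>The first vertex of a longest path has all its neighbours on the path; two of them are
  not the next vertex, so \<open>theta_even\<close> applies.\<close>

lemma even_cycle:
  assumes "sgr E" "finite S" "S \<noteq> {}" "\<And>w. w \<in> S \<Longrightarrow> 3 \<le> card {u\<in>S. E w u}"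
  shows "\<exists>n. even n \<and> cy E S n"
proof -
  define P where "P p \<longleftrightarrow> p \<noteq> [] \<and> distinct p \<and> set p \<subseteq> S \<and> successively E p" for p
  obtain s where "s \<in> S" using assms(3) by blast
  then have P0: "P [s]" by (simp add: P_def)
  have "\<forall>p. P p \<longrightarrow> length p < card S + 1"
  proof (intro allI impI)
    fix p assume "P p"
    then have "card (set p) = length p" "set p \<subseteq> S" by (auto simp: P_def distinct_card)
    then show "length p < card S + 1" using card_mono[OF assms(2), of "set p"] by simp
  qed
  then obtain p where p: "P p" and mx: "\<forall>p'. P p' \<longrightarrow> length p' \<le> length p"
    using ex_has_greatest_nat[of P "[s]" length "card S + 1"] P0 by blast
  have pf: "p \<noteq> []" "distinct p" "set p \<subseteq> S" "successively E p" using p by (auto simp: P_def)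
  define f where "f i = p ! i" for i
  have nb: "u \<in> set p" if u: "u \<in> S" "E (f 0) u" for u
  proof (rule ccontr)
    assume n: "u \<notin> set p"
    have "hd p = f 0" using pf by (simp add: f_def hd_conv_nth)
    then have "E u (hd p)" using sgr_sym[OF assms(1) u(2)] by simp
    then have "P (u # p)" using pf n u by (auto simp: P_def successively_Cons)
    then have "length (u # p) \<le> length p" using mx by blast
    then show False by simp
  qed
  define I where "I = {i. i < length p \<and> E (f 0) (f i)}"
  have fI: "finite I" by (simp add: I_def)
  have "f 0 \<in> S" using pf by (auto simp: f_def)
  then have "3 \<le> card {u\<in>S. E (f 0) u}" by (rule assms(4))
  also have "{u\<in>S. E (f 0) u} \<subseteq> f ` I"
  proof
    fix u assume "u \<in> {u\<in>S. E (f 0) u}"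
    then have u: "u \<in> set p" "E (f 0) u" using nb by auto
    then obtain i where "i < length p" "u = p ! i" by (metis in_set_conv_nth)
    then show "u \<in> f ` I" using u by (auto simp: I_def f_def)
  qed
  then have "card {u\<in>S. E (f 0) u} \<le> card (f ` I)" by (rule card_mono[OF finite_imageI[OF fI]])
  also have "\<dots> \<le> card I" by (rule card_image_le[OF fI])
  finally have "2 \<le> card (I - {1})" using diff_card_le_card_Diff[of "{1}" I] by simp
  then obtain i j where ij: "i \<in> I - {1}" "j \<in> I - {1}" "i < j" by (rule two_in_set[OF finite_Diff[OF fI]])
  have "i \<noteq> 0"
  proof
    assume "i = 0"
    then show False using ij(1) sgr_irrefl[OF assms(1), of "f 0"] by (simp add: I_def)
  qed
  then have i2: "2 \<le> i" using ij by auto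
  have jl: "j < length p" using ij by (simp add: I_def)
  have "\<exists>n. even n \<and> cy E (f ` {0..j}) n"
  proof (rule theta_even[OF assms(1) _ _ i2 ij(3)])
    show "inj_on f {0..j}" using pf(2) jl by (auto simp: inj_on_def f_def nth_eq_iff_index_eq)
    show "E (f i) (f (Suc i))" if "i < j" for i using pf(4) jl that by (auto simp: f_def successively_conv_nth)
  qed (use ij in \<open>auto simp: I_def\<close>)
  moreover have "f ` {0..j} \<subseteq> S"
  proof
    fix u assume "u \<in> f ` {0..j}"
    then obtain i where "u = p ! i" "i < length p" using jl by (auto simp: f_def)
    then show "u \<in> S" using pf(3) nth_mem by blast
  qed
  ultimately show ?thesis using cy_mono[of E "f ` {0..j}" _ S] by blast
qed

text \<open>The numbers \<open>a\<close>, \<open>b\<close>, \<open>c\<close> are the lengths of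
  three legs from a common centre, the first vertex of a path from \<open>u1\<close> to
  \<open>u2\<close> that is met from \<open>u3\<close>. They will be compared by parity.\<close>

lemma tripod:
  assumes "sgr E" "cset E B b0" "u1 \<in> B" "u2 \<in> B" "u3 \<in> B"
  shows "\<exists>a b c. pl E B u1 u2 (a + b) \<and> pl E B u1 u3 (a + c) \<and> pl E B u2 u3 (b + c)"
proof -
  have "con E B u1 u2" by (rule cset_con[OF assms(1) cset_any[OF assms(1,2,4)] assms(3)])
  then obtain p where p: "pth E B u1 p u2" by (auto simp: con_def)
  have u1p: "u1 \<in> set p" using p by (auto simp: pth_def)
  have "con E B u3 u1" by (rule cset_con[OF assms(1) cset_any[OF assms(1,2,3)] assms(5)])
  then obtain w where w: "w \<in> set p" "con E (B - (set p - {w})) u3 w" using first_hit[OF _ u1p] by metis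
  obtain p1 p2 where s: "p = p1 @ w # p2" "pth E B u1 (p1 @ [w]) w" "pth E B w (w # p2) u2"
    by (rule pth_split[OF p w(1)])
  obtain c where c: "pl E (B - (set p - {w})) w u3 c" using con_sym[OF assms(1) w(2)] by (auto simp: con_pl)
  have pB: "set p \<subseteq> B" using p by (simp add: pth_def)
  have a: "pl E (set (p1 @ [w])) u1 w (length p1)" unfolding pl_def
    by (rule exI[of _ "p1 @ [w]"]) (use s(2) in \<open>auto simp: pth_def\<close>)
  have b: "pl E (set (w # p2)) w u2 (length p2)" unfolding pl_def
    by (rule exI[of _ "w # p2"]) (use s(3) in \<open>auto simp: pth_def\<close>)
  have dis: "distinct (p1 @ w # p2)" using p s(1) by (simp add: pth_def)
  have "pl E B u1 u2 (length p1 + length p2)"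
    by (rule pl_append'[OF a b]) (use dis pB s(1) in auto)
  moreover have "pl E B u1 u3 (length p1 + c)"
    by (rule pl_append'[OF a c]) (use dis pB s(1) in auto)
  moreover have "pl E B u2 u3 (length p2 + c)"
    by (rule pl_append'[OF pl_sym[OF assms(1) b] c]) (use dis pB s(1) in auto)
  ultimately show ?thesis by blast
qed

section \<open>4-cycles and even cycles in a counterexample with \<open>m = 2\<close>\<close>

context cex
begin

lemma con3:
  assumes "u \<in> V - {p,q}" "v \<in> V - {p,q}" shows "con E (V - {p,q}) u v"
proof (rule ccontr)
  assume n: "\<not> ?thesis"
  then obtain R where R: "u \<in> R" "R \<subseteq> V - {p,q}" "v \<notin> R" "\<forall>a\<in>R. \<forall>b\<in>V - {p,q}. E a b \<longrightarrow> b \<in> R"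
    using con_or_sep[OF sg assms(1), of v] by blast
  have "clo E V R {p,q}" using R by (intro cloI) blast
  then show False using sep3[of R p q u v] R assms by blast
qed

text \<open>An edge of a 2-connected non-bipartite graph lies on an odd cycle. Applied to the edge obtained by
  contracting both sides of the 4-cycle, this gives a path of even length, which closes through the 4-cycle by
  paths of length 1 and 3.\<close>

lemma no_C4:
  assumes "m = 2" "a \<in> V" "a' \<in> V" "t \<in> V" "t' \<in> V" "a \<noteq> a'" "t \<noteq> t'" "E a t" "E a t'" "E a' t" "E a' t'"
  shows False
proof -
  let ?X = "{a,a'}" and ?Y = "{t,t'}"
  have aa: "\<not> E a a'" "\<not> E a' a" using no_tri[of a a' t] no_tri[of a' a t] assms by blast+
  have tt: "\<not> E t t'" "\<not> E t' t" using no_tri[of a t t'] no_tri[of a t' t] assms by blast+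
  have XY: "?X \<inter> ?Y = {}" using assms irr by auto
  define C where "C = V - ?X - ?Y"
  have C: "a \<notin> C" "t \<notin> C" "a \<noteq> t" "?X \<inter> C = {}" "?Y \<inter> C = {}" using XY by (auto simp: C_def)
  \<comment> \<open>The edge between the contracted vertices, missing in \<open>ctr2\<close>, is
    added here; it stands for the edges of the 4-cycle.\<close>
  define R where "R u v \<longleftrightarrow> ctr2 E a ?X t ?Y C u v \<or> {u,v} = {a,t}" for u v
  let ?W = "C \<union> {a,t}"
  note cs = ctr2_simps[OF C(1-3), where E=E and X="?X" and Y="?Y"]
  have sR: "sgr R" using sgr_ctr2[OF sg C(1,2), of ?X ?Y] C(3) unfolding sgr_def R_def by (metis doubleton_eq_iff)
  have RC: "R u v \<longleftrightarrow> ctr2 E a ?X t ?Y C u v" if "u \<in> C \<or> v \<in> C" for u v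
    using that C by (auto simp: R_def doubleton_eq_iff)
  \<comment> \<open>The contraction map; it preserves edges because, without triangles, neither of
    the two contracted pairs is an edge.\<close>
  define \<phi> where "\<phi> v = (if v \<in> ?X then a else if v \<in> ?Y then t else v)" for v
  have \<phi>: "v \<in> ?X \<Longrightarrow> \<phi> v = a" "v \<in> ?Y \<Longrightarrow> \<phi> v = t" "v \<in> C \<Longrightarrow> \<phi> v = v" for v
    using XY by (auto simp: \<phi>_def C_def)
  have Vc: "v \<in> C \<or> v \<in> ?X \<or> v \<in> ?Y" if "v \<in> V" for v using that by (auto simp: C_def)
  have Rat: "R a t" "R t a" by (auto simp: R_def)
  have hom: "R (\<phi> u) (\<phi> v)" if uv: "u \<in> V" "v \<in> V" "E u v" for u v
  proof -
    have main: "R (\<phi> u) (\<phi> v)" if that: "u \<in> C" "v \<in> V" "E u v" for u v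
    proof -
      note vV = that(2)
      consider "v \<in> C" | "v \<in> ?X" | "v \<in> ?Y" using Vc[OF vV] by blast
      then show ?thesis
      proof cases
        case 1 then show ?thesis using \<phi>(3) RC[of u v] cs(1)[of u v] that by auto
      next
        case 2
        then have "\<phi> v = a" "\<phi> u = u" using \<phi> that by auto
        moreover have "R u a" using RC[of u a] cs(3)[of u] that 2 by blast
        ultimately show ?thesis by simp
      next
        case 3
        then have "\<phi> v = t" "\<phi> u = u" using \<phi> that by auto
        moreover have "R u t" using RC[of u t] cs(5)[of u] that 3 by blast
        ultimately show ?thesis by simp
      qed
    qed
    show ?thesis
    proof (cases "u \<in> C")
      case True then show ?thesis using main uv by blast
    next
      case u: False
      show ?thesis
      proof (cases "v \<in> C")
        case True
        have "R (\<phi> v) (\<phi> u)" using main[OF True uv(1)] sym[OF uv(3)] by blast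
        then show ?thesis using sgr_sym[OF sR] by blast
      next
        case False
        have "\<not> (u \<in> ?X \<and> v \<in> ?X)" "\<not> (u \<in> ?Y \<and> v \<in> ?Y)" using uv aa tt irr by auto
        then have "u \<in> ?X \<and> v \<in> ?Y \<or> u \<in> ?Y \<and> v \<in> ?X" using Vc uv u False by blast
        then show ?thesis using \<phi>(1,2) Rat by (elim disjE conjE) simp_all
      qed
    qed
  qed
  have im: "\<phi> v \<in> ?W" if v: "v \<in> V" for v
    using Vc[OF v]
  proof (elim disjE)
    assume "v \<in> C" then show ?thesis using \<phi>(3)[of v] by simp
  next
    assume "v \<in> ?X" then show ?thesis using \<phi>(1)[of v] by simp
  next
    assume "v \<in> ?Y" then show ?thesis using \<phi>(2)[of v] by simp
  qed
  have nbR: "\<not> bip R ?W"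
  proof
    assume "bip R ?W"
    then obtain A where A: "\<forall>u\<in>?W. \<forall>v\<in>?W. R u v \<longrightarrow> (u \<in> A \<longleftrightarrow> v \<notin> A)" unfolding bip_def by blast
    have "bip E V" unfolding bip_def
    proof (rule exI[of _ "{v. \<phi> v \<in> A}"], intro ballI impI)
      fix u v assume "u \<in> V" "v \<in> V" "E u v"
      then have "\<phi> u \<in> A \<longleftrightarrow> \<phi> v \<notin> A" using A[rule_format, OF im im hom] by blast
      then show "u \<in> {v. \<phi> v \<in> A} \<longleftrightarrow> v \<notin> {v. \<phi> v \<in> A}" by simp
    qed
    then show False using nb by blast
  qed
  \<comment> \<open>Deleting a contracted vertex means deleting two vertices of the graph, so
    3-connectivity is what is needed.\<close>
  have c2R: "con2 R ?W" unfolding con2_def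
  proof (intro allI ballI)
    fix s u v assume uv: "u \<in> ?W - {s}" "v \<in> ?W - {s}"
    have WV: "?W \<subseteq> V" using assms by (auto simp: C_def)
    have \<phi>W: "\<phi> w = w" if wW: "w \<in> ?W" for w
    proof -
      consider "w \<in> C" | "w = a" | "w = t" using wW by blast
      then show ?thesis using \<phi>(3)[of w] \<phi>(1)[of a] \<phi>(2)[of t] by cases simp_all
    qed
    have go: "con R (?W - {s}) u v" if S: "con E S u v" "S \<subseteq> V" "\<phi> ` S \<subseteq> ?W - {s}" for S
    proof -
      have "con R (?W - {s}) (\<phi> u) (\<phi> v)" by (rule con_image[OF sg sR S(1,3)]) (use hom S(2) in blast)
      then show ?thesis using \<phi>W uv by simp
    qed
    consider "s = a" | "s = t" | "s \<noteq> a" "s \<noteq> t" by blast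
    then show "con R (?W - {s}) u v"
    proof cases
      case 1
      have "con E (V - ?X) u v" by (rule con3) (use uv 1 WV C XY in auto)
      moreover have "\<phi> ` (V - ?X) \<subseteq> ?W - {s}"
      proof
        fix x assume "x \<in> \<phi> ` (V - ?X)"
        then obtain w where w: "x = \<phi> w" "w \<in> V" "w \<notin> ?X" by blast
        then have "w \<in> C \<or> w \<in> ?Y" using Vc by blast
        then have "x \<noteq> a" using \<phi>(3)[of w] \<phi>(2)[of w] w(1) C(1-3) by (elim disjE) auto
        then show "x \<in> ?W - {s}" using im[OF w(2)] w(1) 1 by simp
      qed
      ultimately show ?thesis using go[of "V - ?X"] by blast
    next
      case 2
      have "con E (V - ?Y) u v" by (rule con3) (use uv 2 WV C XY in auto)
      moreover have "\<phi> ` (V - ?Y) \<subseteq> ?W - {s}"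
      proof
        fix x assume "x \<in> \<phi> ` (V - ?Y)"
        then obtain w where w: "x = \<phi> w" "w \<in> V" "w \<notin> ?Y" by blast
        then have "w \<in> C \<or> w \<in> ?X" using Vc by blast
        then have "x \<noteq> t" using \<phi>(3)[of w] \<phi>(1)[of w] w(1) C(1-3) by (elim disjE) auto
        then show "x \<in> ?W - {s}" using im[OF w(2)] w(1) 2 by simp
      qed
      ultimately show ?thesis using go[of "V - ?Y"] by blast
    next
      case 3
      have "con E (V - {s}) u v" by (rule con2D[OF c2]) (use uv WV in auto)
      moreover have "\<phi> ` (V - {s}) \<subseteq> ?W - {s}"
      proof
        fix x assume "x \<in> \<phi> ` (V - {s})"
        then obtain w where w: "x = \<phi> w" "w \<in> V" "w \<noteq> s" by blast
        have "x = w \<or> x = a \<or> x = t" using Vc[OF w(2)] \<phi>(1-3)[of w] w(1) by blast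
        then have "x \<noteq> s" using w(3) 3 by blast
        then show "x \<in> ?W - {s}" using im[OF w(2)] w(1) by simp
      qed
      ultimately show ?thesis using go[of "V - {s}"] by blast
    qed
  qed
  have fW: "finite ?W" using fin by (simp add: C_def)
  obtain n where n: "pl R ?W a t n" "even n" using both_parity[OF sR fW c2R nbR, of a t True] C by auto
  have "1 \<le> n" by (rule pl_pos[OF n(1) C(3)])
  \<comment> \<open>A path of even length is not the added edge itself, so it can be lifted.\<close>
  then have n2: "2 \<le> n" using n(2) by (cases "n = 1") auto
  have "\<exists>e\<in>?X. \<exists>d\<in>?Y. pl E (C \<union> {e,d}) e d n"
  proof (rule lift2[OF sg C(3,1,2,4,5) XY, where R = R])
    show "\<exists>e\<in>?X. E e b" if "b \<in> C" "R a b" for b using RC[of a b] cs(2)[OF that(1)] that sym by blast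
    show "\<exists>e\<in>?Y. E b e" if "b \<in> C" "R b t" for b using RC[of b t] cs(5)[OF that(1)] that by blast
    show "E b c" if "b \<in> C" "c \<in> C" "R b c" for b c using RC[of b c] cs(1)[OF that(1,2)] that by blast
  qed (use n n2 in auto)
  then obtain e d where ed: "e \<in> ?X" "d \<in> ?Y" "pl E (C \<union> {e,d}) e d n" by blast
  obtain e' where e': "e' \<in> ?X" "e' \<noteq> e" using ed(1) assms(6) by auto
  obtain d' where d': "d' \<in> ?Y" "d' \<noteq> d" using ed(2) assms(7) by auto
  have ad: "E p q" if "p \<in> ?X" "q \<in> ?Y" for p q using that assms(8-11) by auto
  have dj: "p \<noteq> q" if "p \<in> ?X" "q \<in> ?Y" for p q using that XY by auto
  have p1: "pl E {e,d} e d 1" by (rule pl_edge[of E e d, OF ad[OF ed(1,2)] dj[OF ed(1,2)]])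
  have p3: "pl E (?X \<union> ?Y) e d 3"
    by (rule pl3[of E e d' e' d, OF ad[OF ed(1) d'(1)] sym[OF ad[OF e'(1) d'(1)]] ad[OF e'(1) ed(2)]])
      (use ed(1,2) e' d' dj[OF ed(1,2)] dj[OF ed(1) d'(1)] dj[OF e'(1) ed(2)] dj[OF e'(1) d'(1)] in auto)
  have XV: "?X \<union> ?Y \<subseteq> V" "C \<subseteq> V" using assms by (auto simp: C_def)
  have edV: "e \<in> V" "d \<in> V" using ed XV by auto
  have c1: "cy E V (n + 1)" by (rule cyI[OF sg ed(3) p1]) (use n2 XV edV dj[OF ed(1,2)] in auto)
  have c3: "cy E V (n + 3)" by (rule cyI[OF sg ed(3) p3]) (use n2 XV edV dj[OF ed(1,2)] C in auto)
  show False
  proof (rule ng[of "n + 1"])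
    show "odd (n + 1)" using n by simp
    fix i assume "i < m"
    then have "i = 0 \<or> i = 1" using assms(1) by auto
    then show "cy E V (n + 1 + 2 * i)" using c1 c3 by (elim disjE) (simp_all add: numeral_3_eq_3)
  qed
qed

text \<open>The candidates from which one with largest \<open>C\<close> will be chosen;
  \<open>w0\<close> is a base point of the component.\<close>

definition evq :: "'a set \<Rightarrow> (nat \<Rightarrow> 'a) \<Rightarrow> nat \<Rightarrow> 'a \<Rightarrow> bool" where
  "evq C q n w0 \<longleftrightarrow> cycf E q n \<and> even n \<and> range q \<subseteq> V \<and> w0 \<in> V - range q \<and> C = compo E (V - range q) w0 \<and>
     (\<exists>j. odd j \<and> cy E C j)"

end

text \<open>A vertex outside the shortest odd cycle has at most one neighbour on it, since two would
  lie on a 4-cycle. At least three neighbours remain outside, where \<open>even_cycle\<close> finds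
  an even cycle disjoint from the odd one.\<close>

lemma (in cex_odd) ex_evq: "\<exists>C q n w0. evq C q n w0"
proof -
  have m: "m = 2" by (rule m_eq_2)
  let ?S = "V - O1"
  have "3 \<le> card {u\<in>?S. E w u}" if w: "w \<in> ?S" for w
  proof -
    have "card {u\<in>O1. E w u} \<le> Suc 0"
    proof -
      have "\<forall>a\<in>O1. \<forall>b\<in>O1. E w a \<longrightarrow> E w b \<longrightarrow> a = b"
      proof (rule ccontr)
        assume "\<not> ?thesis"
        then obtain r where "{u\<in>O1. E w u} = {f r, f (r + 2)}" using nbr_cases[of w] w by blast
        then have e: "E w (f r)" "E w (f (r + 2))" by auto
        have e2: "E (f (r + 1)) (f r)" "E (f (r + 1)) (f (r + 2))" using stp[of r] stp[of "r + 1"] sym by auto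
        have "f r \<noteq> f (r + 2)" using f_neq[of r "r + 2"] g5 by auto
        moreover have "w \<noteq> f (r + 1)" using w by auto
        moreover have "f r \<in> V" "f (r + 1) \<in> V" "f (r + 2) \<in> V" using fV by auto
        ultimately show False using no_C4[OF m, of w "f (r + 1)" "f r" "f (r + 2)"] e e2 w by blast
      qed
      moreover have "finite {u\<in>O1. E w u}" using cycf_card(2)[OF cf] by simp
      ultimately show ?thesis by (simp only: card_le_Suc0_iff_eq) blast
    qed
    moreover have "2 * m \<le> card {u\<in>V. E w u}" using deg w by blast
    moreover have "card {u\<in>V. E w u} \<le> card ({u\<in>?S. E w u} \<union> {u\<in>O1. E w u})"
      by (rule card_mono) (use fin cycf_card(2)[OF cf] in auto)
    moreover have "card ({u\<in>?S. E w u} \<union> {u\<in>O1. E w u}) \<le> card {u\<in>?S. E w u} + card {u\<in>O1. E w u}" by (rule card_Un_le)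
    ultimately show ?thesis using m by linarith
  qed
  moreover have "?S \<noteq> {}" using out_nbr[of "f 0"] by auto
  ultimately obtain n where n: "even n" "cy E ?S n" using even_cycle[OF sg, of ?S] fin by blast
  obtain q where q: "cycf E q n" "range q \<subseteq> ?S" by (rule cy_cycf[OF n(2)])
  let ?C = "compo E (V - range q) (f 0)"
  have "O1 \<subseteq> ?C"
  proof
    fix u assume u: "u \<in> O1"
    obtain s where s: "s \<in> V" "s \<notin> O1" using out_nbr[of "f 0"] by blast
    have "con E (O1 - {s}) (f 0) u" by (rule cycf_con[OF sg cf]) (use u s in auto)
    then have "con E (V - range q) (f 0) u" by (rule con_mono) (use q fV in auto)
    then show "u \<in> ?C" by (simp add: compo_def)
  qed
  then have "cy E ?C g" by (rule cy_mono[OF cycf_cy[OF cf]])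
  then have "evq ?C q n (f 0)" unfolding evq_def using q n og fV by auto
  then show ?thesis by blast
qed

section \<open>An even cycle with a largest component containing an odd cycle\<close>

locale cex_even = cex +
  fixes q n C w0
  assumes ev: "evq C q n w0" and mx: "\<And>C' q' n' w'. evq C' q' n' w' \<Longrightarrow> card C' \<le> card C" and m: "m = 2"
begin

lemma qc: "cycf E q n" and en: "even n" and qV: "range q \<subseteq> V" and w0: "w0 \<in> V - range q"
  and Cd: "C = compo E (V - range q) w0" and oddC: "\<exists>j. odd j \<and> cy E C j"
  using ev by (auto simp: evq_def)

lemma CS: "C \<subseteq> V - range q" "w0 \<in> C" "cset E C w0" "finite C"
proof -
  show C: "C \<subseteq> V - range q" "w0 \<in> C" "cset E C w0" using compo_sub[of E "V - range q" w0] compo_self[OF w0, of E] cset_compo[OF sg w0] by (auto simp: Cd)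
  show "finite C" using C fin finite_subset[of C V] by auto
qed

lemma n4: "4 \<le> n" using qc en by (cases "n = 3") (auto simp: cycf_def)

text \<open>The complement of such a cycle has a component containing \<open>C\<close>, which equals
  \<open>C\<close> by maximality.\<close>

lemma evq_other:
  assumes "cycf E q' n'" "even n'" "range q' \<subseteq> V - C" shows "evq C q' n' w0"
proof -
  let ?C = "compo E (V - range q') w0"
  have sub: "C \<subseteq> ?C"
  proof
    fix u assume "u \<in> C"
    then have "con E C w0 u" using con_sym[OF sg cset_con[OF sg CS(3)]] by blast
    then have "con E (V - range q') w0 u" by (rule con_mono) (use CS assms in auto)
    then show "u \<in> ?C" by (simp add: compo_def)
  qed
  have e: "evq ?C q' n' w0" unfolding evq_def
    using assms CS oddC cy_mono[OF _ sub] by auto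
  have "finite ?C" using compo_sub[of E "V - range q'" w0] fin finite_subset[of ?C V] by auto
  then have "C = ?C" using card_seteq[OF _ sub mx[OF e]] by simp
  then show ?thesis using e by simp
qed

text \<open>A neighbour of \<open>C\<close> missed by the cycle would belong to the component, which
  is \<open>C\<close> itself by \<open>evq_other\<close>.\<close>

lemma other_att:
  assumes "cycf E q' n'" "even n'" "range q' \<subseteq> V - C" "a \<in> C" "E a c" "c \<in> V" "c \<notin> C"
  shows "c \<in> range q'"
proof (rule ccontr)
  assume n: "c \<notin> range q'"
  have "C = compo E (V - range q') w0" using evq_other[OF assms(1-3)] by (simp add: evq_def)
  then show False using compo_closed[OF sg, of a "V - range q'" w0 c] assms n by auto
qed

text \<open>Otherwise \<open>p1\<close> and \<open>p2\<close> would separate \<open>B\<close> from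
  the rest of the cycle.\<close>

lemma attach3:
  assumes B: "B = compo E (V - range q) b0" "b0 \<in> V - range q" and p: "p1 \<in> range q" "p2 \<in> range q"
  shows "\<exists>b\<in>B. \<exists>d\<in>range q. d \<noteq> p1 \<and> d \<noteq> p2 \<and> E b d"
proof (rule ccontr)
  assume n: "\<not> ?thesis"
  have BS: "B \<subseteq> V - range q" "b0 \<in> B" using compo_sub[of E "V - range q" b0] compo_self[OF B(2), of E] by (auto simp: B)
  have cl: "clo E V B {p1,p2}"
  proof (rule cloI)
    fix a b assume ab: "a \<in> B" "b \<in> V" "E a b" "b \<notin> B"
    then have "b \<in> range q" using compo_closed[OF sg, of a "V - range q" b0 b] by (auto simp: B)
    then show "b \<in> {p1,p2}" using n ab by blast
  qed
  have "\<not> range q \<subseteq> {p1,p2}"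
  proof
    assume "range q \<subseteq> {p1,p2}"
    then have "card (range q) \<le> card {p1,p2}" by (rule card_mono[rotated]) simp
    also have "\<dots> \<le> 2" by (simp add: card_insert_if)
    finally show False using cycf_card[OF qc] n4 by simp
  qed
  then obtain w where w: "w \<in> range q" "w \<noteq> p1" "w \<noteq> p2" by blast
  then have "w \<in> V" "w \<notin> B" "b0 \<noteq> p1" "b0 \<noteq> p2" using qV BS p B(2) by auto
  then show False using sep3[of B p1 p2 b0 w] BS cl w by blast
qed

text \<open>Both arcs have the parity of \<open>r\<close>, so with the path through \<open>B\<close>
  each of them closes to an even cycle avoiding \<open>C\<close>. A neighbour of \<open>C\<close> on
  \<open>q\<close> other than the two ends lies on only one arc, against
  \<open>other_att\<close>.\<close>

lemma pairB:
  assumes B: "B \<subseteq> V - range q" "B \<inter> C = {}" and k: "k1 < k2" "k2 < k1 + n"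
    and r: "pl E (B \<union> {q k1, q k2}) (q k1) (q k2) r" "even (r + (k2 - k1))" "2 \<le> r"
  shows False
proof -
  obtain b c where bc: "b \<in> C" "c \<in> range q" "c \<noteq> q k1" "c \<noteq> q k2" "E b c" using attach3[OF Cd w0] by blast
  have neq: "q k1 \<noteq> q k2"
  proof
    assume "q k1 = q k2"
    then have "k1 = k2" by (rule inj_onD[OF cycf_inj[OF qc, of k1]]) (use k in auto)
    then show False using k by simp
  qed
  have go: "c \<in> A" if A: "pl E A (q k1) (q k2) j" "A \<subseteq> range q" "even (r + j)" for A j
  proof -
    have "cy E (B \<union> {q k1, q k2} \<union> A) (r + j)"
      by (rule cyI[OF sg r(1) A(1)]) (use B A neq r(3) pl_pos[OF A(1) neq] in auto)
    then obtain q' where q': "cycf E q' (r + j)" "range q' \<subseteq> B \<union> {q k1, q k2} \<union> A" by (rule cy_cycf)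
    have "B \<union> {q k1, q k2} \<union> A \<subseteq> V - C" using B A(2) CS(1) qV by blast
    then have "range q' \<subseteq> V - C" using q'(2) by blast
    moreover have "c \<in> V" "c \<notin> C" using bc(2) qV CS(1) by auto
    ultimately have "c \<in> range q'" by (rule other_att[OF q'(1) A(3) _ bc(1,5)])
    then have "c \<in> B \<union> {q k1, q k2} \<union> A" using q'(2) by blast
    then show ?thesis using bc B by blast
  qed
  have c1: "c \<in> q ` {k1..k2}"
    by (rule go[OF cycf_arc[OF qc]]) (use k r in auto)
  have "(k1 + n - k2) + (k2 - k1) = n" using k by simp
  then have "even (k1 + n - k2) = even (k2 - k1)" using en by (metis even_add)
  then have "even (r + (k1 + n - k2))" using r(2) by auto
  then have c2': "c \<in> q ` {k2..k1 + n}" by (intro go[OF cycf_arc2[OF sg qc k]]) auto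
  obtain i where i: "c = q i" "k1 \<le> i" "i \<le> k2" using c1 by auto
  obtain j where j: "c = q j" "k2 \<le> j" "j \<le> k1 + n" using c2' by auto
  have "i \<noteq> k1" "i \<noteq> k2" "j \<noteq> k2" using bc i j by auto
  moreover have "j \<noteq> k1 + n"
  proof
    assume "j = k1 + n"
    then have "c = q k1" using j qc by (simp add: cycf_def)
    then show False using bc by simp
  qed
  ultimately have "i = j" using inj_onD[OF cycf_inj[OF qc, of k1], of i j] i j k by auto
  then show False using i j \<open>i \<noteq> k2\<close> by auto
qed

text \<open>Two of three attachments of another component agree in parity, so a path through that component makes
  an even cycle with either arc between them; one of the two arcs misses an attachment of \<open>C\<close>, and
  \<open>C\<close> could be enlarged.\<close>

lemma whole: "V = range q \<union> C"
proof (rule ccontr)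
  assume n: "\<not> ?thesis"
  then obtain b0 where b0: "b0 \<in> V - range q" "b0 \<notin> C" using qV CS by blast
  define B where "B = compo E (V - range q) b0"
  have BS: "B \<subseteq> V - range q" "cset E B b0" using compo_sub[of E "V - range q" b0] cset_compo[OF sg b0(1)] by (auto simp: B_def)
  have dis: "B \<inter> C = {}"
  proof (rule ccontr)
    assume "B \<inter> C \<noteq> {}"
    then obtain u where "con E (V - range q) w0 u" "con E (V - range q) b0 u" by (auto simp: Cd B_def compo_def)
    then have "con E (V - range q) w0 b0" using con_trans[OF sg] con_sym[OF sg] by metis
    then show False using b0 by (simp add: Cd compo_def)
  qed
  note at = attach3[OF B_def b0(1)]
  obtain u1 d1 where u1: "u1 \<in> B" "d1 \<in> range q" "E u1 d1" using at[of "q 0" "q 0"] by blast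
  obtain u2 d2 where u2: "u2 \<in> B" "d2 \<in> range q" "d2 \<noteq> d1" "E u2 d2" using at[OF u1(2,2)] by blast
  obtain u3 d3 where u3: "u3 \<in> B" "d3 \<in> range q" "d3 \<noteq> d1" "d3 \<noteq> d2" "E u3 d3" using at[OF u1(2) u2(2)] by blast
  obtain a b c where t: "pl E B u1 u2 (a + b)" "pl E B u1 u3 (a + c)" "pl E B u2 u3 (b + c)"
    using tripod[OF sg BS(2) u1(1) u2(1) u3(1)] by blast
  have key: False if h: "pl E B u v j" "u \<in> B" "v \<in> B" "E u (q k)" "E v (q l)" "k < l" "l < k + n" "even (j + (l - k))" for u v j k l
  proof (rule pairB[OF BS(1) dis h(6,7)])
    have "q k \<noteq> q l"
    proof
      assume "q k = q l"
      then have "k = l" by (rule inj_onD[OF cycf_inj[OF qc, of k]]) (use h in auto)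
      then show False using h by simp
    qed
    have uq: "u \<notin> range q" "v \<notin> range q" using h BS by auto
    have e1: "pl E {q k, u} (q k) u 1" by (rule pl_edge) (use h sym uq in auto)
    have e2: "pl E {v, q l} v (q l) 1" by (rule pl_edge) (use h uq in auto)
    have "pl E (B \<union> {q k}) (q k) v (1 + j)" by (rule pl_append'[OF e1 h(1)]) (use h(2) BS in auto)
    then show "pl E (B \<union> {q k, q l}) (q k) (q l) (j + 2)"
      by (rule pl_append'[OF _ e2]) (use h(3) BS \<open>q k \<noteq> q l\<close> in auto)
  qed (use h(8) in auto)
  have rg: "range q = q ` {0..<0 + n}" by (rule cycf_range[OF qc])
  obtain k1 where k1: "d1 = q k1" "k1 < n" using u1(2) rg by auto
  obtain k2 where k2: "d2 = q k2" "k2 < n" using u2(2) rg by auto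
  obtain k3 where k3: "d3 = q k3" "k3 < n" using u3(2) rg by auto
  have key2: False if h: "pl E B u v (i + j)" "u \<in> B" "v \<in> B" "E u (q k)" "E v (q l)" "q k \<noteq> q l" "k < n" "l < n" "even (k + i) = even (l + j)" for u v i j k l
  proof -
    have "k \<noteq> l" using h(6) by auto
    then consider "k < l" | "l < k" by linarith
    then show False
    proof cases
      case 1
      have "even ((i + j) + (l - k))" using h(9) 1 by auto
      then show False using key[OF h(1-5) 1] h(8) by simp
    next
      case 2
      have "even ((i + j) + (k - l))" using h(9) 2 by auto
      then show False using key[OF pl_sym[OF sg h(1)] h(3,2,5,4) 2] h(7) by simp
    qed
  qed
  \<comment> \<open>Among three attachments, two agree in the parity of the index plus the length of
    the leg.\<close>
  consider "even (k1 + a) = even (k2 + b)" | "even (k1 + a) = even (k3 + c)" | "even (k2 + b) = even (k3 + c)" by blast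
  then show False
  proof cases
    case 1 then show False using key2[OF t(1) u1(1) u2(1), of k1 k2] u1 u2 k1 k2 by auto
  next
    case 2 then show False using key2[OF t(2) u1(1) u3(1), of k1 k3] u1 u3 k1 k3 by auto
  next
    case 3 then show False using key2[OF t(3) u2(1) u3(1), of k2 k3] u2 u3 k2 k3 by auto
  qed
qed

lemma rotq: "cex_even E V m (\<lambda>i. q (i + r)) n C w0"
proof (intro cex_even.intro cex_axioms cex_even_axioms.intro)
  show "evq C (\<lambda>i. q (i + r)) n w0"
    unfolding evq_def cycf_shift_range[OF qc] using cycf_shift[OF qc, of r] en qV w0 Cd oddC by blast
qed (use mx m in auto)

text \<open>Otherwise \<open>q 0\<close> has two chords, and \<open>theta_even\<close> gives an even
  cycle among \<open>q 0\<close>, ..., \<open>q j\<close> with j < n - 1. It avoids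
  \<open>C\<close>, so by \<open>whole\<close> its vertices together with \<open>C\<close> are all
  vertices, although \<open>q (n - 1)\<close> is missing.\<close>

lemma q0_nbr: "\<exists>u\<in>C. E u (q 0)"
proof (rule ccontr)
  assume nn: "\<not> ?thesis"
  define I where "I = {j\<in>{1..<n}. E (q 0) (q j)}"
  have fI: "finite I" by (simp add: I_def)
  have "{u\<in>V. E (q 0) u} \<subseteq> q ` I"
  proof
    fix u assume "u \<in> {u\<in>V. E (q 0) u}"
    then have u: "u \<in> range q" "E (q 0) u" using nn whole sym by blast+
    then obtain j where j: "u = q j" "j < n" using cycf_range[OF qc, of 0] by auto
    have "j \<noteq> 0"
    proof
      assume "j = 0"
      then show False using u(2) j(1) irr by simp
    qed
    then show "u \<in> q ` I" using j u by (auto simp: I_def)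
  qed
  then have "card {u\<in>V. E (q 0) u} \<le> card (q ` I)" by (rule card_mono[OF finite_imageI[OF fI]])
  also have "\<dots> \<le> card I" by (rule card_image_le[OF fI])
  finally have "4 \<le> card I" using deg[of "q 0"] qV m by fastforce
  moreover have "card I - card {1,n-1} \<le> card (I - {1,n-1})" by (rule diff_card_le_card_Diff) simp
  moreover have "card {1,n-1} \<le> 2" by (simp add: card_insert_if)
  ultimately have "2 \<le> card (I - {1,n-1})" by linarith
  then obtain i j where ij: "i \<in> I - {1,n-1}" "j \<in> I - {1,n-1}" "i < j" by (rule two_in_set[OF finite_Diff[OF fI]])
  have b: "2 \<le> i" "j < n - 1" using ij by (auto simp: I_def)
  have "\<exists>k. even k \<and> cy E (q ` {0..j}) k"
  proof (rule theta_even[OF sg _ _ b(1) ij(3)])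
    show "inj_on q {0..j}" by (rule inj_on_subset[OF cycf_inj[OF qc, of 0]]) (use b in auto)
  qed (use ij qc in \<open>auto simp: I_def cycf_def\<close>)
  then obtain k where k: "even k" "cy E (q ` {0..j}) k" by blast
  obtain q' where q': "cycf E q' k" "range q' \<subseteq> q ` {0..j}" by (rule cy_cycf[OF k(2)])
  have "range q' \<subseteq> range q" using q'(2) by blast
  then have "range q' \<subseteq> V - C" using qV CS(1) by blast
  then have "evq C q' k w0" by (rule evq_other[OF q'(1) k(1)])
  then have "cex_even E V m q' k C w0"
    by (intro cex_even.intro cex_axioms cex_even_axioms.intro) (use mx m in auto)
  then have "V = range q' \<union> C" by (rule cex_even.whole)
  moreover have "q (n - 1) \<in> V" "q (n - 1) \<notin> C" using qV CS by auto
  ultimately have "q (n - 1) \<in> q ` {0..j}" using q' by blast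
  then obtain i' where i': "q (n - 1) = q i'" "i' \<le> j" by auto
  have "n - 1 = i'" by (rule inj_onD[OF cycf_inj[OF qc, of 0] i'(1)]) (use i' b n4 in auto)
  then show False using i' b by simp
qed

lemma q_nbr: "\<exists>u\<in>C. E u (q i)"
  using cex_even.q0_nbr[OF rotq[of i]] by simp

text \<open>\<open>K s\<close> is the part of \<open>C\<close> cut off by \<open>s\<close> from an odd cycle in \<open>C\<close>. These sets form a laminar family.
  If \<open>q i\<close> and \<open>q (i + h - 1)\<close> are never linked to the odd cycle by disjoint paths, then the neighbours of all
  \<open>q i\<close> with \<open>i\<close> of fixed parity lie in one \<open>K s\<close>, and two vertices separate the graph.\<close>

lemma no_cex_even: False
proof -
  obtain h where h: "n = 2 * h" using en by blast
  have h2: "2 \<le> h" using n4 h by simp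
  obtain g where g: "odd g" "cy E C g" using oddC by blast
  obtain f where f: "cycf E f g" "range f \<subseteq> C" by (rule cy_cycf[OF g(2)])
  have qC: "q i \<in> V" "q i \<notin> C" for i using qV CS by auto
  have per: "q (i + n) = q i" for i using qc by (simp add: cycf_def)
  have conC: "con E C u v" if "u \<in> C" "v \<in> C" for u v
    by (rule cset_con[OF sg cset_any[OF sg CS(3) that(2)] that(1)])
  define K where "K s = {u\<in>C. \<not> (\<exists>w\<in>range f. con E (C - {s}) u w)}" for s
  have selfK: "s \<in> K s" if s: "s \<in> C" for s
  proof -
    have "\<not> con E (C - {s}) s w" for w using con_in(1)[of E "C - {s}" s w] by blast
    then show ?thesis using s by (simp add: K_def)
  qed
  have KC: "K s \<subseteq> C" for s by (auto simp: K_def)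
  have notK: "\<exists>w\<in>range f. con E (C - {s}) u w" if "u \<in> C" "u \<notin> K s" for u s using that by (auto simp: K_def)
  have inK: "u \<notin> K s" if "con E (C - {s}) u w" "w \<in> range f" for u s w using that by (auto simp: K_def)

  \<comment> \<open>Otherwise \<open>oddlink\<close> joins the two vertices through \<open>C\<close>
    by a path of prescribed parity, and the arcs of lengths h - 1 and h + 1 close it to two odd
    cycles, as many as m = 2 asks for.\<close>
  have step: "\<exists>s\<in>C. \<forall>u\<in>C. E u (q i) \<or> E u (q (i + (h - 1))) \<longrightarrow> u \<in> K s" for i
  proof (rule ccontr)
    assume n0: "\<not> ?thesis"
    let ?x = "q i" and ?y = "q (i + (h - 1))"
    let ?S = "C \<union> {?x, ?y}"
    have xy: "?x \<noteq> ?y"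
    proof
      assume "?x = ?y"
      then have "i = i + (h - 1)" by (rule inj_onD[OF cycf_inj[OF qc, of i]]) (use h h2 in auto)
      then show False using h2 by simp
    qed
    have sep: "\<exists>a\<in>{?x,?y}. \<exists>b\<in>range f. con E (?S - {s}) a b" for s
    proof -
      have "\<exists>a\<in>{?x,?y}. \<exists>u\<in>C. a \<noteq> s \<and> E u a \<and> (\<exists>w\<in>range f. con E (C - {s}) u w)"
      proof (cases "s \<in> C")
        case True
        then obtain u where u: "u \<in> C" "E u ?x \<or> E u ?y" "u \<notin> K s" using n0 by blast
        then obtain a where "a \<in> {?x,?y}" "E u a" by blast
        moreover have "a \<noteq> s" using \<open>a \<in> {?x,?y}\<close> True qC by auto
        ultimately show ?thesis using notK[OF u(1,3)] u(1) by blast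
      next
        case False
        obtain a where a: "a \<in> {?x,?y}" "a \<noteq> s" using xy by auto
        obtain u where u: "u \<in> C" "E u a" using a q_nbr[of i] q_nbr[of "i + (h - 1)"] by auto
        have "con E C u (f 0)" by (rule conC) (use u f in auto)
        moreover have "C - {s} = C" using False by auto
        ultimately have "con E (C - {s}) u (f 0)" by simp
        then have "\<exists>w\<in>range f. con E (C - {s}) u w" by blast
        then show ?thesis using a u by blast
      qed
      then obtain a u w where a: "a \<in> {?x,?y}" "u \<in> C" "a \<noteq> s" "E u a" "w \<in> range f" "con E (C - {s}) u w" by blast
      have "con E (?S - {s}) w u" by (rule con_mono[OF con_sym[OF sg a(6)]]) auto
      then have "con E (?S - {s}) w a" by (rule con_step[OF sg _ a(4)]) (use a in auto)
      then show ?thesis using con_sym[OF sg] a by blast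
    qed
    obtain r where r: "pl E ?S ?x ?y r" "even r = even h"
      using oddlink[OF sg _ _ _ f(1) g(1) _ sep, of "even h"] CS(4) f(2) by auto
    have o: "odd (r + (h - 1))" using r(2) h2 by auto
    have r1: "1 \<le> r" by (rule pl_pos[OF r(1) xy])
    have a1: "pl E (q ` {i..i + (h - 1)}) ?x ?y (h - 1)"
      using cycf_arc[OF qc, of i "i + (h - 1)"] h h2 by simp
    have a2: "pl E (q ` {i + (h - 1)..i + n}) ?x ?y (h + 1)"
    proof -
      have "pl E (q ` {i + (h - 1)..i + n}) ?x ?y (i + n - (i + (h - 1)))"
        by (rule cycf_arc2[OF sg qc]) (use h h2 in auto)
      moreover have "i + n - (i + (h - 1)) = h + 1" using h h2 by linarith
      ultimately show ?thesis by simp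
    qed
    have c: "cy E V (r + j)" if "pl E A ?x ?y j" "A \<subseteq> range q" "odd (r + j)" for A j
    proof -
      have "3 \<le> r + j" by (rule odd_sum_ge3[OF that(3) r1 pl_pos[OF that(1) xy]])
      then show ?thesis by (intro cyI[OF sg r(1) that(1)]) (use that(2) CS qV xy in auto)
    qed
    have c1: "cy E V (r + (h - 1))" by (rule c[OF a1]) (use o in auto)
    have "odd (r + (h + 1))" using o h2 by auto
    then have c2': "cy E V (r + (h + 1))" by (intro c[OF a2]) auto
    show False
    proof (rule ng[OF o])
      fix j assume "j < m"
      then have "j = 0 \<or> j = 1" using m by auto
      moreover have "r + (h - 1) + 2 = r + (h + 1)" using h2 by simp
      ultimately show "cy E V (r + (h - 1) + 2 * j)" using c1 c2' by (elim disjE) simp_all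
    qed
  qed

  \<comment> \<open>Every way from \<open>u\<close> to the odd cycle passes \<open>t\<close>, and
    every way from \<open>t\<close> passes \<open>s\<close>.\<close>
  have sub1: "K t \<subseteq> K s" if st: "t \<in> K s" "s \<in> C" for s t
  proof
    fix u assume u: "u \<in> K t"
    show "u \<in> K s"
    proof (rule ccontr)
      assume nu: "u \<notin> K s"
      have uC: "u \<in> C" "t \<in> C" using u st KC by auto
      obtain w where w: "w \<in> range f" "con E (C - {s}) u w" using notK[OF uC(1) nu] by blast
      have ut: "u \<noteq> t" using nu st by auto
      have us: "u \<in> C - {s,t}" using con_in(1)[OF w(2)] ut by auto
      let ?W = "compo E (C - {s,t}) u"
      have wW: "w \<notin> ?W"
      proof
        assume "w \<in> ?W"
        then have "con E (C - {s,t}) u w" by (simp add: compo_def)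
        then have "con E (C - {t}) u w" by (rule con_mono) auto
        then show False using inK[OF _ w(1)] u by blast
      qed
      obtain c d where cd: "c \<in> ?W" "d \<notin> ?W" "c \<in> C - {s}" "d \<in> C - {s}" "E c d"
        by (rule con_exit[OF sg w(2) compo_self[OF us] wW])
      have "d = t" using compo_closed[OF sg cd(1) _ cd(5)] cd(2,4) by blast
      have "con E (C - {s,t}) u c" using cd(1) by (simp add: compo_def)
      then have "con E (C - {s}) u c" by (rule con_mono) auto
      then have "con E (C - {s}) u d" by (rule con_step[OF sg _ cd(5,4)])
      then have "con E (C - {s}) t w" using con_trans[OF sg con_sym[OF sg] w(2)] \<open>d = t\<close> by blast
      then show False using inK[OF _ w(1)] st by blast
    qed
  qed
  \<comment> \<open>Otherwise the first of \<open>s\<close>, \<open>t\<close> on a way from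
    \<open>u\<close> to the odd cycle would reach that cycle without the other one, and so would
    \<open>u\<close>.\<close>
  have meet: "s \<in> K t \<or> t \<in> K s" if st: "s \<in> C" "t \<in> C" "u \<in> K s" "u \<in> K t" for s t u
  proof (rule ccontr)
    assume nn: "\<not> ?thesis"
    have uC: "u \<in> C" using st KC by auto
    have us: "u \<in> C - {s,t}" using nn st uC by auto
    let ?W = "compo E (C - {s,t}) u"
    have f0: "f 0 \<in> C" using f by auto
    have cu: "con E C u (f 0)" by (rule conC[OF uC f0])
    have wW: "f 0 \<notin> ?W"
    proof
      assume "f 0 \<in> ?W"
      then have "con E (C - {s,t}) u (f 0)" by (simp add: compo_def)
      then have "con E (C - {t}) u (f 0)" by (rule con_mono) auto
      then show False using inK[of t u "f 0"] st by blast
    qed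
    obtain c d where cd: "c \<in> ?W" "d \<notin> ?W" "c \<in> C" "d \<in> C" "E c d"
      by (rule con_exit[OF sg cu compo_self[OF us] wW])
    have d: "d = s \<or> d = t" using compo_closed[OF sg cd(1) _ cd(5)] cd(2,4) by blast
    have uc: "con E (C - {s,t}) u c" using cd(1) by (simp add: compo_def)
    have fin: False if xy: "{x,y} = {s,t}" "d = x" for x y
    proof -
      have xys: "x \<notin> K y" "u \<in> K y" "x \<in> C" "x \<noteq> y" using xy nn st selfK by (auto simp: doubleton_eq_iff)
      have "con E (C - {y}) u c" by (rule con_mono[OF uc]) (use xy in auto)
      then have ux: "con E (C - {y}) u x" by (rule con_step[OF sg]) (use cd xy xys in auto)
      obtain w where w: "w \<in> range f" "con E (C - {y}) x w" using notK[OF xys(3,1)] by blast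
      have "con E (C - {y}) u w" by (rule con_trans[OF sg ux w(2)])
      then show False using inK[OF _ w(1)] xys by blast
    qed
    show False using d fin[of s t] fin[of t s] by auto
  qed

  have gate: "\<exists>s\<in>C. \<forall>j. \<forall>u\<in>C. E u (q (i + 2 * j)) \<longrightarrow> u \<in> K s" for i
  proof -
    obtain u0 where u0: "u0 \<in> C" "E u0 (q i)" using q_nbr by blast
    define P where "P s \<longleftrightarrow> s \<in> C \<and> u0 \<in> K s" for s
    have P0: "P u0" using u0 selfK by (simp add: P_def)
    have "\<forall>s. P s \<longrightarrow> card (K s) < card C + 1" using card_mono[OF CS(4) KC] by (auto simp: less_Suc_eq_le)
    then obtain s where s: "P s" and smx: "\<forall>t. P t \<longrightarrow> card (K t) \<le> card (K s)"
      using ex_has_greatest_nat[of P u0 "\<lambda>s. card (K s)" "card C + 1"] P0 by blast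
    have sC: "s \<in> C" "u0 \<in> K s" using s by (auto simp: P_def)
    \<comment> \<open>By \<open>meet\<close> and \<open>sub1\<close>, a largest set
      \<open>K s\<close> containing \<open>u0\<close> absorbs every \<open>K t\<close> that meets
      it.\<close>
    have big: "K t \<subseteq> K s" if t: "t \<in> C" "u \<in> K t" "u \<in> K s" for t u
    proof (cases "t \<in> K s")
      case True then show ?thesis using sub1 sC by blast
    next
      case False
      then have "s \<in> K t" using meet[OF sC(1) t(1) t(3,2)] by blast
      then have ks: "K s \<subseteq> K t" using sub1 t by blast
      then have "P t" using t sC by (auto simp: P_def)
      then have "card (K t) \<le> card (K s)" using smx by blast
      then have "K s = K t" using card_seteq[OF finite_subset[OF KC CS(4)] ks] by simp
      then show ?thesis by simp
    qed
    define Q where "Q j \<longleftrightarrow> (\<forall>u\<in>C. E u (q j) \<longrightarrow> u \<in> K s)" for j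
    have "Q i"
    proof -
      obtain t where t: "t \<in> C" "\<forall>u\<in>C. E u (q i) \<or> E u (q (i + (h - 1))) \<longrightarrow> u \<in> K t" using step by blast
      then have "u0 \<in> K t" using u0 by blast
      then have "K t \<subseteq> K s" by (rule big[OF t(1) _ sC(2)])
      then show ?thesis using t by (auto simp: Q_def)
    qed
    \<comment> \<open>Applied at j + h + 1, \<open>step\<close> also reaches the index j + n, which
      stands for \<open>q j\<close>; so the property passes from j to j + h + 1 and, in two such
      moves, to j + 2 up to the period.\<close>
    have stepQ: "Q (j + (h + 1))" if "Q j" for j
    proof -
      obtain t where t: "t \<in> C" "\<forall>u\<in>C. E u (q (j + (h + 1))) \<or> E u (q (j + (h + 1) + (h - 1))) \<longrightarrow> u \<in> K t" using step by blast
      have "j + (h + 1) + (h - 1) = j + n" using h h2 by simp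
      then have eq: "q (j + (h + 1) + (h - 1)) = q j" using per[of j] by (simp only:)
      obtain u where u: "u \<in> C" "E u (q j)" using q_nbr by blast
      then have "u \<in> K t" "u \<in> K s" using t(2) eq \<open>Q j\<close> by (auto simp: Q_def)
      then have "K t \<subseteq> K s" by (rule big[OF t(1)])
      then show ?thesis using t by (auto simp: Q_def)
    qed
    have step2: "Q (j + 2)" if "Q j" for j
    proof -
      have "Q (j + (h + 1) + (h + 1))" using stepQ stepQ[OF that] by blast
      moreover have "j + (h + 1) + (h + 1) = (j + 2) + n" using h by simp
      ultimately have "Q ((j + 2) + n)" by (simp only:)
      then show ?thesis unfolding Q_def per .
    qed
    have "Q (i + 2 * j)" for j
    proof (induction j)
      case (Suc j)
      then have "Q (i + 2 * j + 2)" by (rule step2)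
      then show ?case by simp
    qed (use \<open>Q i\<close> in simp)
    then show ?thesis using sC unfolding Q_def by blast
  qed
  obtain s0 where s0: "s0 \<in> C" "\<forall>j. \<forall>u\<in>C. E u (q (0 + 2 * j)) \<longrightarrow> u \<in> K s0" using gate by blast
  obtain s1 where s1: "s1 \<in> C" "\<forall>j. \<forall>u\<in>C. E u (q (1 + 2 * j)) \<longrightarrow> u \<in> K s1" using gate by blast
  have qK: "u \<in> K s0 \<union> K s1" if "u \<in> C" "E u (q i)" for u i
  proof (cases "even i")
    case True
    then obtain j where "i = 0 + 2 * j" by auto
    then show ?thesis using s0 that by blast
  next
    case False
    then obtain j where "i = 1 + 2 * j" by (metis oddE add.commute)
    then show ?thesis using s1 that by blast
  qed
  let ?L = "C - (K s0 \<union> K s1)"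
  have "\<not> range f \<subseteq> {s0,s1}"
  proof
    assume "range f \<subseteq> {s0,s1}"
    then have "card (range f) \<le> card {s0,s1}" by (rule card_mono[rotated]) simp
    also have "\<dots> \<le> 2" by (simp add: card_insert_if)
    finally show False using cycf_card[OF f(1)] f(1) by (simp add: cycf_def)
  qed
  then obtain w where w: "w \<in> range f" "w \<noteq> s0" "w \<noteq> s1" by blast
  have wC: "w \<in> C" using w f by auto
  have wL: "w \<in> ?L"
  proof -
    have "con E (C - {s0}) w w" "con E (C - {s1}) w w" using w wC by (auto intro!: con_refl)
    then show ?thesis using inK[OF _ w(1)] wC by blast
  qed
  have edge: "b = s" if ab: "a \<in> C" "a \<notin> K s" "b \<in> K s" "E a b" for a b s
  proof (rule ccontr)
    assume bs: "b \<noteq> s"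
    obtain v where v: "v \<in> range f" "con E (C - {s}) a v" using notK[OF ab(1,2)] by blast
    have "con E (C - {s}) v b" by (rule con_step[OF sg con_sym[OF sg v(2)] ab(4)]) (use ab bs KC in auto)
    then have "con E (C - {s}) b v" by (rule con_sym[OF sg])
    then show False using inK[OF _ v(1)] ab by blast
  qed
  \<comment> \<open>A vertex of \<open>L\<close> has no neighbour on the even cycle, and an edge
    from it enters \<open>K s0\<close> or \<open>K s1\<close> only at \<open>s0\<close> or
    \<open>s1\<close>.\<close>
  have "clo E V ?L {s0,s1}"
  proof (rule cloI)
    fix a b assume ab: "a \<in> ?L" "b \<in> V" "E a b" "b \<notin> ?L"
    have "b \<notin> range q" using qK ab by blast
    then have "b \<in> K s0 \<or> b \<in> K s1" using whole ab by blast
    then show "b \<in> {s0,s1}" using edge[of a s0 b] edge[of a s1 b] ab by blast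
  qed
  then show False using sep3[of ?L s0 s1 w "q 0"] wL w CS qC[of 0] s0(1) s1(1) by blast
qed

end

lemma (in cex_odd) no_cex_odd: False
proof -
  define P where "P C \<longleftrightarrow> (\<exists>q n w0. evq C q n w0)" for C
  obtain C0 where C0: "P C0" using ex_evq by (auto simp: P_def)
  have "\<forall>C. P C \<longrightarrow> card C < card V + 1"
  proof (intro allI impI)
    fix C assume "P C"
    then obtain q n w0 where "evq C q n w0" by (auto simp: P_def)
    then have "C \<subseteq> V" using compo_sub[of E "V - range q" w0] by (auto simp: evq_def)
    then show "card C < card V + 1" using card_mono[OF fin] by (simp add: less_Suc_eq_le)
  qed
  then obtain C where C: "P C" and mx: "\<forall>C'. P C' \<longrightarrow> card C' \<le> card C"
    using ex_has_greatest_nat[of P C0 card "card V + 1"] C0 by blast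
  obtain q n w0 where e: "evq C q n w0" using C by (auto simp: P_def)
  have "cex_even E V m q n C w0"
    by (intro cex_even.intro cex_axioms cex_even_axioms.intro e m_eq_2) (use mx in \<open>auto simp: P_def\<close>)
  then show False by (rule cex_even.no_cex_even)
qed

lemma (in cex) no_cex: False
proof -
  define P where "P n \<longleftrightarrow> odd n \<and> cy E V n" for n
  obtain n0 where "P n0" using odd_cycle[OF sg fin nb] by (auto simp: P_def)
  then have L: "P (LEAST n. P n)" "\<And>n. P n \<Longrightarrow> (LEAST n. P n) \<le> n" by (auto intro: LeastI Least_le)
  define g where "g = (LEAST n. P n)"
  obtain h where h: "g = 2 * h + 1" using L(1) by (auto simp: P_def g_def elim!: oddE)
  have "cy E V g" using L(1) by (simp add: P_def g_def)
  then obtain f where f: "cycf E f g" "range f \<subseteq> V" by (rule cy_cycf)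
  have "cex_odd E V m f g h"
    by (intro cex_odd.intro cex_axioms cex_odd_axioms.intro f h) (use L(2) in \<open>auto simp: P_def g_def\<close>)
  then show False by (rule cex_odd.no_cex_odd)
qed

theorem consecutive_odd_cycles:
  assumes "sgr E" "finite V" "con2 E V" "\<not> bip E V" "\<And>v. v \<in> V \<Longrightarrow> 2 * m \<le> card {u\<in>V. E v u}"
  shows "\<exists>l. odd l \<and> (\<forall>i<m. cy E V (l + 2 * i))"
proof (rule ccontr)
  assume n: "\<not> ?thesis"
  have "cex E V m" by unfold_locales (use assms n in blast)+
  then show False by (rule cex.no_cex)
qed

section \<open>Directed graphs with symmetric arcs\<close>

text \<open>Connectedness of a digraph refers to the symmetric closure of its arcs, and symmetry of
  \<open>E\<close> absorbs the added arcs.\<close>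

lemma connected_con:
  assumes "sgr E" "\<And>u v. (u,v) \<in> arcs_ends G \<Longrightarrow> E u v" "Digraph_Component.connected (G \<restriction> S)" "a \<in> S" "b \<in> S"
  shows "con E S a b"
proof -
  let ?H = "with_proj (mk_symmetric (G \<restriction> S))"
  have v: "verts ?H = S" by (simp add: mk_symmetric_def)
  have e: "E u w" if "(u,w) \<in> arcs_ends ?H" for u w
  proof -
    have "(u,w) \<in> parcs (mk_symmetric (G \<restriction> S))" using that by (simp add: arcs_ends_conv)
    then obtain x where "x \<in> arcs G" "(u,w) = (tail G x, head G x) \<or> (u,w) = (head G x, tail G x)"
      by (auto simp: mk_symmetric_def induce_subgraph_def)
    then have "(u,w) \<in> arcs_ends G \<or> (w,u) \<in> arcs_ends G" by (auto simp: arcs_ends_conv)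
    then show ?thesis using assms(2) sgr_sym[OF assms(1)] by blast
  qed
  have "(a,b) \<in> rtrancl_on S (arcs_ends ?H)"
    using assms(3-5) unfolding connected_def strongly_connected_def reachable_def v by blast
  then show ?thesis
  proof (induction rule: rtrancl_on_induct)
    case base show ?case by (rule con_refl[OF assms(4)])
  next
    case (step b c)
    then show ?case using con_step[OF assms(1), of S a b c] e by blast
  qed
qed

lemma cy_has_cycle:
  assumes "wf_digraph G" "\<And>u v. E u v \<Longrightarrow> (u,v) \<in> arcs_ends G" "cy E (verts G) n"
  shows "has_cycle_of_length G n"
proof -
  interpret wf_digraph G by (rule assms(1))
  obtain f where f: "cycf E f n" "range f \<subseteq> verts G" by (rule cy_cycf[OF assms(3)])
  have "\<exists>x\<in>arcs G. tail G x = f i \<and> head G x = f (Suc i)" for i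
  proof -
    have "E (f i) (f (Suc i))" using f(1) by (simp add: cycf_def)
    then have "(f i, f (Suc i)) \<in> arcs_ends G" by (rule assms(2))
    then show ?thesis by (auto simp: arcs_ends_conv)
  qed
  then obtain x where x: "\<And>i. x i \<in> arcs G" "\<And>i. tail G (x i) = f i" "\<And>i. head G (x i) = f (Suc i)" by metis
  have up: "[i..<i + Suc j] = i # [Suc i..<Suc i + j]" for i j :: nat by (simp add: upt_conv_Cons del: upt_Suc)
  have cas: "cas (f i) (map x [i..<i + j]) (f (i + j))" for i j
  proof (induction j arbitrary: i)
    case (Suc j)
    have "cas (f (Suc i)) (map x [Suc i..<Suc i + j]) (f (i + Suc j))" using Suc.IH[of "Suc i"] by (simp del: upt_Suc)
    then show ?case unfolding up list.map cas.simps x(2,3) by (intro conjI refl)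
  qed simp
  have verts: "awalk_verts (f i) (map x [i..<i + j]) = map f [i..<i + Suc j]" for i j
  proof (induction j arbitrary: i)
    case (Suc j)
    then show ?case unfolding up[of i] list.map awalk_verts.simps x(2,3) by (simp only: Suc.IH up)
  qed simp
  let ?p = "map x [0..<n]"
  have n: "3 \<le> n" using f by (simp add: cycf_def)
  have "f (0 + n) = f 0" using f unfolding cycf_def by blast
  then have "awalk (f 0) ?p (f 0)" unfolding awalk_def using cas[of 0 n] f(2) x(1) by auto
  moreover have "tl (awalk_verts (f 0) ?p) = map f [1..<1 + n]" using verts[of 0 n] up[of 0 n] by (simp del: upt_Suc)
  moreover have "distinct (map f [1..<1 + n])" using cycf_inj[OF f(1), of 1] by (simp add: distinct_map del: upt_Suc)
  ultimately have "cycle ?p" unfolding cycle_def using n by (metis diff_zero length_map length_upt list.size(3) not_numeral_le_zero)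
  then show ?thesis unfolding has_cycle_of_length_def using n by (intro exI[of _ ?p]) simp
qed

theorem theorem1p2:
  fixes G :: "('a, 'b) pre_digraph" and k :: nat
  assumes "1 \<le> k"
    and "graph G"
    and "vertex_connected 2 G"
    and "\<not> bipartite G"
    and "k + 1 \<le> min_degree G"
  shows "\<exists>l::nat. odd l \<and> (\<forall>i < nat \<lceil>real k / 2\<rceil>. has_cycle_of_length G (l + 2 * i))"
proof -
  interpret graph G by (rule assms(2))
  define E where "E u v \<longleftrightarrow> (u,v) \<in> arcs_ends G" for u v
  define m where "m = nat \<lceil>real k / 2\<rceil>"
  have mk: "2 * m \<le> k + 1" unfolding m_def by linarith
  have sg: "sgr E" unfolding sgr_def E_def
    using arcs_ends_symmetric[OF sym_arcs] no_loops by (auto simp: arcs_ends_conv)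
  have con: "con2 E (verts G)" unfolding con2_def
  proof (intro allI ballI)
    fix s a b assume ab: "a \<in> verts G - {s}" "b \<in> verts G - {s}"
    \<comment> \<open>\<open>con2\<close> lets \<open>s\<close> range over the whole type, whereas
      \<open>vertex_connected\<close> removes only sets of vertices.\<close>
    let ?X = "{s} \<inter> verts G"
    have "card ?X \<le> card {s}" by (rule card_mono) auto
    then have "card ?X < 2" by simp
    then have "Digraph_Component.connected (G \<restriction> (verts G - ?X))"
      using assms(3) unfolding vertex_connected_def by blast
    moreover have "verts G - ?X = verts G - {s}" by auto
    ultimately show "con E (verts G - {s}) a b"
      using connected_con[OF sg _ _ ab] by (simp add: E_def)
  qed
  have nb: "\<not> bip E (verts G)"
  proof
    assume "bip E (verts G)"
    then obtain A where A: "\<forall>a\<in>verts G. \<forall>b\<in>verts G. E a b \<longrightarrow> (a \<in> A \<longleftrightarrow> b \<notin> A)" by (auto simp: bip_def)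
    have "bipartite G" unfolding bipartite_def
    proof (intro exI conjI ballI)
      show "A \<inter> verts G \<union> (verts G - A) = verts G" "A \<inter> verts G \<inter> (verts G - A) = {}" by auto
      fix e assume e: "e \<in> arcs_ends G"
      obtain u v where uv: "e = (u,v)" by (cases e)
      have "u \<in> verts G" "v \<in> verts G" using e uv by (auto simp: arcs_ends_conv)
      then show "case e of (u, v) \<Rightarrow> u \<in> A \<inter> verts G \<and> v \<in> verts G - A \<or> u \<in> verts G - A \<and> v \<in> A \<inter> verts G"
        using A e uv by (auto simp: E_def)
    qed
    then show False using assms(4) by blast
  qed
  have deg: "2 * m \<le> card {u\<in>verts G. E v u}" if v: "v \<in> verts G" for v
  proof -
    have "min_degree G \<le> out_degree G v" unfolding min_degree_def using v by (intro Min_le) auto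
    also have "out_degree G v = card (head G ` out_arcs G v)" unfolding out_degree_def
    proof (rule card_image[symmetric], rule inj_onI)
      fix x y assume "x \<in> out_arcs G v" "y \<in> out_arcs G v" "head G x = head G y"
      then show "x = y" by (intro no_multi_arcs) (auto simp: arc_to_ends_def)
    qed
    also have "head G ` out_arcs G v = {u\<in>verts G. E v u}" by (auto simp: E_def arcs_ends_conv)
    finally show ?thesis using assms(5) mk by linarith
  qed
  obtain l where "odd l" "\<forall>i<m. cy E (verts G) (l + 2 * i)"
    using consecutive_odd_cycles[OF sg finite_verts con nb deg] by blast
  then show ?thesis using cy_has_cycle[OF wf_digraph_axioms, of E] unfolding m_def by (auto simp: E_def)
qed

end
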